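(* Let $d_1,d_2,s_1,s_2\in\mathbb{N}$ and put $S:=s_1+s_2$, $D:=d_1+d_2$. (i) Let $2\le p<\infty$ and $r>0$. Then there exists a constant $c>0$, independent of $r$, such that $$\liminf_{n\to\infty}\Big(\frac{r^{D/S}}{n}\Big)^{-\frac{pS}{2S+D}}\inf_{\tilde f}\sup_{f\in W^{(s_1,s_2)}_p(r)}\mathbb{E}_f\|\tilde f-f\|_p^p\ge c,$$ where the supremum is over probability density functions $f$ in $W^{(s_1,s_2)}_p(r)$. (ii) Let $1\le p<2$, let $r>0$ (with $r>1$ if $p=1$), set $r_*:=r-1$ if $p=1$ and $r_*:=r$ if $p>1$, and let $R>0$ be large enough. Then there exists a constant $c>0$, independent of $r_*$, such that $$\liminf_{n\to\infty}\Big(\frac{r_*^{D/S}}{n}\Big)^{-\frac{Sp}{2S+D}}\inf_{\tilde f}\sup_{f\in W^{(s_1,s_2)}_p(r,R)}\mathbb{E}_f\|\tilde f-f\|_p^p\ge c.$$ In both parts the infimum is taken over all possible estimators $\tilde f$ based on an i.i.d. sample of size $n$ from $f$.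
   Context: $\mathbb{N}$ denotes the positive integers and $\mathbb{N}_0$ the non-negative integers. For a multi-index $\alpha$, $|\alpha|$ denotes the sum of its entries. Norms $\|\cdot\|_p$ are $L^p$ norms with respect to Lebesgue measure. Sobolev space with dominating mixed smoothness: for $s_1,s_2\in\mathbb{N}$ and $1\le p<\infty$, a function $f$ on $\mathbb{R}^{d_1}\times\mathbb{R}^{d_2}$ belongs to $W^{(s_1,s_2)}_p$ when $$\|f\|_{W^{(s_1,s_2)}_p}:=\sum_{|\alpha_1|\le s_1,\ |\alpha_2|\le s_2}\|\partial_2^{\alpha_2}\partial_1^{\alpha_1}f\|_p<\infty,$$ where $\alpha_i\in\mathbb{N}_0^{d_i}$ and $\partial_i^{\alpha_i}$ denotes the (weak) partial derivative of multi-index $\alpha_i$ in the variables of $\mathbb{R}^{d_i}$. $W^{(s_1,s_2)}_p(r)$ is the closed ball $\{f:\|f\|_{W^{(s_1,s_2)}_p}\le r\}$. $W^{(s_1,s_2)}_p(r,R)$ is the set of all probability density functions $f\in W^{(s_1,s_2)}_p(r)$ such that $\operatorname{supp} f\subset\{(x,y):|(x,y)-(x_0,y_0)|\le R\}$ for some $(x_0,y_0)\in\mathbb{R}^{d_1}\times\mathbb{R}^{d_2}$. An estimator $\tilde f$ is a measurable function of the sample, i.e. of $n$ i.i.d. random variables in $\mathbb{R}^{d_1}\times\mathbb{R}^{d_2}$ with density $f$; $\mathbb{E}_f$ denotes expectation when the sample is i.i.d. with density $f$. *)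

theory Defs
  imports "HOL-Probability.Probability"
begin

section \<open>Test functions and partial derivatives\<close>

definition dir_deriv :: "'v::real_normed_vector \<Rightarrow> ('v \<Rightarrow> real) \<Rightarrow> 'v \<Rightarrow> real" where
  "dir_deriv v \<phi> z = deriv (\<lambda>t. \<phi> (z + t *\<^sub>R v)) 0"

text \<open>All iterated partial derivatives exist and are (totally) differentiable, hence continuous.\<close>

definition smooth :: "('v::euclidean_space \<Rightarrow> real) \<Rightarrow> bool" where
  "smooth \<phi> \<longleftrightarrow> (\<forall>vs. set vs \<subseteq> Basis \<longrightarrow> (\<forall>z. foldr dir_deriv vs \<phi> differentiable at z))"

definition supp :: "('v::topological_space \<Rightarrow> real) \<Rightarrow> 'v set" where
  "supp f = closure {z. f z \<noteq> 0}"

definition test_function :: "('v::euclidean_space \<Rightarrow> real) \<Rightarrow> bool" where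
  "test_function \<phi> \<longleftrightarrow> smooth \<phi> \<and> compact (supp \<phi>)"

text \<open>A multi-index in \<open>\<nat>\<^sub>0\<^sup>d\<close>, \<open>d = CARD('i)\<close>, is a function \<^typ>\<open>'i::finite \<Rightarrow> nat\<close>.
  The partial derivatives are taken in the order of some fixed enumeration of the finite index type;
  the order is irrelevant, as the operators are only applied to smooth functions.\<close>

definition indices :: "'i::finite list" where
  "indices = (SOME xs. distinct xs \<and> set xs = UNIV)"

definition multi_deriv :: "('i::finite \<Rightarrow> 'v::real_normed_vector) \<Rightarrow> ('i \<Rightarrow> nat) \<Rightarrow> ('v \<Rightarrow> real) \<Rightarrow> 'v \<Rightarrow> real" where
  "multi_deriv e \<alpha> \<phi> = foldr (\<lambda>i. dir_deriv (e i) ^^ \<alpha> i) indices \<phi>"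

definition partial1 ::
  "('m::finite \<Rightarrow> nat) \<Rightarrow> ((real^'m) \<times> (real^'n::finite) \<Rightarrow> real) \<Rightarrow> (real^'m) \<times> (real^'n) \<Rightarrow> real" where
  "partial1 = multi_deriv (\<lambda>i. (axis i 1, 0))"

definition partial2 ::
  "('n::finite \<Rightarrow> nat) \<Rightarrow> ((real^'m::finite) \<times> (real^'n) \<Rightarrow> real) \<Rightarrow> (real^'m) \<times> (real^'n) \<Rightarrow> real" where
  "partial2 = multi_deriv (\<lambda>j. (0, axis j 1))"

definition order :: "('i::finite \<Rightarrow> nat) \<Rightarrow> nat" where
  "order \<alpha> = (\<Sum>i\<in>UNIV. \<alpha> i)"


section \<open>Weak derivatives\<close>

definition locally_integrable :: "('v::euclidean_space \<Rightarrow> real) \<Rightarrow> bool" where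
  "locally_integrable f \<longleftrightarrow> (\<forall>K. compact K \<longrightarrow> set_integrable lborel K f)"

definition is_weak_deriv ::
  "('m::finite \<Rightarrow> nat) \<Rightarrow> ('n::finite \<Rightarrow> nat)
    \<Rightarrow> ((real^'m) \<times> (real^'n) \<Rightarrow> real) \<Rightarrow> ((real^'m) \<times> (real^'n) \<Rightarrow> real) \<Rightarrow> bool" where
  "is_weak_deriv \<alpha>1 \<alpha>2 f g \<longleftrightarrow> locally_integrable f \<and> locally_integrable g \<and>
     (\<forall>\<phi>. test_function \<phi> \<longrightarrow>
        (\<integral>z. f z * partial2 \<alpha>2 (partial1 \<alpha>1 \<phi>) z \<partial>lborel)
          = (-1) ^ (order \<alpha>1 + order \<alpha>2) * (\<integral>z. g z * \<phi> z \<partial>lborel))"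

text \<open>Unique almost everywhere when it exists; a junk value otherwise.\<close>

definition weak_deriv ::
  "('m::finite \<Rightarrow> nat) \<Rightarrow> ('n::finite \<Rightarrow> nat)
    \<Rightarrow> ((real^'m) \<times> (real^'n) \<Rightarrow> real) \<Rightarrow> (real^'m) \<times> (real^'n) \<Rightarrow> real" where
  "weak_deriv \<alpha>1 \<alpha>2 f = (SOME g. is_weak_deriv \<alpha>1 \<alpha>2 f g)"


section \<open>Sobolev spaces with dominating mixed smoothness\<close>

text \<open>Power with a positive real exponent, extended by \<open>\<infinity>\<close> at \<open>\<infinity>\<close>.\<close>

definition ennreal_powr :: "ennreal \<Rightarrow> real \<Rightarrow> ennreal" where
  "ennreal_powr x a = (if x = \<infinity> then \<infinity> else ennreal (enn2real x powr a))"

definition Lp_norm :: "real \<Rightarrow> ('v::euclidean_space \<Rightarrow> real) \<Rightarrow> ennreal" where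
  "Lp_norm p f = ennreal_powr (\<integral>\<^sup>+z. ennreal (\<bar>f z\<bar> powr p) \<partial>lborel) (1 / p)"

definition multi_indices :: "nat \<Rightarrow> ('i::finite \<Rightarrow> nat) set" where
  "multi_indices s = {\<alpha>. order \<alpha> \<le> s}"

lemma finite_multi_indices: "finite (multi_indices s :: ('i::finite \<Rightarrow> nat) set)"
proof (rule finite_subset)
  show "multi_indices s \<subseteq> PiE (UNIV :: 'i set) (\<lambda>_. {..s})"
    by (auto simp: multi_indices_def order_def PiE_def Pi_def
        intro: order_trans[OF member_le_sum[where A = UNIV]])
qed (auto intro!: finite_PiE)

definition weakly_differentiable :: "nat \<Rightarrow> nat \<Rightarrow> ((real^'m::finite) \<times> (real^'n::finite) \<Rightarrow> real) \<Rightarrow> bool" where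
  "weakly_differentiable s1 s2 f \<longleftrightarrow>
     (\<forall>\<alpha>1\<in>multi_indices s1. \<forall>\<alpha>2\<in>multi_indices s2. \<exists>g. is_weak_deriv \<alpha>1 \<alpha>2 f g)"

definition sobolev_norm ::
  "real \<Rightarrow> nat \<Rightarrow> nat \<Rightarrow> ((real^'m::finite) \<times> (real^'n::finite) \<Rightarrow> real) \<Rightarrow> ennreal" where
  "sobolev_norm p s1 s2 f =
     (\<Sum>(\<alpha>1, \<alpha>2) \<in> multi_indices s1 \<times> multi_indices s2. Lp_norm p (weak_deriv \<alpha>1 \<alpha>2 f))"

definition sobolev :: "real \<Rightarrow> nat \<Rightarrow> nat \<Rightarrow> ((real^'m::finite) \<times> (real^'n::finite) \<Rightarrow> real) set" where
  "sobolev p s1 s2 = {f. f \<in> borel_measurable borel \<and> weakly_differentiable s1 s2 f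
                         \<and> sobolev_norm p s1 s2 f < \<infinity>}"

definition sobolev_ball ::
  "real \<Rightarrow> nat \<Rightarrow> nat \<Rightarrow> real \<Rightarrow> ((real^'m::finite) \<times> (real^'n::finite) \<Rightarrow> real) set" where
  "sobolev_ball p s1 s2 r = {f \<in> sobolev p s1 s2. sobolev_norm p s1 s2 f \<le> ennreal r}"

definition prob_density :: "('v::euclidean_space \<Rightarrow> real) \<Rightarrow> bool" where
  "prob_density f \<longleftrightarrow> f \<in> borel_measurable borel \<and> (\<forall>z. 0 \<le> f z) \<and> (\<integral>\<^sup>+z. ennreal (f z) \<partial>lborel) = 1"

definition sobolev_densities ::
  "real \<Rightarrow> nat \<Rightarrow> nat \<Rightarrow> real \<Rightarrow> ((real^'m::finite) \<times> (real^'n::finite) \<Rightarrow> real) set" where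
  "sobolev_densities p s1 s2 r = {f \<in> sobolev_ball p s1 s2 r. prob_density f}"

definition sobolev_densities_supp ::
  "real \<Rightarrow> nat \<Rightarrow> nat \<Rightarrow> real \<Rightarrow> real \<Rightarrow> ((real^'m::finite) \<times> (real^'n::finite) \<Rightarrow> real) set" where
  "sobolev_densities_supp p s1 s2 r R =
     {f \<in> sobolev_densities p s1 s2 r. \<exists>z0. supp f \<subseteq> cball z0 R}"


section \<open>Estimators and minimax risk\<close>

text \<open>A sample of size \<open>n\<close> is a point of the \<open>n\<close>-fold product space. As usual, measurability of an
  estimator means joint measurability in the sample and the point of evaluation.\<close>

definition estimators :: "nat \<Rightarrow> ((nat \<Rightarrow> 'v::euclidean_space) \<Rightarrow> 'v \<Rightarrow> real) set" where
  "estimators n = {T. (\<lambda>(xs, z). T xs z) \<in> borel_measurable ((\<Pi>\<^sub>M i\<in>{..<n}. borel) \<Otimes>\<^sub>M borel)}"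

definition sample_measure :: "nat \<Rightarrow> ('v::euclidean_space \<Rightarrow> real) \<Rightarrow> (nat \<Rightarrow> 'v) measure" where
  "sample_measure n f = (\<Pi>\<^sub>M i\<in>{..<n}. density lborel (\<lambda>z. ennreal (f z)))"

definition risk ::
  "real \<Rightarrow> nat \<Rightarrow> ((nat \<Rightarrow> 'v::euclidean_space) \<Rightarrow> 'v \<Rightarrow> real) \<Rightarrow> ('v \<Rightarrow> real) \<Rightarrow> ennreal" where
  "risk p n T f = (\<integral>\<^sup>+xs. ennreal_powr (Lp_norm p (\<lambda>z. T xs z - f z)) p \<partial>sample_measure n f)"

definition minimax_risk :: "real \<Rightarrow> nat \<Rightarrow> ('v::euclidean_space \<Rightarrow> real) set \<Rightarrow> ennreal" where
  "minimax_risk p n F = (INF T\<in>estimators n. SUP f\<in>F. risk p n T f)"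

end

theory Submission
  imports Defs
begin

text \<open>The lower bound comes from Assouad's lemma. A wide smooth density, bounded below on a large cube, is
  perturbed by \<open>a \<Sum> \<plusminus>\<psi>\<close> with smooth compactly supported wavelets \<open>\<psi>\<close> living on dyadic cells, where the
  amplitude \<open>a\<close> is so small that the sign of a single wavelet cannot be read off a sample of size \<open>n\<close>.

  For \<open>p < 2\<close> one isotropic scale suffices: the loss splits over disjoint cells, and dilating the base density
  only improves the bound. For \<open>p > 2\<close> and small \<open>r\<close> a single scale does not give a constant independent of \<open>r\<close>,
  and the dominating mixed smoothness has to be used: cells with side lengths \<open>h1\<close> and \<open>h2\<close> and a common value of
  \<open>h1 ^ s1 * h2 ^ s2\<close> cost the same Sobolev norm, so \<open>J\<close> such scales are superposed. With random signs the norm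
  grows only like \<open>sqrt J\<close>, hence most sign patterns stay in the ball, while the lower bound gains a positive power
  of \<open>J\<close>, which beats any constant depending on \<open>r\<close>. Haar functions are biorthogonal to the smooth wavelets
  across all these scales, so Bessel's inequality splits the \<open>L\<^sup>2\<close> loss into the losses of the single signs.\<close>

section \<open>An algebra of smooth functions\<close>

text \<open>Write \<open>d\<close> and \<open>s\<close> for D and S. Two requirements tie amplitude
  and scale together: with cells of volume 2^(-d N0) a sign stays undetected while a^2 2^(-d N0) is
  at most of order 1/n, and the Sobolev budget keeps a 2^(s N0) at most of order r. Saturating both
  gives \<open>a\<close> of order n^(-s/(2s+d)), whose p-th power is the rate. As \<open>a\<close>
  tends to 0 while \<open>K\<close> and \<open>J\<close> stay fixed, positivity of the perturbed
  densities holds for all large n. Hence the order of choices: r determines \<open>K\<close>, then r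
  and \<open>K\<close> determine \<open>J\<close>, and only then n tends to infinity.

  A small r forces a large \<open>K\<close>, because a density of small Sobolev norm has to be
  spread out. For p = 1 spreading does not lower the norm of the density itself, which is always 1,
  so only r - 1 remains for the proper derivatives.

  Smooth wavelets of different scales need not be orthogonal to each other. A Haar function that is
  coarser in a single coordinate is constant in that coordinate across the cell of the wavelet,
  whose mean is 0. The two side lengths of the cells trade off against each other, so each of two
  different scales is coarser than the other in some coordinate.\<close>

definition flat_exp :: "real poly \<Rightarrow> real \<Rightarrow> real" where
  "flat_exp p x = (if x > 0 then poly p (1 / x) * exp (- (1 / x)) else 0)"

lemma flat_exp_tendsto_0: "((\<lambda>x. poly p (1 / x) * exp (- (1 / x))) \<longlongrightarrow> (0::real)) (at_right 0)"
proof -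
  have "((\<lambda>y. poly p y * exp (- y)) \<longlongrightarrow> (0::real)) at_top"
  proof -
    have "((\<lambda>y. \<Sum>i\<le>degree p. coeff p i * (y ^ i / exp y)) \<longlongrightarrow> (\<Sum>i\<le>degree p. coeff p i * 0)) at_top"
      by (intro tendsto_intros tendsto_power_div_exp_0)
    then show ?thesis
      by (simp add: poly_altdef sum_divide_distrib exp_minus field_simps)
  qed
  then show ?thesis
    by (simp add: filterlim_at_right_to_top inverse_eq_divide)
qed

text \<open>With \<open>y = 1 / x\<close> the derivative of \<open>p(y) exp(-y)\<close> is
  \<open>y^2 (p(y) - p'(y)) exp(-y)\<close>, which has the same shape. One order of
  differentiability for all polynomials at once therefore yields every order, also at the critical
  point 0.\<close>

lemma flat_exp_has_derivative:
  "(flat_exp p has_real_derivative flat_exp (monom 1 2 * (p - pderiv p)) x) (at x)"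
proof -
  consider "x > 0" | "x < 0" | "x = 0" by linarith
  then show ?thesis
  proof cases
    case 1
    have "((\<lambda>x. poly p (1 / x) * exp (- (1 / x))) has_real_derivative
        flat_exp (monom 1 2 * (p - pderiv p)) x) (at x)"
      using 1 by (auto intro!: derivative_eq_intros DERIV_chain2[OF poly_DERIV]
          simp: flat_exp_def poly_monom field_simps power2_eq_square)
    moreover have "\<forall>\<^sub>F y in nhds x. y > 0"
      using 1 by (rule order_tendstoD(1)[OF filterlim_ident])
    ultimately show ?thesis
      by (subst DERIV_cong_ev[OF refl _ refl])
         (auto simp: flat_exp_def elim: eventually_mono)
  next
    case 2
    have "\<forall>\<^sub>F y in nhds x. y < 0"
      using 2 by (rule order_tendstoD(2)[OF filterlim_ident])
    then have "\<forall>\<^sub>F y in nhds x. flat_exp p y = 0"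
      by eventually_elim (simp add: flat_exp_def)
    then show ?thesis using 2
      by (subst DERIV_cong_ev[OF refl _ refl]) (auto simp: flat_exp_def)
  next
    case 3
    have "((\<lambda>h. flat_exp p h / h) \<longlongrightarrow> 0) (at 0)"
    proof (rule filterlim_split_at)
      have "eventually (\<lambda>h. flat_exp p h / h = 0) (at_left 0)"
        by (auto simp: eventually_at_left_field flat_exp_def intro!: exI[of _ "-1"])
      then show "((\<lambda>h. flat_exp p h / h) \<longlongrightarrow> 0) (at_left 0)"
        by (rule tendsto_eventually)
      \<comment> \<open>Dividing by \<open>h\<close> only multiplies the polynomial by its variable,
        so the limit known for arbitrary polynomials applies to the difference quotient.\<close>
      have "eventually (\<lambda>h. poly (monom 1 1 * p) (1 / h) * exp (- (1 / h)) = flat_exp p h / h) (at_right 0)"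
        by (auto simp: eventually_at_right_field flat_exp_def poly_monom intro!: exI[of _ "1"])
      from Lim_transform_eventually[OF flat_exp_tendsto_0 this]
      show "((\<lambda>h. flat_exp p h / h) \<longlongrightarrow> 0) (at_right 0)" .
    qed
    then show ?thesis unfolding 3 DERIV_def by (simp add: flat_exp_def)
  qed
qed

text \<open>The generators are closed under differentiation up to a factor, so smoothness of every member follows without
  Leibniz formulas for higher derivatives.\<close>

inductive smooth_alg :: "('v::euclidean_space \<Rightarrow> real) \<Rightarrow> bool" where
  base: "smooth_alg (\<lambda>z. flat_exp p (z \<bullet> w + d))"
| const: "smooth_alg (\<lambda>z. c)"
| add: "smooth_alg f \<Longrightarrow> smooth_alg g \<Longrightarrow> smooth_alg (\<lambda>z. f z + g z)"
| mult: "smooth_alg f \<Longrightarrow> smooth_alg g \<Longrightarrow> smooth_alg (\<lambda>z. f z * g z)"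

text \<open>\<open>smooth\<close> demands total differentiability after every list of directions.
  Total derivative and membership of all directional derivatives come out of the same induction, so
  that the result can be iterated along a list.\<close>

lemma smooth_alg_has_derivative:
  assumes "smooth_alg f"
  shows "\<exists>f'. (\<forall>z. (f has_derivative f' z) (at z)) \<and> (\<forall>v. smooth_alg (\<lambda>z. f' z v))"
  using assms
proof induction
  case (base p w d)
  let ?q = "monom 1 2 * (p - pderiv p)"
  show ?case
  proof (intro exI conjI allI)
    fix z :: 'a
    show "((\<lambda>z. flat_exp p (z \<bullet> w + d)) has_derivative (\<lambda>v. (v \<bullet> w) * flat_exp ?q (z \<bullet> w + d))) (at z)"
      by (rule DERIV_compose_FDERIV[OF flat_exp_has_derivative]) (auto intro!: derivative_eq_intros)
  next
    fix v :: 'a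
    show "smooth_alg (\<lambda>z. (v \<bullet> w) * flat_exp ?q (z \<bullet> w + d))"
      by (intro smooth_alg.intros)
  qed
next
  case (const c)
  show ?case by (intro exI[of _ "\<lambda>z v. 0"]) (auto intro: smooth_alg.const)
next
  case (add f g)
  then obtain f' g' where "\<And>z. (f has_derivative f' z) (at z)" "\<And>v. smooth_alg (\<lambda>z. f' z v)"
    "\<And>z. (g has_derivative g' z) (at z)" "\<And>v. smooth_alg (\<lambda>z. g' z v)" by blast
  then show ?case
    by (intro exI[of _ "\<lambda>z v. f' z v + g' z v"]) (auto intro!: smooth_alg.add derivative_eq_intros)
next
  case (mult f g)
  then obtain f' g' where "\<And>z. (f has_derivative f' z) (at z)" "\<And>v. smooth_alg (\<lambda>z. f' z v)"
    "\<And>z. (g has_derivative g' z) (at z)" "\<And>v. smooth_alg (\<lambda>z. g' z v)" by blast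
  then show ?case using mult.hyps
    by (intro exI[of _ "\<lambda>z v. f z * g' z v + f' z v * g z"])
       (auto intro!: smooth_alg.add smooth_alg.mult has_derivative_mult)
qed

lemma dir_deriv_eq:
  assumes "(f has_derivative f') (at z)"
  shows "dir_deriv v f z = f' v"
proof -
  have "((\<lambda>t. f (z + t *\<^sub>R v)) has_derivative (\<lambda>t. f' (t *\<^sub>R v))) (at 0)"
    by (rule has_derivative_compose[where f = "\<lambda>t. z + t *\<^sub>R v" and g = f])
       (use assms in \<open>auto intro!: derivative_eq_intros\<close>)
  then have "((\<lambda>t. f (z + t *\<^sub>R v)) has_derivative (\<lambda>t. f' v * t)) (at 0)"
    using has_derivative_bounded_linear[OF assms]
    by (simp add: linear_simps mult.commute)
  then show ?thesis
    unfolding dir_deriv_def by (intro DERIV_imp_deriv) (simp add: has_field_derivative_def)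
qed

lemma smooth_alg_differentiable: "smooth_alg f \<Longrightarrow> f differentiable at z"
  using smooth_alg_has_derivative[of f] by (auto simp: differentiable_def)

lemma smooth_alg_dir_deriv: 
  assumes "smooth_alg f" shows "smooth_alg (dir_deriv v f)"
proof -
  obtain f' where f': "\<And>z. (f has_derivative f' z) (at z)" "\<And>v. smooth_alg (\<lambda>z. f' z v)"
    using smooth_alg_has_derivative[OF assms] by blast
  have "dir_deriv v f = (\<lambda>z. f' z v)" using dir_deriv_eq[OF f'(1)] by auto
  then show ?thesis using f'(2) by simp
qed

lemma smooth_alg_foldr: "smooth_alg f \<Longrightarrow> smooth_alg (foldr dir_deriv vs f)"
  by (induction vs) (auto intro: smooth_alg_dir_deriv)

lemma smooth_alg_imp_smooth: "smooth_alg f \<Longrightarrow> smooth f"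
  by (auto simp: smooth_def intro: smooth_alg_foldr smooth_alg_differentiable)

lemma smooth_alg_continuous_on: "smooth_alg f \<Longrightarrow> continuous_on X f"
  by (meson continuous_at_imp_continuous_on differentiable_imp_continuous_within smooth_alg_differentiable)

lemma smooth_alg_measurable [measurable_dest]: "smooth_alg f \<Longrightarrow> f \<in> borel_measurable borel"
  by (intro borel_measurable_continuous_onI smooth_alg_continuous_on)

lemma smooth_alg_cmult: "smooth_alg f \<Longrightarrow> smooth_alg (\<lambda>z. c * f z)"
  by (intro smooth_alg.mult smooth_alg.const)

lemma smooth_alg_sum: "(\<And>i. i \<in> I \<Longrightarrow> smooth_alg (f i)) \<Longrightarrow> smooth_alg (\<lambda>z. \<Sum>i\<in>I. f i z)"
  by (induction I rule: infinite_finite_induct) (auto intro: smooth_alg.intros)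

lemma smooth_alg_prod: "(\<And>i. i \<in> I \<Longrightarrow> smooth_alg (f i)) \<Longrightarrow> smooth_alg (\<lambda>z. \<Prod>i\<in>I. f i z)"
  by (induction I rule: infinite_finite_induct) (auto intro: smooth_alg.intros)

text \<open>Composition is not among the generators. An affine substitution is absorbed by the
  vector and the shift of a base element, and it passes through the other three rules.\<close>

lemma smooth_alg_affine:
  fixes g :: "real \<Rightarrow> real"
  assumes "smooth_alg g" shows "smooth_alg (\<lambda>z. g (c * (z \<bullet> b) + d))"
  using assms
proof induction
  case (base p w e)
  have "(\<lambda>z. flat_exp p ((c * (z \<bullet> b) + d) \<bullet> w + e)) = (\<lambda>z. flat_exp p (z \<bullet> (c * w) *\<^sub>R b + (d * w + e)))"
    by (auto simp: algebra_simps)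
  then show ?case by (simp only: smooth_alg.base)
qed (auto intro: smooth_alg.intros)

lemma foldr_dir_deriv_add:
  assumes "smooth_alg f" "smooth_alg g"
  shows "foldr dir_deriv l (\<lambda>z. f z + g z) = (\<lambda>z. foldr dir_deriv l f z + foldr dir_deriv l g z)"
proof (induction l)
  case (Cons v l)
  have "((\<lambda>z. foldr dir_deriv l f z + foldr dir_deriv l g z) has_derivative
      (\<lambda>v. frechet_derivative (foldr dir_deriv l f) (at z) v + frechet_derivative (foldr dir_deriv l g) (at z) v)) (at z)"
    for z
    by (intro has_derivative_add frechet_derivative_works[THEN iffD1] smooth_alg_differentiable smooth_alg_foldr assms)
  moreover have "dir_deriv v (foldr dir_deriv l h) z = frechet_derivative (foldr dir_deriv l h) (at z) v"
    if "smooth_alg h" for h :: "'a \<Rightarrow> real" and z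
    by (intro dir_deriv_eq frechet_derivative_works[THEN iffD1] smooth_alg_differentiable smooth_alg_foldr that)
  ultimately show ?case
    using assms by (auto simp: Cons fun_eq_iff dest: dir_deriv_eq)
qed auto

lemma foldr_dir_deriv_cmult:
  assumes "smooth_alg f"
  shows "foldr dir_deriv l (\<lambda>z. c * f z) = (\<lambda>z. c * foldr dir_deriv l f z)"
proof (induction l)
  case (Cons v l)
  have "((\<lambda>z. c * foldr dir_deriv l f z) has_derivative
      (\<lambda>v. c * frechet_derivative (foldr dir_deriv l f) (at z) v)) (at z)" for z
    by (intro has_derivative_mult_right frechet_derivative_works[THEN iffD1] smooth_alg_differentiable smooth_alg_foldr assms)
  moreover have "dir_deriv v (foldr dir_deriv l f) z = frechet_derivative (foldr dir_deriv l f) (at z) v" for z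
    by (intro dir_deriv_eq frechet_derivative_works[THEN iffD1] smooth_alg_differentiable smooth_alg_foldr assms)
  ultimately show ?case
    by (auto simp: Cons fun_eq_iff dest: dir_deriv_eq)
qed auto

lemma foldr_dir_deriv_zero: "foldr dir_deriv l (\<lambda>z. 0) = (\<lambda>z. 0)"
  by (induction l) (auto simp: dir_deriv_def)

lemma foldr_dir_deriv_sum:
  assumes "\<And>i. i \<in> I \<Longrightarrow> smooth_alg (f i)"
  shows "foldr dir_deriv l (\<lambda>z. \<Sum>i\<in>I. f i z) = (\<lambda>z. \<Sum>i\<in>I. foldr dir_deriv l (f i) z)"
  using assms
  by (induction I rule: infinite_finite_induct)
     (simp_all add: foldr_dir_deriv_zero foldr_dir_deriv_add smooth_alg_sum)

text \<open>Functions of product form carry the whole construction: a derivative in a coordinate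
  direction touches a single factor, and Lebesgue integrals factor, so everything reduces to
  functions of one real variable.\<close>

definition tprod :: "('v::euclidean_space \<Rightarrow> real \<Rightarrow> real) \<Rightarrow> 'v \<Rightarrow> real" where
  "tprod g z = (\<Prod>b\<in>Basis. g b (z \<bullet> b))"

lemma smooth_alg_inner: "smooth_alg g \<Longrightarrow> smooth_alg (\<lambda>z. g (z \<bullet> b))" for g :: "real \<Rightarrow> real"
  using smooth_alg_affine[of g 1 b 0] by simp

lemma smooth_alg_tprod: "(\<And>b. b \<in> Basis \<Longrightarrow> smooth_alg (g b)) \<Longrightarrow> smooth_alg (tprod g)"
  unfolding tprod_def by (intro smooth_alg_prod smooth_alg_inner)

lemma smooth_alg_has_real_derivative:
  fixes g :: "real \<Rightarrow> real"
  assumes "smooth_alg g" shows "(g has_real_derivative deriv g x) (at x)"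
  using smooth_alg_differentiable[OF assms, of x]
  by (simp add: DERIV_deriv_iff_real_differentiable)

lemma dir_deriv_1: "dir_deriv 1 g = deriv g" for g :: "real \<Rightarrow> real"
proof
  show "dir_deriv 1 g x = deriv g x" for x
    using deriv_shift_0[of g x] by (simp add: dir_deriv_def o_def add.commute)
qed

lemma smooth_alg_deriv: "smooth_alg g \<Longrightarrow> smooth_alg (deriv g)" for g :: "real \<Rightarrow> real"
  using smooth_alg_dir_deriv[of g 1] by (simp add: dir_deriv_1)

lemma smooth_alg_higher_deriv: "smooth_alg g \<Longrightarrow> smooth_alg ((deriv ^^ k) g)" for g :: "real \<Rightarrow> real"
  by (induction k) (auto intro: smooth_alg_deriv)

lemma dir_deriv_tprod:
  assumes g: "\<And>b. b \<in> Basis \<Longrightarrow> smooth_alg (g b)" and c: "c \<in> Basis"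
  shows "dir_deriv c (tprod g) = tprod (g(c := deriv (g c)))"
proof
  fix z
  have "((\<lambda>t. tprod g (z + t *\<^sub>R c)) has_real_derivative
     deriv (g c) (z \<bullet> c) * (\<Prod>b\<in>Basis - {c}. g b (z \<bullet> b))) (at 0)"
  proof -
    have "tprod g (z + t *\<^sub>R c) = g c (z \<bullet> c + t) * (\<Prod>b\<in>Basis - {c}. g b (z \<bullet> b))" for t
      unfolding tprod_def using c
      by (subst prod.remove[OF _ c])
         (auto simp: inner_simps inner_Basis[OF c] c intro!: arg_cong2[of _ _ _ _ "(*)"] prod.cong split: if_splits)
    moreover have "((\<lambda>t. g c (z \<bullet> c + t)) has_real_derivative deriv (g c) (z \<bullet> c) * 1) (at 0)"
      by (rule DERIV_chain2[of "g c"]) (use smooth_alg_has_real_derivative[OF g[OF c]] in \<open>auto intro!: derivative_eq_intros\<close>)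
    ultimately show ?thesis by (auto intro!: derivative_eq_intros)
  qed
  then show "dir_deriv c (tprod g) z = tprod (g(c := deriv (g c))) z"
    unfolding dir_deriv_def using c
    by (subst DERIV_imp_deriv) (auto simp: tprod_def prod.remove[OF _ c] intro!: prod.cong)
qed

text \<open>Each direction acts on its own factor, so only the number of its occurrences matters.
  The commutation of mixed partial derivatives is never invoked.\<close>

lemma foldr_dir_deriv_tprod:
  assumes g: "\<And>b. b \<in> Basis \<Longrightarrow> smooth_alg (g b)" and l: "set l \<subseteq> Basis"
  shows "foldr dir_deriv l (tprod g) = tprod (\<lambda>b. (deriv ^^ count_list l b) (g b))"
  using l
proof (induction l)
  case (Cons c l)
  then show ?case
    by (simp add: dir_deriv_tprod g smooth_alg_higher_deriv)
       (auto simp: tprod_def intro!: prod.cong)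
qed auto

lemma higher_deriv_affine:
  fixes g :: "real \<Rightarrow> real"
  assumes "smooth_alg g"
  shows "(deriv ^^ k) (\<lambda>x. g (c * x + d)) = (\<lambda>x. c ^ k * (deriv ^^ k) g (c * x + d))"
proof (induction k)
  case (Suc k)
  have "((\<lambda>x. c ^ k * (deriv ^^ k) g (c * x + d)) has_real_derivative
      c ^ k * (deriv ((deriv ^^ k) g) (c * x + d) * c)) (at x)" for x
    by (intro DERIV_cmult DERIV_chain2[of "(deriv ^^ k) g"] smooth_alg_has_real_derivative smooth_alg_higher_deriv assms)
       (auto intro!: derivative_eq_intros)
  from DERIV_imp_deriv[OF this] show ?case by (auto simp: Suc)
qed auto

lemma dir_deriv_eq_0:
  assumes "open X" "z \<in> X" "\<And>w. w \<in> X \<Longrightarrow> f w = 0"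
  shows "dir_deriv v f z = 0"
proof (rule dir_deriv_eq)
  show "(f has_derivative (\<lambda>v. 0)) (at z)"
    by (rule has_derivative_transform_within_open[OF has_derivative_const[of 0] assms(1,2)]) (simp add: assms)
qed

lemma foldr_dir_deriv_eq_0:
  assumes "open X" "z \<in> X" "\<And>w. w \<in> X \<Longrightarrow> f w = 0"
  shows "foldr dir_deriv l f z = 0"
  using assms(2)
proof (induction l arbitrary: z)
  case (Cons v l)
  show ?case using dir_deriv_eq_0[OF assms(1) Cons.prems, of "foldr dir_deriv l f"] Cons.IH by simp
qed (use assms in auto)

section \<open>Integration by parts\<close>

text \<open>The difference quotients integrate to \<open>0\<close> by translation invariance; this avoids Fubini and the fundamental theorem.\<close>

lemma integral_dir_deriv_eq_0:
  fixes F :: "'v::euclidean_space \<Rightarrow> real"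
  assumes diff: "\<And>z. F differentiable at z"
    and cont: "continuous_on UNIV (dir_deriv v F)"
    and supp: "\<And>z. norm z > R \<Longrightarrow> F z = 0"
  shows "(\<integral>z. dir_deriv v F z \<partial>lborel) = 0"
proof -
  define K where "K = cball (0::'v) (R + norm v)"
  have der: "(F has_derivative frechet_derivative F (at z)) (at z)" for z
    using diff by (simp add: frechet_derivative_works[symmetric])
  have Fc: "continuous_on UNIV F"
    using diff by (auto intro!: continuous_at_imp_continuous_on differentiable_imp_continuous_within)
  then have Fm[measurable]: "F \<in> borel_measurable borel"
    by (rule borel_measurable_continuous_onI)
  have K: "compact K" unfolding K_def by simp
  \<comment> \<open>The quotients \<open>q n\<close> vanish outside the ball of radius
    \<open>R + norm v\<close>, and the intermediate point of the mean value theorem lies at most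
    another \<open>norm v\<close> away; hence the factor 2.\<close>
  have "bounded (dir_deriv v F ` cball 0 (R + 2 * norm v))"
    by (intro compact_imp_bounded compact_continuous_image continuous_on_subset[OF cont]) auto
  then obtain B where B: "\<And>z. norm z \<le> R + 2 * norm v \<Longrightarrow> \<bar>dir_deriv v F z\<bar> \<le> B" 
    unfolding bounded_iff by fastforce
  have F_line: "((\<lambda>t. F (z + t *\<^sub>R v)) has_real_derivative dir_deriv v F (z + t *\<^sub>R v)) (at t)" for z t
  proof -
    have "((\<lambda>t. F (z + t *\<^sub>R v)) has_derivative (\<lambda>s. frechet_derivative F (at (z + t *\<^sub>R v)) (s *\<^sub>R v))) (at t)"
      by (rule has_derivative_compose[where f = "\<lambda>t. z + t *\<^sub>R v" and g = F])
         (use der in \<open>auto intro!: derivative_eq_intros\<close>)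
    then show ?thesis
      using dir_deriv_eq[OF der[of "z + t *\<^sub>R v"], of v] linear_frechet_derivative[OF diff[of "z + t *\<^sub>R v"]]
      by (simp add: has_field_derivative_def linear_cmul mult.commute[of "frechet_derivative F _ v"]
          mult_commute_abs)
  qed
  let ?t = "\<lambda>n. 1 / real (Suc n)"
  have Fint: "integrable lborel F"
  proof -
    have "integrable lborel (\<lambda>z. indicator (cball 0 R) z *\<^sub>R F z)"
      by (rule borel_integrable_compact) (auto intro: continuous_on_subset[OF Fc])
    also have "(\<lambda>z. indicator (cball 0 R) z *\<^sub>R F z) = F"
      using supp by (auto simp: indicator_def fun_eq_iff not_le)
    finally show ?thesis .
  qed
  have Fint': "integrable lborel (\<lambda>z. F (z + w))" "(\<integral>z. F (z + w) \<partial>lborel) = (\<integral>z. F z \<partial>lborel)" for w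
  proof -
    have "integrable (distr lborel borel ((+) w)) F" using Fint by (simp add: lborel_distr_plus)
    then show "integrable lborel (\<lambda>z. F (z + w))" by (subst (asm) integrable_distr_eq) (auto simp: add.commute)
    have "(\<integral>z. F z \<partial>lborel) = (\<integral>z. F z \<partial>(distr lborel borel ((+) w)))" by (simp add: lborel_distr_plus)
    also have "\<dots> = (\<integral>z. F (z + w) \<partial>lborel)" by (subst integral_distr) (auto simp: add.commute)
    finally show "(\<integral>z. F (z + w) \<partial>lborel) = (\<integral>z. F z \<partial>lborel)" ..
  qed
  define q where "q n z = (F (z + ?t n *\<^sub>R v) - F z) / ?t n" for n z
  have "(\<lambda>n. \<integral>z. q n z \<partial>lborel) \<longlonglongrightarrow> (\<integral>z. dir_deriv v F z \<partial>lborel)"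
  proof (rule integral_dominated_convergence)
    show "integrable lborel (\<lambda>z. indicator K z *\<^sub>R B)"
      by (rule borel_integrable_compact[OF K]) auto
    show "dir_deriv v F \<in> borel_measurable lborel"
      using cont by (simp add: borel_measurable_continuous_onI)
    show "q n \<in> borel_measurable lborel" for n unfolding q_def by measurable
    show "AE z in lborel. (\<lambda>n. q n z) \<longlonglongrightarrow> dir_deriv v F z"
    proof (rule AE_I2)
      fix z
      have "((\<lambda>h. (F (z + h *\<^sub>R v) - F z) / h) \<longlongrightarrow> dir_deriv v F z) (at 0)"
        using F_line[of z 0] by (simp add: DERIV_def)
      moreover have "filterlim ?t (at 0) sequentially"
        using LIMSEQ_Suc[OF lim_1_over_n] by (auto simp: filterlim_at)
      ultimately show "(\<lambda>n. q n z) \<longlonglongrightarrow> dir_deriv v F z"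
        unfolding q_def by (rule filterlim_compose)
    qed
    show "AE z in lborel. norm (q n z) \<le> indicator K z *\<^sub>R B" for n
    proof (rule AE_I2)
      fix z
      show "norm (q n z) \<le> indicator K z *\<^sub>R B"
      proof (cases "z \<in> K")
        case True
        have "\<exists>s. 0 < s \<and> s < ?t n \<and> F (z + ?t n *\<^sub>R v) - F (z + 0 *\<^sub>R v) = (?t n - 0) * dir_deriv v F (z + s *\<^sub>R v)"
          by (intro MVT2) (auto intro: F_line)
        then obtain s where s: "0 < s" "s < ?t n" "q n z = dir_deriv v F (z + s *\<^sub>R v)"
          unfolding q_def by auto
        have "?t n \<le> 1" by simp
        with s have "s \<le> 1" by linarith
        then have "norm (s *\<^sub>R v) \<le> norm v" using s(1) by (simp add: mult_left_le_one_le)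
        then have "norm (z + s *\<^sub>R v) \<le> R + 2 * norm v"
          using True norm_triangle_ineq[of z "s *\<^sub>R v"] by (simp add: K_def)
        then show ?thesis using B s(3) True by simp
      next
        case False
        then have z: "norm z > R + norm v" by (simp add: K_def)
        have "norm (?t n *\<^sub>R v) \<le> norm v"
          using mult_left_mono[of 1 "1 + real n" "norm v"] by (simp add: divide_simps)
        then have "norm (z + ?t n *\<^sub>R v) > R"
          using z norm_diff_ineq[of z "?t n *\<^sub>R v"] by linarith
        moreover have "norm z > R" using z norm_ge_zero[of v] by linarith
        ultimately show ?thesis using False by (simp add: q_def supp)
      qed
    qed
  qed
  moreover have "(\<integral>z. q n z \<partial>lborel) = 0" for n
    unfolding q_def by (simp add: Fint Fint')
  ultimately show ?thesis by (simp add: LIMSEQ_const_iff)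
qed

lemma integral_by_parts:
  fixes f g :: "'v::euclidean_space \<Rightarrow> real"
  assumes f: "\<And>z. f differentiable at z" "continuous_on UNIV (dir_deriv v f)" "\<And>z. norm z > R \<Longrightarrow> f z = 0"
    and g: "\<And>z. g differentiable at z" "continuous_on UNIV (dir_deriv v g)"
  shows "(\<integral>z. f z * dir_deriv v g z \<partial>lborel) = - (\<integral>z. dir_deriv v f z * g z \<partial>lborel)"
proof -
  have cf: "continuous_on UNIV f" and cg: "continuous_on UNIV g"
    using f g by (auto intro!: continuous_at_imp_continuous_on differentiable_imp_continuous_within)
  have d: "dir_deriv v (\<lambda>z. f z * g z) = (\<lambda>z. f z * dir_deriv v g z + dir_deriv v f z * g z)"
  proof
    fix z
    have df: "(f has_derivative frechet_derivative f (at z)) (at z)" 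
      and dg: "(g has_derivative frechet_derivative g (at z)) (at z)" 
      using f g by (auto simp: frechet_derivative_works[symmetric])
    show "dir_deriv v (\<lambda>z. f z * g z) z = f z * dir_deriv v g z + dir_deriv v f z * g z"
      using dir_deriv_eq[OF has_derivative_mult[OF df dg], of v] dir_deriv_eq[OF df, of v] dir_deriv_eq[OF dg, of v]
      by simp
  qed
  have f0: "dir_deriv v f z = 0" if "norm z > R" for z
    by (rule dir_deriv_eq_0[of "- cball 0 R"]) (use that f(3) in auto)
  have int: "integrable lborel h" if "continuous_on UNIV h" "\<And>z. norm z > R \<Longrightarrow> h z = 0" for h :: "'v \<Rightarrow> real"
  proof -
    have "integrable lborel (\<lambda>z. indicator (cball 0 R) z *\<^sub>R h z)"
      by (rule borel_integrable_compact) (auto intro: continuous_on_subset[OF that(1)])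
    also have "(\<lambda>z. indicator (cball 0 R) z *\<^sub>R h z) = h"
      using that by (auto simp: indicator_def fun_eq_iff not_le)
    finally show ?thesis .
  qed
  have "(\<integral>z. dir_deriv v (\<lambda>z. f z * g z) z \<partial>lborel) = 0"
    by (rule integral_dir_deriv_eq_0[where R = R])
       (use f g cf cg in \<open>auto simp: d intro!: continuous_intros\<close>)
  then have "(\<integral>z. f z * dir_deriv v g z + dir_deriv v f z * g z \<partial>lborel) = 0" by (simp add: d)
  also have "(\<integral>z. f z * dir_deriv v g z + dir_deriv v f z * g z \<partial>lborel) = 
    (\<integral>z. f z * dir_deriv v g z \<partial>lborel) + (\<integral>z. dir_deriv v f z * g z \<partial>lborel)"
    by (intro Bochner_Integration.integral_add int continuous_intros f g cf cg) (auto simp: f0 f)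
  finally show ?thesis by simp
qed

text \<open>Integration by parts takes the outermost direction off \<open>\<phi>\<close> first, so
  the directions arrive at \<open>f\<close> in reverse order. Keeping \<open>rev\<close> avoids
  having to commute derivatives.\<close>

lemma integral_foldr_dir_deriv:
  fixes f \<phi> :: "'v::euclidean_space \<Rightarrow> real"
  assumes f: "smooth_alg f" "\<And>z. norm z > R \<Longrightarrow> f z = 0" and \<phi>: "smooth \<phi>" and l: "set l \<subseteq> Basis"
  shows "(\<integral>z. f z * foldr dir_deriv l \<phi> z \<partial>lborel) 
    = (- 1) ^ length l * (\<integral>z. foldr dir_deriv (rev l) f z * \<phi> z \<partial>lborel)"
  using f l
proof (induction l arbitrary: f)
  case (Cons v l)
  have diff: "foldr dir_deriv vs \<phi> differentiable at z" if "set vs \<subseteq> Basis" for vs z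
    using \<phi> that by (auto simp: smooth_def)
  have "continuous_on UNIV (foldr dir_deriv (v # l) \<phi>)"
    using diff[of "v # l"] Cons.prems(3) 
    by (auto intro!: continuous_at_imp_continuous_on differentiable_imp_continuous_within)
  then have "(\<integral>z. f z * foldr dir_deriv (v # l) \<phi> z \<partial>lborel) = - (\<integral>z. dir_deriv v f z * foldr dir_deriv l \<phi> z \<partial>lborel)"
    unfolding foldr.simps o_def using Cons.prems diff[of l]
    by (intro integral_by_parts[where R = R]) 
       (auto intro: smooth_alg_differentiable smooth_alg_continuous_on smooth_alg_dir_deriv)
  also have "\<dots> = - ((- 1) ^ length l * (\<integral>z. foldr dir_deriv (rev l) (dir_deriv v f) z * \<phi> z \<partial>lborel))"
  proof (subst Cons.IH)
    show "dir_deriv v f z = 0" if "norm z > R" for z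
      by (rule dir_deriv_eq_0[of "- cball 0 R"]) (use that Cons.prems in auto)
  qed (use Cons.prems in \<open>auto intro: smooth_alg_dir_deriv\<close>)
  finally show ?case by simp
qed auto

section \<open>Locally integrable functions that annihilate all test functions\<close>

lemma locally_integrable_measurable:
  fixes g :: "'v::euclidean_space \<Rightarrow> real"
  assumes "locally_integrable g" shows "g \<in> borel_measurable borel"
proof (rule borel_measurable_LIMSEQ_real)
  show "(\<lambda>n. indicator (cball 0 (real n)) z *\<^sub>R g z) \<longlonglongrightarrow> g z" for z
  proof (rule tendsto_eventually)
    obtain n0 where "norm z \<le> real n0" using real_arch_simple by blast
    then have "indicator (cball 0 (real n)) z *\<^sub>R g z = g z" if "n \<ge> n0" for n
      using that by (auto simp: indicator_def)
    then show "\<forall>\<^sub>F n in sequentially. indicator (cball 0 (real n)) z *\<^sub>R g z = g z"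
      by (auto simp: eventually_sequentially)
  qed
  show "(\<lambda>z. indicator (cball 0 (real n)) z *\<^sub>R g z) \<in> borel_measurable borel" for n
    using assms[unfolded locally_integrable_def, rule_format, of "cball 0 (real n)"]
    by (auto simp: set_integrable_def dest: borel_measurable_integrable)
qed

lemma flat_exp_1: "flat_exp 1 x = (if x > 0 then exp (- (1 / x)) else 0)"
  by (simp add: flat_exp_def)

text \<open>Since \<open>exp (- 1 / (m * x)) \<longlonglongrightarrow> 1\<close> as \<open>m\<close> grows, these bumps converge to the indicator of the open box.\<close>

definition box_bump :: "real \<Rightarrow> 'v::euclidean_space \<Rightarrow> 'v \<Rightarrow> 'v \<Rightarrow> real" where
  "box_bump m l u = tprod (\<lambda>b x. flat_exp 1 (m * x + - (m * (l \<bullet> b))) * flat_exp 1 ((- m) * x + m * (u \<bullet> b)))"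

lemma smooth_alg_flat_exp: "smooth_alg (flat_exp p)"
  using smooth_alg.base[of p "1::real" 0] by simp

lemma smooth_alg_affine_real:
  "smooth_alg g \<Longrightarrow> smooth_alg (\<lambda>x. g (c * x + d))" for g :: "real \<Rightarrow> real"
  using smooth_alg_affine[of g c "1::real" d] by (simp add: inner_real_def)

lemma smooth_alg_box_bump: "smooth_alg (box_bump m l u)"
  unfolding box_bump_def
  by (intro smooth_alg_tprod smooth_alg.mult smooth_alg_affine_real smooth_alg_flat_exp)

lemma box_bump_eq_0:
  assumes "z \<notin> box l u" "m > 0" shows "box_bump m l u z = 0"
proof -
  obtain b where b: "b \<in> Basis" "z \<bullet> b \<le> l \<bullet> b \<or> u \<bullet> b \<le> z \<bullet> b"
    using assms(1) by (auto simp: mem_box not_less)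
  have "flat_exp 1 (m * (z \<bullet> b) + - (m * (l \<bullet> b))) * flat_exp 1 ((- m) * (z \<bullet> b) + m * (u \<bullet> b)) = 0"
    using b(2) assms(2) by (auto simp: flat_exp_1 not_le dest: mult_left_mono[of _ _ m])
  then show ?thesis using b(1) unfolding box_bump_def tprod_def
    by (intro prod_zero) auto
qed

lemma box_bump_le_1: "\<bar>box_bump m l u z\<bar> \<le> 1"
proof -
  have "0 \<le> flat_exp 1 x \<and> flat_exp 1 x \<le> 1" for x by (auto simp: flat_exp_1)
  then have "\<bar>flat_exp 1 x * flat_exp 1 y\<bar> \<le> 1" for x y
    by (simp add: abs_mult mult_le_one)
  then show ?thesis unfolding box_bump_def tprod_def abs_prod
    by (intro prod_le_1) auto
qed

lemma box_bump_tendsto: "(\<lambda>n. box_bump (real (Suc n)) l u z) \<longlonglongrightarrow> indicator (box l u) z"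
proof (cases "z \<in> box l u")
  case True
  have fe: "(\<lambda>n. flat_exp 1 (real (Suc n) * c)) \<longlonglongrightarrow> 1" if "c > 0" for c
  proof -
    have "(\<lambda>n. exp (- (1 / real (Suc n) / c))) \<longlonglongrightarrow> exp (- (0 / c))"
      by (intro tendsto_intros LIMSEQ_Suc[OF lim_1_over_n]) (use that in auto)
    then show ?thesis using that by (simp add: flat_exp_1)
  qed
  have "(\<lambda>n. box_bump (real (Suc n)) l u z) \<longlonglongrightarrow> (\<Prod>b\<in>(Basis::'a set). 1 * 1)"
    unfolding box_bump_def tprod_def
  proof (intro tendsto_prod tendsto_mult)
    fix b :: 'a assume "b \<in> Basis"
    then have "z \<bullet> b - l \<bullet> b > 0" "u \<bullet> b - z \<bullet> b > 0" using True by (auto simp: mem_box)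
    from fe[OF this(1)] fe[OF this(2)]
    show "(\<lambda>n. flat_exp 1 (real (Suc n) * (z \<bullet> b) + - (real (Suc n) * (l \<bullet> b)))) \<longlonglongrightarrow> 1"
      "(\<lambda>n. flat_exp 1 (- real (Suc n) * (z \<bullet> b) + real (Suc n) * (u \<bullet> b))) \<longlonglongrightarrow> 1"
      by (simp_all add: algebra_simps)
  qed
  then show ?thesis using True by simp
next
  case False
  then show ?thesis by (simp add: box_bump_eq_0)
qed

lemma test_function_smooth_alg:
  assumes "smooth_alg f" "\<And>z. norm z > R \<Longrightarrow> f z = 0"
  shows "test_function f"
  unfolding test_function_def supp_def
proof
  have "{z. f z \<noteq> 0} \<subseteq> cball 0 R" using assms(2) by (force simp: not_less)
  then show "compact (closure {z. f z \<noteq> 0})"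
    by (meson bounded_cball bounded_subset compact_closure)
qed (use assms smooth_alg_imp_smooth in auto)

lemma test_function_box_bump: "m > 0 \<Longrightarrow> test_function (box_bump m l u)"
proof -
  assume m: "m > 0"
  obtain R where "box l u \<subseteq> cball 0 R"
    using bounded_subset_ballD[OF bounded_box, of l u 0] ball_subset_cball by blast
  with m show ?thesis
    by (intro test_function_smooth_alg[of _ R] smooth_alg_box_bump box_bump_eq_0) auto
qed

text \<open>Dominated convergence along the bumps: they are bounded by 1 and vanish outside the open
  box, so \<open>g\<close> restricted to the closed box dominates.\<close>

lemma integral_box_eq_0:
  fixes g :: "'v::euclidean_space \<Rightarrow> real"
  assumes g: "locally_integrable g" and 0: "\<And>\<phi>. test_function \<phi> \<Longrightarrow> (\<integral>z. g z * \<phi> z \<partial>lborel) = 0"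
  shows "(\<integral>z. indicator (box l u) z * g z \<partial>lborel) = 0"
proof -
  have [measurable]: "g \<in> borel_measurable borel" by (rule locally_integrable_measurable[OF g])
  have "(\<lambda>n. \<integral>z. g z * box_bump (real (Suc n)) l u z \<partial>lborel) \<longlonglongrightarrow> (\<integral>z. indicator (box l u) z * g z \<partial>lborel)"
  proof (rule integral_dominated_convergence)
    show "integrable lborel (\<lambda>z. \<bar>indicator (cbox l u) z *\<^sub>R g z\<bar>)"
      using g by (auto simp: locally_integrable_def set_integrable_def)
    show "(\<lambda>z. g z * box_bump (real (Suc n)) l u z) \<in> borel_measurable lborel" for n
      using smooth_alg_measurable[OF smooth_alg_box_bump] by measurable
    have "(\<lambda>n. g z * box_bump (real (Suc n)) l u z) \<longlonglongrightarrow> g z * indicator (box l u) z" for z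
      by (intro tendsto_intros box_bump_tendsto)
    then show "AE z in lborel. (\<lambda>n. g z * box_bump (real (Suc n)) l u z) \<longlonglongrightarrow> indicator (box l u) z * g z"
      by (simp add: mult.commute)
    have "norm (g z * box_bump (real (Suc n)) l u z) \<le> \<bar>indicator (cbox l u) z *\<^sub>R g z\<bar>" for z n
    proof (cases "z \<in> box l u")
      case True
      then have "z \<in> cbox l u" using box_subset_cbox by auto
      then show ?thesis using box_bump_le_1[of "real (Suc n)" l u z] mult_left_mono[of _ 1 "\<bar>g z\<bar>"]
        by (auto simp: abs_mult)
    qed (simp add: box_bump_eq_0)
    then show "AE z in lborel. norm (g z * box_bump (real (Suc n)) l u z) \<le> \<bar>indicator (cbox l u) z *\<^sub>R g z\<bar>" for n
      by simp
  qed measurable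
  then show ?thesis using 0[OF test_function_box_bump] by (simp add: LIMSEQ_const_iff)
qed

text \<open>The fundamental lemma of the calculus of variations. The measures with the positive and
  the negative part of \<open>g\<close> as densities agree on open boxes, an intersection-stable
  generator of the Borel sets, hence they are equal, and densities are unique almost
  everywhere.\<close>

lemma integral_test_function_eq_0_imp_AE:
  fixes g :: "'v::euclidean_space \<Rightarrow> real"
  assumes g: "locally_integrable g" and 0: "\<And>\<phi>. test_function \<phi> \<Longrightarrow> (\<integral>z. g z * \<phi> z \<partial>lborel) = 0"
  shows "AE z in lborel. g z = 0"
proof -
  have [measurable]: "g \<in> borel_measurable borel" by (rule locally_integrable_measurable[OF g])
  \<comment> \<open>\<open>ennreal\<close> cuts negative values off at 0, so \<open>M1\<close> and
    \<open>M2\<close> belong to the positive and the negative part of \<open>g\<close>.\<close>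
  define M1 where "M1 = density lborel (\<lambda>z. ennreal (g z))"
  define M2 where "M2 = density lborel (\<lambda>z. ennreal (- g z))"
  have box_eq: "emeasure M1 (box l u) = emeasure M2 (box l u)" and fin: "emeasure M1 (box l u) \<noteq> \<infinity>" for l u
  proof -
    have "integrable lborel (\<lambda>z. indicator (cbox l u) z *\<^sub>R g z)" 
      using g by (auto simp: locally_integrable_def set_integrable_def)
    then have int: "integrable lborel (\<lambda>z. indicator (box l u) z * g z)"
      by (rule Bochner_Integration.integrable_bound)
         (use box_subset_cbox[of l u] in \<open>auto simp: indicator_def intro!: AE_I2\<close>)
    have e1: "emeasure M1 (box l u) = (\<integral>\<^sup>+z. ennreal (indicator (box l u) z * g z) \<partial>lborel)"
      and e2: "emeasure M2 (box l u) = (\<integral>\<^sup>+z. ennreal (- (indicator (box l u) z * g z)) \<partial>lborel)"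
      by (auto simp: M1_def M2_def emeasure_density indicator_def intro!: nn_integral_cong)
    have n1: "(\<integral>\<^sup>+z. ennreal (indicator (box l u) z * g z) \<partial>lborel) < \<infinity>"
      by (rule order.strict_trans1[OF _ int[unfolded integrable_iff_bounded, THEN conjunct2]])
         (auto intro!: nn_integral_mono ennreal_leI)
    have n2: "(\<integral>\<^sup>+z. ennreal (- (indicator (box l u) z * g z)) \<partial>lborel) < \<infinity>"
      by (rule order.strict_trans1[OF _ int[unfolded integrable_iff_bounded, THEN conjunct2]])
         (auto intro!: nn_integral_mono ennreal_leI)
    show "emeasure M1 (box l u) \<noteq> \<infinity>" using n1 e1 by simp
    have "0 = enn2real (\<integral>\<^sup>+z. ennreal (indicator (box l u) z * g z) \<partial>lborel)
        - enn2real (\<integral>\<^sup>+z. ennreal (- (indicator (box l u) z * g z)) \<partial>lborel)"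
      using integral_box_eq_0[OF g 0, of l u] real_lebesgue_integral_def[OF int] by simp
    then show "emeasure M1 (box l u) = emeasure M2 (box l u)"
      using n1 n2 unfolding e1 e2 by (metis diff_eq_diff_eq diff_self ennreal_enn2real infinity_ennreal_def)
  qed
  have "M1 = M2"
  proof (rule measure_eqI_generator_eq)
    let ?E = "range (\<lambda>(a, b). box a b :: 'v set)"
    show "Int_stable ?E" by (auto simp: Int_stable_def box_Int_box)
    show "?E \<subseteq> Pow UNIV" "sets M1 = sigma_sets UNIV ?E" "sets M2 = sigma_sets UNIV ?E"
      by (simp_all add: borel_eq_box M1_def M2_def)
    let ?A = "\<lambda>n::nat. box (- (real n *\<^sub>R One)) (real n *\<^sub>R One) :: 'v set"
    show "range ?A \<subseteq> ?E" "(\<Union>i. ?A i) = UNIV"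
      unfolding UN_box_eq_UNIV by auto
    show "emeasure M1 (?A i) \<noteq> \<infinity>" for i by (rule fin)
    show "emeasure M1 X = emeasure M2 X" if "X \<in> ?E" for X using that box_eq by auto
  qed
  then have "AE z in lborel. ennreal (g z) = ennreal (- g z)"
    unfolding M1_def M2_def
    by (subst (asm) sigma_finite_measure.density_unique_iff) (auto intro: sigma_finite_lborel)
  then show ?thesis
  proof (rule AE_mp, intro AE_I2 impI)
    fix z assume *: "ennreal (g z) = ennreal (- g z)"
    show "g z = 0"
    proof (cases "g z \<ge> 0")
      case True then show ?thesis using * by (auto simp: ennreal_neg)
    next
      case False then show ?thesis using * by (auto simp: ennreal_neg)
    qed
  qed
qed

section \<open>Sobolev norms of smooth functions\<close>

text \<open>A pair of multi-indices becomes a list of unit vectors, in the order in which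
  \<open>foldr\<close> applies \<open>partial2\<close> after \<open>partial1\<close>. Facts about
  mixed derivatives then become inductions over lists.\<close>

definition deriv_dirs :: "('m::finite \<Rightarrow> nat) \<Rightarrow> ('n::finite \<Rightarrow> nat) \<Rightarrow> ((real^'m) \<times> (real^'n)) list" where
  "deriv_dirs \<alpha>1 \<alpha>2 = concat (map (\<lambda>j. replicate (\<alpha>2 j) (0, axis j 1)) indices)
     @ concat (map (\<lambda>i. replicate (\<alpha>1 i) (axis i 1, 0)) indices)"

lemma foldr_replicate: "foldr f (replicate k x) y = (f x ^^ k) y"
  by (induction k) auto

lemma multi_deriv_eq: "multi_deriv e \<alpha> \<phi> = foldr dir_deriv (concat (map (\<lambda>i. replicate (\<alpha> i) (e i)) indices)) \<phi>"
proof -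
  have "foldr (\<lambda>i. dir_deriv (e i) ^^ \<alpha> i) xs \<phi> = foldr dir_deriv (concat (map (\<lambda>i. replicate (\<alpha> i) (e i)) xs)) \<phi>" for xs
    by (induction xs) (auto simp: foldr_replicate)
  then show ?thesis by (simp add: multi_deriv_def)
qed

lemma partial2_partial1: "partial2 \<alpha>2 (partial1 \<alpha>1 \<phi>) = foldr dir_deriv (deriv_dirs \<alpha>1 \<alpha>2) \<phi>"
  by (simp add: partial1_def partial2_def multi_deriv_eq deriv_dirs_def)

lemma indices: "distinct (indices :: 'i::finite list)" "set (indices :: 'i list) = UNIV"
proof -
  have "\<exists>xs :: 'i list. distinct xs \<and> set xs = UNIV"
    using finite_distinct_list[of "UNIV :: 'i set"] by auto
  from someI_ex[OF this] show "distinct (indices :: 'i::finite list)" "set (indices :: 'i list) = UNIV"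
    unfolding indices_def by auto
qed

lemma set_deriv_dirs: "set (deriv_dirs \<alpha>1 \<alpha>2) \<subseteq> Basis"
  by (auto simp: deriv_dirs_def Basis_prod_def Basis_vec_def image_iff)

lemma length_concat_replicate: "length (concat (map (\<lambda>i. replicate (\<alpha> i) (e i)) indices)) = order \<alpha>"
proof -
  have "length (concat (map (\<lambda>i. replicate (\<alpha> i) (e i)) xs)) = sum_list (map \<alpha> xs)" for xs
    by (induction xs) auto
  then show ?thesis using sum_list_distinct_conv_sum_set[OF indices(1), of \<alpha>]
    by (simp add: order_def indices)
qed

lemma length_deriv_dirs: "length (deriv_dirs \<alpha>1 \<alpha>2) = order \<alpha>1 + order \<alpha>2"
  by (simp add: deriv_dirs_def length_concat_replicate)

lemma locally_integrable_continuous: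
  "continuous_on UNIV f \<Longrightarrow> locally_integrable f"
  unfolding locally_integrable_def set_integrable_def
  by (intro allI impI borel_integrable_compact) (auto intro: continuous_on_subset)

lemma is_weak_deriv_smooth_alg:
  fixes f :: "(real^'m::finite) \<times> (real^'n::finite) \<Rightarrow> real"
  assumes "smooth_alg f" "\<And>z. norm z > R \<Longrightarrow> f z = 0"
  shows "is_weak_deriv \<alpha>1 \<alpha>2 f (foldr dir_deriv (rev (deriv_dirs \<alpha>1 \<alpha>2)) f)"
  unfolding is_weak_deriv_def partial2_partial1 length_deriv_dirs[symmetric]
  by (intro conjI allI impI integral_foldr_dir_deriv[OF assms] set_deriv_dirs)
     (auto intro!: locally_integrable_continuous smooth_alg_continuous_on smooth_alg_foldr assms simp: test_function_def)

lemma is_weak_deriv_unique: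
  assumes "is_weak_deriv \<alpha>1 \<alpha>2 f g" "is_weak_deriv \<alpha>1 \<alpha>2 f h"
  shows "AE z in lborel. g z = h z"
proof -
  have "AE z in lborel. g z - h z = 0"
  proof (rule integral_test_function_eq_0_imp_AE)
    have g: "locally_integrable g" "locally_integrable h" using assms by (auto simp: is_weak_deriv_def)
    then show "locally_integrable (\<lambda>z. g z - h z)"
      by (auto simp: locally_integrable_def set_integral_diff)
    fix \<phi> :: "(real^'a) \<times> (real^'b) \<Rightarrow> real" assume \<phi>: "test_function \<phi>"
    have int: "integrable lborel (\<lambda>z. k z * \<phi> z)" if k: "locally_integrable k" for k
    proof -
      have cp: "continuous_on UNIV \<phi>"
        using \<phi>[unfolded test_function_def smooth_def, THEN conjunct1, rule_format, of "[]"] 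
        by (auto intro!: continuous_at_imp_continuous_on differentiable_imp_continuous_within)
      have s: "compact (supp \<phi>)" using \<phi> by (simp add: test_function_def)
      then have "bounded (\<phi> ` supp \<phi>)"
        by (intro compact_imp_bounded compact_continuous_image continuous_on_subset[OF cp]) auto
      then obtain B where B: "\<And>z. z \<in> supp \<phi> \<Longrightarrow> \<bar>\<phi> z\<bar> \<le> B" unfolding bounded_iff by auto
      have s0: "\<phi> z = 0" if "z \<notin> supp \<phi>" for z 
        using that closure_subset[of "{z. \<phi> z \<noteq> 0}"] by (auto simp: supp_def)
      show ?thesis
      proof (rule Bochner_Integration.integrable_bound)
        show "integrable lborel (\<lambda>z. B * (indicator (supp \<phi>) z *\<^sub>R k z))"
          using k s by (auto simp: locally_integrable_def set_integrable_def)
        show "(\<lambda>z. k z * \<phi> z) \<in> borel_measurable lborel"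
          using locally_integrable_measurable[OF k] borel_measurable_continuous_onI[OF cp] by measurable
        have "norm (k z * \<phi> z) \<le> norm (B * (indicator (supp \<phi>) z *\<^sub>R k z))" for z
        proof (cases "z \<in> supp \<phi>")
          case True
          then have "\<bar>\<phi> z\<bar> * \<bar>k z\<bar> \<le> \<bar>B\<bar> * \<bar>k z\<bar>"
            using B[OF True] by (intro mult_right_mono) auto
          then show ?thesis using True by (simp add: abs_mult mult.commute)
        qed (simp add: s0)
        then show "AE z in lborel. norm (k z * \<phi> z) \<le> norm (B * (indicator (supp \<phi>) z *\<^sub>R k z))"
          by simp
      qed
    qed
    show "(\<integral>z. (g z - h z) * \<phi> z \<partial>lborel) = 0"
      using assms \<phi> int[OF g(1)] int[OF g(2)] by (auto simp: left_diff_distrib is_weak_deriv_def)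
  qed
  then show ?thesis by eventually_elim simp
qed

text \<open>\<open>weak_deriv\<close> is an arbitrary choice among the weak derivatives, so its norm
  is accessible only through uniqueness almost everywhere. From here on, Sobolev norms are computed
  from classical derivatives.\<close>

lemma Lp_norm_weak_deriv:
  fixes f :: "(real^'m::finite) \<times> (real^'n::finite) \<Rightarrow> real"
  assumes "smooth_alg f" "\<And>z. norm z > R \<Longrightarrow> f z = 0"
  shows "Lp_norm p (weak_deriv \<alpha>1 \<alpha>2 f) = Lp_norm p (foldr dir_deriv (rev (deriv_dirs \<alpha>1 \<alpha>2)) f)"
proof -
  have "is_weak_deriv \<alpha>1 \<alpha>2 f (weak_deriv \<alpha>1 \<alpha>2 f)"
    unfolding weak_deriv_def
    using someI_ex[of "is_weak_deriv \<alpha>1 \<alpha>2 f"] is_weak_deriv_smooth_alg[OF assms] by blast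
  from is_weak_deriv_unique[OF this is_weak_deriv_smooth_alg[OF assms]]
  have "AE z in lborel. weak_deriv \<alpha>1 \<alpha>2 f z = foldr dir_deriv (rev (deriv_dirs \<alpha>1 \<alpha>2)) f z" .
  then have "AE z in lborel. ennreal (\<bar>weak_deriv \<alpha>1 \<alpha>2 f z\<bar> powr p)
      = ennreal (\<bar>foldr dir_deriv (rev (deriv_dirs \<alpha>1 \<alpha>2)) f z\<bar> powr p)"
    by eventually_elim simp
  then show ?thesis unfolding Lp_norm_def
    by (intro arg_cong2[of _ _ _ _ ennreal_powr] nn_integral_cong_AE) auto
qed

lemma sobolev_densitiesI:
  fixes f :: "(real^'m::finite) \<times> (real^'n::finite) \<Rightarrow> real"
  assumes f: "smooth_alg f" "\<And>z. norm z > R \<Longrightarrow> f z = 0" "prob_density f"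
    and norm: "(\<Sum>(\<alpha>1, \<alpha>2) \<in> multi_indices s1 \<times> multi_indices s2.
       Lp_norm p (foldr dir_deriv (rev (deriv_dirs \<alpha>1 \<alpha>2)) f)) \<le> ennreal r"
  shows "f \<in> sobolev_densities p s1 s2 r"
proof -
  have "sobolev_norm p s1 s2 f = (\<Sum>(\<alpha>1, \<alpha>2) \<in> multi_indices s1 \<times> multi_indices s2.
       Lp_norm p (foldr dir_deriv (rev (deriv_dirs \<alpha>1 \<alpha>2)) f))"
    unfolding sobolev_norm_def by (intro sum.cong) (auto simp: Lp_norm_weak_deriv[OF f(1,2)])
  moreover have "weakly_differentiable s1 s2 f"
    unfolding weakly_differentiable_def using is_weak_deriv_smooth_alg[OF f(1,2)] by blast
  moreover have "f \<in> borel_measurable borel" by (rule smooth_alg_measurable[OF f(1)])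
  ultimately show ?thesis
    using f(3) norm ennreal_less_top[of r]
    by (auto simp: sobolev_densities_def sobolev_ball_def sobolev_def intro: order.strict_trans1)
qed

section \<open>Integrals of product functions and dyadic rescaling\<close>

lemma tprod_integral:
  fixes g :: "'v::euclidean_space \<Rightarrow> real \<Rightarrow> real"
  assumes g: "\<And>b. b \<in> Basis \<Longrightarrow> integrable lborel (g b)"
  shows "integrable lborel (tprod g)" "(\<integral>z. tprod g z \<partial>lborel) = (\<Prod>b\<in>Basis. \<integral>x. g b x \<partial>lborel)"
proof -
  interpret product_sigma_finite "\<lambda>_::'v. lborel :: real measure" ..
  define g' where "g' b = (if b \<in> Basis then g b else (\<lambda>_. 0))" for b
  have g': "integrable lborel (g' b)" for b using g by (simp add: g'_def)
  have [measurable]: "g' b \<in> borel_measurable borel" for b using g'[of b] by auto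
  have eq: "tprod g = tprod g'" by (auto simp: tprod_def g'_def)
  have [measurable]: "tprod g' \<in> borel_measurable borel" unfolding tprod_def by measurable
  have L: "(lborel :: 'v measure) = distr (Pi\<^sub>M Basis (\<lambda>_. lborel)) borel (\<lambda>f. \<Sum>b\<in>Basis. f b *\<^sub>R b)"
    by (simp add: lborel_def[where 'a = 'v] lborel_eq_real)
  have val: "tprod g' (\<Sum>b\<in>Basis. f b *\<^sub>R b) = (\<Prod>b\<in>Basis. g' b (f b))" for f
    unfolding tprod_def by (intro prod.cong) (auto simp: inner_sum_left_Basis)
  show "integrable lborel (tprod g)" unfolding eq
    by (subst L, subst integrable_distr_eq) (auto simp: val intro!: product_integrable_prod g')
  have "(\<integral>z. tprod g z \<partial>lborel) = (\<integral>f. (\<Prod>b\<in>Basis. g' b (f b)) \<partial>(Pi\<^sub>M Basis (\<lambda>_. lborel)))" unfolding eq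
    by (subst L, subst integral_distr) (simp_all add: val)
  also have "\<dots> = (\<Prod>b\<in>Basis. \<integral>x. g' b x \<partial>lborel)"
    by (intro product_integral_prod g') auto
  finally show "(\<integral>z. tprod g z \<partial>lborel) = (\<Prod>b\<in>Basis. \<integral>x. g b x \<partial>lborel)"
    by (simp add: g'_def)
qed

lemma tprod_mult: "tprod f z * tprod g z = tprod (\<lambda>b x. f b x * g b x) z"
  by (simp add: tprod_def prod.distrib)

lemma bump_integral_dyadic:
  fixes f :: "real \<Rightarrow> real"
  shows "(\<integral>x. f (2 ^ N * x - k) \<partial>lborel) = (\<integral>x. f x \<partial>lborel) / 2 ^ N"
  using lborel_integral_real_affine[of "2 ^ N" f "- k"] by (simp add: field_simps)

lemma bump_integrable_dyadic:
  fixes f :: "real \<Rightarrow> real"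
  assumes "integrable lborel f"
  shows "integrable lborel (\<lambda>x. f (2 ^ N * x - k))"
  using lborel_integrable_real_affine[OF assms, of "2 ^ N" "- k"] by (simp add: field_simps)

section \<open>Haar functions and smooth wavelets\<close>

text \<open>Written through the floor of \<open>2 * x\<close> so that the behaviour on dyadic cells
  becomes integer division.\<close>

definition haar :: "real \<Rightarrow> real" where
  "haar x = (if \<lfloor>2 * x\<rfloor> = 0 then 1 else if \<lfloor>2 * x\<rfloor> = 1 then - 1 else 0)"

lemma haar_eq: "haar x = indicator {0..<1/2} x - indicator {1/2..<1} x"
  by (auto simp: haar_def floor_eq_iff indicator_def)

lemma haar_measurable [measurable]: "haar \<in> borel_measurable borel"
  unfolding haar_eq[abs_def] by measurable

lemma haar_eq_0: "x \<notin> {0..<1} \<Longrightarrow> haar x = 0"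
  by (auto simp: haar_eq indicator_def)

lemma haar_square: "haar x * haar x = indicator {0..<1} x"
  by (auto simp: haar_eq indicator_def)

lemma haar_integral: "(\<integral>x. haar x \<partial>lborel) = 0" "integrable lborel haar"
proof -
  have i: "integrable lborel (indicator {0..<1/2} :: real \<Rightarrow> real)" "integrable lborel (indicator {1/2..<1} :: real \<Rightarrow> real)"
    by (auto intro!: integrable_real_indicator emeasure_bounded_finite)
  then show "(\<integral>x. haar x \<partial>lborel) = 0" "integrable lborel haar"
    unfolding haar_eq[abs_def] by auto
qed

text \<open>A Haar function of level \<open>N'\<close> depends only on the floor of
  \<open>2 ^ (N' + 1) * x\<close>, which is the floor of \<open>2 ^ N * x\<close> divided by
  \<open>2 ^ (N - N' - 1)\<close>. It is therefore constant on dyadic cells of level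
  \<open>N\<close> and takes there its value at the left end point. Strictness of
  \<open>N' < N\<close> matters, because a Haar function changes sign inside its own cell.\<close>

lemma haar_coarse:
  assumes "2 ^ N * x - real k \<in> {0..<1}" "N' < N"
  shows "haar (2 ^ N' * x - real k') = haar (2 ^ N' * (real k / 2 ^ N) - real k')"
proof -
  have fl: "\<lfloor>2 * (2 ^ N' * y - real k')\<rfloor> = \<lfloor>2 ^ N * y\<rfloor> div 2 ^ (N - Suc N') - 2 * int k'" for y :: real
  proof -
    have "(2::real) ^ N = 2 ^ (N - Suc N') * (2 * 2 ^ N')"
      using assms(2) by (simp add: power_add[symmetric] flip: power_Suc)
    then have "2 * 2 ^ N' * y = 2 ^ N * y / real_of_int (2 ^ (N - Suc N'))" by simp
    then have "\<lfloor>2 * 2 ^ N' * y\<rfloor> = \<lfloor>2 ^ N * y\<rfloor> div 2 ^ (N - Suc N')"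
      by (simp only: floor_divide_real_eq_div[of "2 ^ (N - Suc N')"] zero_le_power zero_le_numeral)
    moreover have "2 * (2 ^ N' * y - real k') = 2 * 2 ^ N' * y - of_int (2 * int k')" by (simp add: algebra_simps)
    ultimately show ?thesis by (simp only: floor_diff_of_int)
  qed
  have "\<lfloor>2 ^ N * x\<rfloor> = int k" using assms(1) by (auto simp: floor_eq_iff)
  then show ?thesis unfolding haar_def fl by simp
qed

text \<open>Every coordinate has its own level and position. There is no normalisation: the supremum
  does not depend on the levels, so one amplitude can serve all cells.\<close>

definition cellfun :: "(real \<Rightarrow> real) \<Rightarrow> ('v::euclidean_space \<Rightarrow> nat) \<Rightarrow> ('v \<Rightarrow> nat) \<Rightarrow> 'v \<Rightarrow> real" where
  "cellfun f N k = tprod (\<lambda>b x. f (2 ^ N b * x - real (k b)))"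

lemma cellfun_mult_haar_integral_1D:
  fixes f :: "real \<Rightarrow> real"
  assumes f: "integrable lborel f" "\<And>x. x \<notin> {0..<1} \<Longrightarrow> f x = 0"
  shows "integrable lborel (\<lambda>x. f (2 ^ N * x - real k) * haar (2 ^ N' * x - real k'))"
    and "(\<integral>x. f (2 ^ N * x - real k) * haar (2 ^ N * x - real k) \<partial>lborel) = (\<integral>x. f x * haar x \<partial>lborel) / 2 ^ N"
    and "(\<integral>x. f x \<partial>lborel) = 0 \<Longrightarrow> N' < N \<Longrightarrow>
      (\<integral>x. f (2 ^ N * x - real k) * haar (2 ^ N' * x - real k') \<partial>lborel) = 0"
    and "k \<noteq> k' \<Longrightarrow> (\<integral>x. f (2 ^ N * x - real k) * haar (2 ^ N * x - real k') \<partial>lborel) = 0"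
proof -
  have [measurable]: "f \<in> borel_measurable borel" using f(1) by auto
  have fi: "integrable lborel (\<lambda>x. f (2 ^ N * x - real k))" by (rule bump_integrable_dyadic[OF f(1)])
  show "integrable lborel (\<lambda>x. f (2 ^ N * x - real k) * haar (2 ^ N' * x - real k'))"
  proof (rule Bochner_Integration.integrable_bound[OF fi])
    have "\<bar>haar y\<bar> \<le> 1" for y by (auto simp: haar_def)
    then show "AE x in lborel. norm (f (2 ^ N * x - real k) * haar (2 ^ N' * x - real k')) \<le> norm (f (2 ^ N * x - real k))"
      by (auto simp: abs_mult intro!: AE_I2 mult_left_le)
  qed measurable
  show "(\<integral>x. f (2 ^ N * x - real k) * haar (2 ^ N * x - real k) \<partial>lborel) = (\<integral>x. f x * haar x \<partial>lborel) / 2 ^ N"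
    using bump_integral_dyadic[of "\<lambda>x. f x * haar x" N k] by simp
  show "(\<integral>x. f (2 ^ N * x - real k) * haar (2 ^ N' * x - real k') \<partial>lborel) = 0"
    if "(\<integral>x. f x \<partial>lborel) = 0" "N' < N"
  proof -
    have eq: "f (2 ^ N * x - real k) * haar (2 ^ N' * x - real k') 
       = f (2 ^ N * x - real k) * haar (2 ^ N' * (real k / 2 ^ N) - real k')" for x
      using f(2)[of "2 ^ N * x - real k"] haar_coarse[OF _ that(2), of x k k'] by (cases "2 ^ N * x - real k \<in> {0..<1}") auto
    show ?thesis unfolding eq using bump_integral_dyadic[of f N "real k"] that(1) by simp
  qed
  show "(\<integral>x. f (2 ^ N * x - real k) * haar (2 ^ N * x - real k') \<partial>lborel) = 0" if "k \<noteq> k'"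
  proof -
    have eq: "f (2 ^ N * x - real k) * haar (2 ^ N * x - real k') = 0" for x
    proof (rule ccontr)
      assume "f (2 ^ N * x - real k) * haar (2 ^ N * x - real k') \<noteq> 0"
      then have "f (2 ^ N * x - real k) \<noteq> 0" "haar (2 ^ N * x - real k') \<noteq> 0" by auto
      then have "2 ^ N * x - real k \<in> {0..<1}" "2 ^ N * x - real k' \<in> {0..<1}"
        using f(2) haar_eq_0 by blast+
      then have "\<lfloor>2 ^ N * x\<rfloor> = int k" "\<lfloor>2 ^ N * x\<rfloor> = int k'" by (auto simp: floor_eq_iff)
      then show False using that by simp
    qed
    show ?thesis unfolding eq by simp
  qed
qed

lemma cellfun_haar_integrable:
  assumes f: "integrable lborel f" "\<And>x. x \<notin> {0..<1} \<Longrightarrow> f x = 0"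
  shows "integrable lborel (\<lambda>z. cellfun f N k z * cellfun haar N' k' z)"
  unfolding cellfun_def tprod_mult
  by (intro tprod_integral cellfun_mult_haar_integral_1D f)

text \<open>The integral factors, so one vanishing coordinate suffices. If the Haar factor is
  coarser there, it is constant on the cell of \<open>f\<close>, which has mean 0; if the levels
  agree and the positions differ, the supports are disjoint. A finer Haar factor gives nothing,
  hence the asymmetric condition.\<close>

lemma cellfun_haar_orthogonal:
  fixes N :: "'v::euclidean_space \<Rightarrow> nat"
  assumes f: "integrable lborel f" "\<And>x. x \<notin> {0..<1} \<Longrightarrow> f x = 0" "(\<integral>x. f x \<partial>lborel) = 0"
    and "b \<in> Basis" "N' b < N b \<or> N' b = N b \<and> k b \<noteq> k' b"
  shows "(\<integral>z. cellfun f N k z * cellfun haar N' k' z \<partial>lborel) = 0"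
proof -
  have "(\<integral>x. f (2 ^ N b * x - real (k b)) * haar (2 ^ N' b * x - real (k' b)) \<partial>lborel) = 0"
    using assms(5)
  proof
    assume "N' b < N b"
    with f show ?thesis by (intro cellfun_mult_haar_integral_1D(3)) auto
  next
    assume "N' b = N b \<and> k b \<noteq> k' b"
    with f show ?thesis using cellfun_mult_haar_integral_1D(4)[of f "k b" "k' b" "N b"] by simp
  qed
  with assms(4) have 0: "(\<Prod>b\<in>Basis. \<integral>x. f (2 ^ N b * x - real (k b)) * haar (2 ^ N' b * x - real (k' b)) \<partial>lborel) = 0"
    by (intro prod_zero) auto
  show ?thesis unfolding cellfun_def tprod_mult
    by (subst tprod_integral(2), rule cellfun_mult_haar_integral_1D(1)[OF f(1,2)], assumption) (rule 0)
qed

lemma cellfun_haar_diagonal: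
  fixes N :: "'v::euclidean_space \<Rightarrow> nat"
  assumes f: "integrable lborel f" "\<And>x. x \<notin> {0..<1} \<Longrightarrow> f x = 0"
  shows "(\<integral>z. cellfun f N k z * cellfun haar N k z \<partial>lborel) = (\<integral>x. f x * haar x \<partial>lborel) ^ DIM('v) / 2 ^ (\<Sum>b\<in>Basis. N b)"
proof -
  have "(\<integral>z. cellfun f N k z * cellfun haar N k z \<partial>lborel) = (\<Prod>b\<in>(Basis :: 'v set). (\<integral>x. f x * haar x \<partial>lborel) / 2 ^ N b)"
    unfolding cellfun_def tprod_mult
    by (subst tprod_integral(2), rule cellfun_mult_haar_integral_1D(1)[OF f], assumption,
        rule prod.cong[OF refl], rule cellfun_mult_haar_integral_1D(2)[OF f])
  then show ?thesis by (simp add: prod_dividef power_sum)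
qed

text \<open>The nonnegative integral of the square of \<open>G - (\<Sum>i\<in>I. c i * h i)\<close>
  is expanded, with \<open>c i\<close> the Fourier coefficient. The \<open>h i\<close> are
  orthogonal but not normalised, and \<open>v i\<close> is the squared norm of
  \<open>h i\<close>.\<close>

lemma bessel_inequality:
  fixes h :: "'i \<Rightarrow> 'a \<Rightarrow> real"
  assumes I: "finite I"
    and h[measurable]: "\<And>i. i \<in> I \<Longrightarrow> h i \<in> borel_measurable M"
    and int: "\<And>i j. i \<in> I \<Longrightarrow> j \<in> I \<Longrightarrow> integrable M (\<lambda>z. h i z * h j z)"
    and orth: "\<And>i j. i \<in> I \<Longrightarrow> j \<in> I \<Longrightarrow> (\<integral>z. h i z * h j z \<partial>M) = (if i = j then v i else 0)"
    and v: "\<And>i. i \<in> I \<Longrightarrow> v i > 0"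
    and G[measurable]: "G \<in> borel_measurable M" "integrable M (\<lambda>z. (G z)\<^sup>2)"
  shows "(\<Sum>i\<in>I. (\<integral>z. G z * h i z \<partial>M)\<^sup>2 / v i) \<le> (\<integral>z. (G z)\<^sup>2 \<partial>M)"
    and "i \<in> I \<Longrightarrow> integrable M (\<lambda>z. G z * h i z)"
proof -
  have Gint: "integrable M (\<lambda>z. G z * h i z)" if "i \<in> I" for i
  proof (rule Bochner_Integration.integrable_bound)
    show "integrable M (\<lambda>z. (G z)\<^sup>2 + h i z * h i z)" by (intro Bochner_Integration.integrable_add G int that)
    have "2 * \<bar>x * y\<bar> \<le> x\<^sup>2 + y * y" for x y :: real
      using sum_squares_bound[of "\<bar>x\<bar>" "\<bar>y\<bar>"] by (simp add: abs_mult power2_eq_square)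
    then have "\<bar>x * y\<bar> \<le> \<bar>x\<^sup>2 + y * y\<bar>" for x y :: real
      by (smt (verit) abs_ge_zero)
    then show "AE z in M. norm (G z * h i z) \<le> norm ((G z)\<^sup>2 + h i z * h i z)" by simp
  qed (use that in measurable)
  then show "i \<in> I \<Longrightarrow> integrable M (\<lambda>z. G z * h i z)" .
  define c where "c i = (\<integral>z. G z * h i z \<partial>M) / v i" for i
  have exp: "(G z - (\<Sum>i\<in>I. c i * h i z))\<^sup>2 =
      ((G z)\<^sup>2 - (\<Sum>i\<in>I. 2 * c i * (G z * h i z))) + (\<Sum>i\<in>I. \<Sum>j\<in>I. c i * c j * (h i z * h j z))" for z
    by (simp add: power2_diff power2_eq_square[of "sum _ _"] sum_product sum_distrib_left algebra_simps)
  have "0 \<le> (\<integral>z. (G z - (\<Sum>i\<in>I. c i * h i z))\<^sup>2 \<partial>M)" by simp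
  also have "\<dots> = ((\<integral>z. (G z)\<^sup>2 \<partial>M) - (\<Sum>i\<in>I. 2 * c i * (\<integral>z. G z * h i z \<partial>M))) 
      + (\<Sum>i\<in>I. \<Sum>j\<in>I. c i * c j * (\<integral>z. h i z * h j z \<partial>M))"
    unfolding exp by (simp add: Gint int G)
  also have "(\<Sum>i\<in>I. \<Sum>j\<in>I. c i * c j * (\<integral>z. h i z * h j z \<partial>M)) = (\<Sum>i\<in>I. c i * c i * v i)"
    by (intro sum.cong refl) (simp add: orth I if_distrib[of "\<lambda>x. _ * x"] sum.delta cong: if_cong)
  also have "(\<Sum>i\<in>I. c i * c i * v i) = (\<Sum>i\<in>I. (\<integral>z. G z * h i z \<partial>M)\<^sup>2 / v i)"
    using v by (intro sum.cong refl) (force simp: c_def power2_eq_square)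
  also have "(\<Sum>i\<in>I. 2 * c i * (\<integral>z. G z * h i z \<partial>M)) = 2 * (\<Sum>i\<in>I. (\<integral>z. G z * h i z \<partial>M)\<^sup>2 / v i)"
    by (simp add: c_def power2_eq_square sum_distrib_left mult.assoc)
  finally show "(\<Sum>i\<in>I. (\<integral>z. G z * h i z \<partial>M)\<^sup>2 / v i) \<le> (\<integral>z. (G z)\<^sup>2 \<partial>M)" by simp
qed

section \<open>Assouad's lemma\<close>

lemma prob_space_density_prob_density:
  "prob_density f \<Longrightarrow> prob_space (density lborel (\<lambda>z. ennreal (f z)))"
  by (auto intro!: prob_spaceI simp: prob_density_def emeasure_density)

text \<open>Samples from two densities are compared through their likelihoods, and this requires
  densities with respect to a common measure on the sample space.\<close>

lemma sample_measure_eq_density: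
  fixes f :: "'v::euclidean_space \<Rightarrow> real"
  assumes f: "prob_density f"
  shows "sample_measure n f = density (\<Pi>\<^sub>M i\<in>{..<n}. lborel) (\<lambda>xs. \<Prod>i<n. ennreal (f (xs i)))"
proof -
  have [measurable]: "f \<in> borel_measurable borel" using f by (simp add: prob_density_def)
  interpret P: prob_space "density lborel (\<lambda>z. ennreal (f z))" by (rule prob_space_density_prob_density[OF f])
  interpret L: product_sigma_finite "\<lambda>_::nat. lborel :: 'v measure" ..
  interpret D: product_sigma_finite "\<lambda>_::nat. density lborel (\<lambda>z. ennreal (f z))" ..
  show ?thesis unfolding sample_measure_def
  proof (rule D.PiM_eqI[symmetric])
    show "sets (density (\<Pi>\<^sub>M i\<in>{..<n}. lborel) (\<lambda>xs. \<Prod>i<n. ennreal (f (xs i)))) 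
      = sets (\<Pi>\<^sub>M i\<in>{..<n}. density lborel (\<lambda>z. ennreal (f z)))"
      by (auto intro!: sets_PiM_cong)
    fix A :: "nat \<Rightarrow> 'v set" assume A: "\<And>i. i \<in> {..<n} \<Longrightarrow> A i \<in> sets (density lborel (\<lambda>z. ennreal (f z)))"
    then have [measurable]: "i < n \<Longrightarrow> A i \<in> sets borel" for i by simp
    have [measurable]: "Pi\<^sub>E {..<n} A \<in> sets (\<Pi>\<^sub>M i\<in>{..<n}. lborel)"
      by (rule sets_PiM_I_finite) auto
    have "emeasure (density (\<Pi>\<^sub>M i\<in>{..<n}. lborel) (\<lambda>xs. \<Prod>i<n. ennreal (f (xs i)))) (Pi\<^sub>E {..<n} A)
       = (\<integral>\<^sup>+xs. (\<Prod>i<n. ennreal (f (xs i))) * indicator (Pi\<^sub>E {..<n} A) xs \<partial>(\<Pi>\<^sub>M i\<in>{..<n}. lborel))"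
      by (subst emeasure_density) auto
    also have "\<dots> = (\<integral>\<^sup>+xs. (\<Prod>i<n. ennreal (f (xs i)) * indicator (A i) (xs i)) \<partial>(\<Pi>\<^sub>M i\<in>{..<n}. lborel))"
    proof (rule nn_integral_cong)
      fix xs assume "xs \<in> space (\<Pi>\<^sub>M i\<in>{..<n}. lborel :: 'v measure)"
      then have "xs \<in> extensional {..<n}" by (auto simp: space_PiM PiE_def)
      then have "(indicator (Pi\<^sub>E {..<n} A) xs :: ennreal) = (\<Prod>i<n. indicator (A i) (xs i))"
        by (auto simp: indicator_def PiE_def Pi_def prod_eq_1_iff)
      then show "(\<Prod>i<n. ennreal (f (xs i))) * indicator (Pi\<^sub>E {..<n} A) xs = (\<Prod>i<n. ennreal (f (xs i)) * indicator (A i) (xs i))"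
        by (simp add: prod.distrib)
    qed
    also have "\<dots> = (\<Prod>i<n. \<integral>\<^sup>+z. ennreal (f z) * indicator (A i) z \<partial>lborel)"
      by (subst L.product_nn_integral_prod) auto
    also have "\<dots> = (\<Prod>i\<in>{..<n}. emeasure (density lborel (\<lambda>z. ennreal (f z))) (A i))"
      by (intro prod.cong refl) (subst emeasure_density, auto)
    finally show "emeasure (density (\<Pi>\<^sub>M i\<in>{..<n}. lborel) (\<lambda>xs. \<Prod>i<n. ennreal (f (xs i)))) (Pi\<^sub>E {..<n} A) 
      = (\<Prod>i\<in>{..<n}. emeasure (density lborel (\<lambda>z. ennreal (f z))) (A i))" .
  qed simp
qed

text \<open>Pointwise \<open>(sqrt f - sqrt g)^2 = (f - g)^2 / (sqrt f + sqrt g)^2 <= (f - g)^2 /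
  b\<close> where \<open>f\<close> and \<open>g\<close> differ. Integration shows that the squared
  Hellinger distance, which is 2 minus twice the affinity, is at most \<open>t\<close>. A lower
  bound on one of the two densities is enough.\<close>

lemma hellinger_affinity_ge:
  fixes f g :: "'v::euclidean_space \<Rightarrow> real"
  assumes f: "prob_density f" and g: "prob_density g" and b: "b > 0"
    and ge: "\<And>z. f z \<noteq> g z \<Longrightarrow> f z \<ge> b"
    and t: "(\<integral>\<^sup>+z. ennreal ((f z - g z)\<^sup>2) \<partial>lborel) \<le> ennreal (b * t)" "t \<ge> 0"
  shows "ennreal (1 - t / 2) \<le> (\<integral>\<^sup>+z. ennreal (sqrt (f z * g z)) \<partial>lborel)"
proof -
  have [measurable]: "f \<in> borel_measurable borel" "g \<in> borel_measurable borel" 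
    and nn: "f z \<ge> 0" "g z \<ge> 0" for z
    using f g by (auto simp: prob_density_def)
  have pw: "ennreal (f z) + ennreal (g z) \<le> 2 * ennreal (sqrt (f z * g z)) + ennreal (1 / b) * ennreal ((f z - g z)\<^sup>2)" for z
  proof -
    have "f z + g z \<le> 2 * sqrt (f z * g z) + 1 / b * (f z - g z)\<^sup>2"
    proof (cases "f z = g z")
      case False
      then have fb: "f z \<ge> b" by (rule ge)
      have sq: "f z = sqrt (f z) ^ 2" "g z = sqrt (g z) ^ 2" using nn by simp_all
      have "f z + g z - 2 * sqrt (f z * g z) = (sqrt (f z) - sqrt (g z))\<^sup>2"
        using nn by (simp add: power2_diff real_sqrt_mult)
      also have "\<dots> \<le> (sqrt (f z) - sqrt (g z))\<^sup>2 * ((sqrt (f z) + sqrt (g z))\<^sup>2 / b)"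
      proof -
        have "b \<le> sqrt (f z) ^ 2" using fb nn by simp
        also have "\<dots> \<le> (sqrt (f z) + sqrt (g z))\<^sup>2" using nn by (intro power_mono) auto
        finally have "1 \<le> (sqrt (f z) + sqrt (g z))\<^sup>2 / b" using b by simp
        then show ?thesis using mult_left_mono[of 1 "(sqrt (f z) + sqrt (g z))\<^sup>2 / b" "(sqrt (f z) - sqrt (g z))\<^sup>2"] by simp
      qed
      also have "\<dots> = 1 / b * ((sqrt (f z) - sqrt (g z)) * (sqrt (f z) + sqrt (g z)))\<^sup>2"
        by (simp add: power_mult_distrib)
      also have "(sqrt (f z) - sqrt (g z)) * (sqrt (f z) + sqrt (g z)) = f z - g z"
        using nn by (simp add: algebra_simps)
      finally show ?thesis by simp
    qed (use nn in \<open>simp add: real_sqrt_mult\<close>)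
    then have "ennreal (f z + g z) \<le> ennreal (2 * sqrt (f z * g z) + 1 / b * (f z - g z)\<^sup>2)"
      by (rule ennreal_leI)
    also have "\<dots> = ennreal (2 * sqrt (f z * g z)) + ennreal (1 / b * (f z - g z)\<^sup>2)"
      using b nn by (intro ennreal_plus) auto
    also have "ennreal (2 * sqrt (f z * g z)) = ennreal 2 * ennreal (sqrt (f z * g z))"
      using nn by (intro ennreal_mult) auto
    also have "ennreal (1 / b * (f z - g z)\<^sup>2) = ennreal (1 / b) * ennreal ((f z - g z)\<^sup>2)"
      using b by (intro ennreal_mult) auto
    finally show ?thesis using nn by simp
  qed
  have "2 = (\<integral>\<^sup>+z. ennreal (f z) + ennreal (g z) \<partial>lborel)"
    using f g by (subst nn_integral_add) (auto simp: prob_density_def)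
  also have "\<dots> \<le> (\<integral>\<^sup>+z. 2 * ennreal (sqrt (f z * g z)) + ennreal (1 / b) * ennreal ((f z - g z)\<^sup>2) \<partial>lborel)"
    by (intro nn_integral_mono pw)
  also have "\<dots> = 2 * (\<integral>\<^sup>+z. ennreal (sqrt (f z * g z)) \<partial>lborel) + ennreal (1 / b) * (\<integral>\<^sup>+z. ennreal ((f z - g z)\<^sup>2) \<partial>lborel)"
    by (subst nn_integral_add) (auto simp: nn_integral_cmult)
  also have "\<dots> \<le> 2 * (\<integral>\<^sup>+z. ennreal (sqrt (f z * g z)) \<partial>lborel) + ennreal (1 / b) * ennreal (b * t)"
    by (intro add_left_mono mult_left_mono t) auto
  also have "ennreal (1 / b) * ennreal (b * t) = ennreal t"
    using b t by (simp flip: ennreal_mult)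
  finally have *: "2 \<le> 2 * (\<integral>\<^sup>+z. ennreal (sqrt (f z * g z)) \<partial>lborel) + ennreal t" .
  show ?thesis
  proof (cases "(\<integral>\<^sup>+z. ennreal (sqrt (f z * g z)) \<partial>lborel)")
    case (real r)
    have "ennreal 2 \<le> ennreal (2 * r + t)"
      using * real t(2) by (simp add: ennreal_mult ennreal_plus)
    then have "2 \<le> 2 * r + t" using real t(2) by (subst (asm) ennreal_le_iff) auto
    then show ?thesis using real by (auto intro!: ennreal_leI)
  qed simp
qed

lemma sqrt_prod: "sqrt (\<Prod>i\<in>A. f i) = (\<Prod>i\<in>A. sqrt (f i))"
  by (induction A rule: infinite_finite_induct) (auto simp: real_sqrt_mult)

text \<open>Le Cam's two-point argument. The affinity is multiplicative over the sample, so it is at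
  least \<open>(1 - t / 2) ^ n >= 1 / 2\<close> by Bernoulli. This forces the likelihoods to
  overlap: the integral of their minimum is at least \<open>1 / 8\<close>. On the overlap the two
  losses cannot both be small.\<close>

lemma two_point_bound:
  fixes f g :: "'v::euclidean_space \<Rightarrow> real"
  assumes f: "prob_density f" and g: "prob_density g" and b: "b > 0"
    and ge: "\<And>z. f z \<noteq> g z \<Longrightarrow> f z \<ge> b"
    and t: "(\<integral>\<^sup>+z. ennreal ((f z - g z)\<^sup>2) \<partial>lborel) \<le> ennreal (b * t)" "t \<ge> 0" "real n * t \<le> 1" "t \<le> 1"
    and [measurable]: "u \<in> borel_measurable (\<Pi>\<^sub>M i\<in>{..<n}. borel)" "w \<in> borel_measurable (\<Pi>\<^sub>M i\<in>{..<n}. borel)"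
    and c: "\<And>xs. xs \<in> space (\<Pi>\<^sub>M i\<in>{..<n}. borel) \<Longrightarrow> u xs + w xs \<ge> ennreal c" "c \<ge> 0"
  shows "ennreal (c / 8) \<le> (\<integral>\<^sup>+xs. u xs \<partial>sample_measure n f) + (\<integral>\<^sup>+xs. w xs \<partial>sample_measure n g)"
proof -
  have [measurable]: "f \<in> borel_measurable borel" "g \<in> borel_measurable borel" 
    and nn: "f z \<ge> 0" "g z \<ge> 0" for z
    using f g by (auto simp: prob_density_def)
  let ?M = "\<Pi>\<^sub>M i\<in>{..<n}. lborel :: 'v measure"
  have [measurable_cong]: "sets ?M = sets (\<Pi>\<^sub>M i\<in>{..<n}. borel)" by (intro sets_PiM_cong) auto
  interpret L: product_sigma_finite "\<lambda>_::nat. lborel :: 'v measure" ..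
  define P where "P h xs = (\<Prod>i<n. h (xs i) :: real)" for h :: "'v \<Rightarrow> real" and xs
  have [measurable]: "P f \<in> borel_measurable ?M" "P g \<in> borel_measurable ?M"
    unfolding P_def by measurable
  have Pnn: "P f xs \<ge> 0" "P g xs \<ge> 0" for xs using nn by (auto simp: P_def intro: prod_nonneg)
  have P1: "(\<integral>\<^sup>+xs. ennreal (P h xs) \<partial>?M) = 1" if "prob_density h" for h
  proof -
    have [measurable]: "h \<in> borel_measurable borel" using that by (simp add: prob_density_def)
    have "(\<integral>\<^sup>+xs. ennreal (P h xs) \<partial>?M) = (\<integral>\<^sup>+xs. (\<Prod>i<n. ennreal (h (xs i))) \<partial>?M)"
      using that by (simp add: P_def prod_ennreal prob_density_def)
    also have "\<dots> = 1" using that by (subst L.product_nn_integral_prod) (auto simp: prob_density_def)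
    finally show ?thesis .
  qed
  have smp: "(\<integral>\<^sup>+xs. v xs \<partial>sample_measure n h) = (\<integral>\<^sup>+xs. ennreal (P h xs) * v xs \<partial>?M)" 
    if "prob_density h" and [measurable]: "v \<in> borel_measurable (\<Pi>\<^sub>M i\<in>{..<n}. borel)" for h v
  proof -
    have [measurable]: "h \<in> borel_measurable borel" using that by (simp add: prob_density_def)
    show ?thesis unfolding sample_measure_eq_density[OF that(1)]
      using that(1) by (subst nn_integral_density) (auto simp: P_def prod_ennreal prob_density_def)
  qed
  have "ennreal (1 / 2) \<le> ennreal ((1 - t / 2) ^ n)"
  proof (rule ennreal_leI)
    have "1 / 2 \<le> 1 + real n * (- t / 2)" using t(3) by simp
    also have "\<dots> \<le> (1 + (- t / 2)) ^ n" using t by (intro Bernoulli_inequality) auto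
    finally show "1 / 2 \<le> (1 - t / 2) ^ n" by simp
  qed
  also have "\<dots> = (\<Prod>i<n. ennreal (1 - t / 2))" using t by (simp add: ennreal_power)
  also have "\<dots> \<le> (\<Prod>i<n. \<integral>\<^sup>+z. ennreal (sqrt (f z * g z)) \<partial>lborel)"
    using hellinger_affinity_ge[OF f g b ge t(1,2)] by (intro prod_mono_ennreal)
  also have "\<dots> = (\<integral>\<^sup>+xs. (\<Prod>i<n. ennreal (sqrt (f (xs i) * g (xs i)))) \<partial>?M)"
    by (subst L.product_nn_integral_prod) auto
  also have "\<dots> = (\<integral>\<^sup>+xs. ennreal (sqrt (P f xs * P g xs)) \<partial>?M)"
    using nn by (simp add: prod_ennreal P_def real_sqrt_mult prod.distrib sqrt_prod)
  also have "\<dots> \<le> (\<integral>\<^sup>+xs. (ennreal (1 / 8) * ennreal (P f xs) + ennreal (1 / 8) * ennreal (P g xs)) + 2 * ennreal (min (P f xs) (P g xs)) \<partial>?M)"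
  proof (intro nn_integral_mono)
    fix xs
    \<comment> \<open>The arithmetic-geometric mean inequality with weights \<open>1 / 8\<close> and
      2, whose product is \<open>1 / 4\<close>. Both likelihoods integrate to 1, so this turns
      affinity \<open>1 / 2\<close> into \<open>1 / 2 <= 1 / 4 + 2 * m\<close>, where
      \<open>m\<close> is the integral of the minimum.\<close>
    have "sqrt (P f xs * P g xs) \<le> 1 / 8 * P f xs + 1 / 8 * P g xs + 2 * min (P f xs) (P g xs)"
    proof (rule real_le_lsqrt)
      let ?x = "P f xs" and ?y = "P g xs"
      have "?x * ?y = max ?x ?y * min ?x ?y" by (auto simp: max_def min_def)
      also have "\<dots> \<le> (1 / 8 * max ?x ?y + 2 * min ?x ?y)\<^sup>2"
        using zero_le_power2[of "1 / 8 * max ?x ?y - 2 * min ?x ?y"] by (simp add: power2_eq_square algebra_simps)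
      also have "\<dots> \<le> (1 / 8 * ?x + 1 / 8 * ?y + 2 * min ?x ?y)\<^sup>2"
        using Pnn[of xs] by (intro power_mono) (auto simp: max_def)
      finally show "?x * ?y \<le> (1 / 8 * ?x + 1 / 8 * ?y + 2 * min ?x ?y)\<^sup>2" .
    qed (use Pnn[of xs] in auto)
    then have "ennreal (sqrt (P f xs * P g xs)) \<le> ennreal (1 / 8 * P f xs + 1 / 8 * P g xs + 2 * min (P f xs) (P g xs))"
      by (rule ennreal_leI)
    also have "\<dots> = (ennreal (1 / 8 * P f xs) + ennreal (1 / 8 * P g xs)) + ennreal (2 * min (P f xs) (P g xs))"
      using Pnn[of xs] by (subst ennreal_plus; simp add: ennreal_plus)+
    also have "ennreal (1 / 8 * P f xs) = ennreal (1 / 8) * ennreal (P f xs)"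
      using Pnn by (intro ennreal_mult) auto
    also have "ennreal (1 / 8 * P g xs) = ennreal (1 / 8) * ennreal (P g xs)"
      using Pnn by (intro ennreal_mult) auto
    also have "ennreal (2 * min (P f xs) (P g xs)) = ennreal 2 * ennreal (min (P f xs) (P g xs))"
      using Pnn by (intro ennreal_mult) auto
    also have "ennreal 2 = 2" by simp
    finally show "ennreal (sqrt (P f xs * P g xs)) \<le> ennreal (1 / 8) * ennreal (P f xs) + ennreal (1 / 8) * ennreal (P g xs)
      + 2 * ennreal (min (P f xs) (P g xs))" .
  qed
  also have "\<dots> = (ennreal (1 / 8) * 1 + ennreal (1 / 8) * 1) + 2 * (\<integral>\<^sup>+xs. ennreal (min (P f xs) (P g xs)) \<partial>?M)"
    by (simp add: nn_integral_add nn_integral_cmult P1 f g)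
  finally have half: "ennreal (1 / 2) \<le> ennreal (1 / 4) + 2 * (\<integral>\<^sup>+xs. ennreal (min (P f xs) (P g xs)) \<partial>?M)"
    by (simp flip: ennreal_plus)
  have min_ge: "ennreal (1 / 8) \<le> (\<integral>\<^sup>+xs. ennreal (min (P f xs) (P g xs)) \<partial>?M)"
  proof (cases "(\<integral>\<^sup>+xs. ennreal (min (P f xs) (P g xs)) \<partial>?M)")
    case (real r)
    have "ennreal (1 / 2) \<le> ennreal (1 / 4 + 2 * r)"
      using half real by (simp add: ennreal_mult ennreal_plus)
    then have "1 / 2 \<le> 1 / 4 + 2 * r" using real by (subst (asm) ennreal_le_iff) auto
    then show ?thesis using real by (auto intro!: ennreal_leI)
  qed simp
  have "ennreal (c / 8) = ennreal c * ennreal (1 / 8)" using c by (simp flip: ennreal_mult)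
  also have "\<dots> \<le> ennreal c * (\<integral>\<^sup>+xs. ennreal (min (P f xs) (P g xs)) \<partial>?M)"
    by (intro mult_left_mono min_ge) auto
  also have "\<dots> = (\<integral>\<^sup>+xs. ennreal c * ennreal (min (P f xs) (P g xs)) \<partial>?M)"
    by (subst nn_integral_cmult) auto
  also have "\<dots> \<le> (\<integral>\<^sup>+xs. ennreal (P f xs) * u xs + ennreal (P g xs) * w xs \<partial>?M)"
  proof (intro nn_integral_mono)
    fix xs assume "xs \<in> space ?M"
    then have xs: "xs \<in> space (\<Pi>\<^sub>M i\<in>{..<n}. borel)" by (simp add: space_PiM)
    have "ennreal c * ennreal (min (P f xs) (P g xs)) \<le> ennreal (min (P f xs) (P g xs)) * u xs + ennreal (min (P f xs) (P g xs)) * w xs"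
      using mult_right_mono[OF c(1)[OF xs], of "ennreal (min (P f xs) (P g xs))"]
      by (simp add: distrib_right mult.commute)
    also have "\<dots> \<le> ennreal (P f xs) * u xs + ennreal (P g xs) * w xs"
      by (intro add_mono mult_right_mono ennreal_leI) auto
    finally show "ennreal c * ennreal (min (P f xs) (P g xs)) \<le> ennreal (P f xs) * u xs + ennreal (P g xs) * w xs" .
  qed
  also have "\<dots> = (\<integral>\<^sup>+xs. u xs \<partial>sample_measure n f) + (\<integral>\<^sup>+xs. w xs \<partial>sample_measure n g)"
    by (subst nn_integral_add) (auto simp: smp f g)
  finally show ?thesis .
qed

text \<open>Half of all patterns omit \<open>i\<close>. Such a pattern fails only if it or its flip
  lies outside \<open>G\<close>, so removing \<open>i\<close> maps the complement of
  \<open>G\<close> onto a set that covers all failures. At most a quarter of all patterns fail, and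
  a quarter is left over.\<close>

lemma card_good_pairs:
  assumes I: "finite I" "i \<in> I" and G: "G \<subseteq> Pow I" "4 * card (Pow I - G) \<le> 2 ^ card I"
  shows "2 ^ card I \<le> 4 * card {A \<in> G. i \<notin> A \<and> insert i A \<in> G}"
proof -
  let ?J = "I - {i}"
  let ?bad = "{A \<in> Pow ?J. \<not> (A \<in> G \<and> insert i A \<in> G)}"
  have fin: "finite (Pow I)" using I by simp
  have P: "card (Pow ?J) * 2 = 2 ^ card I"
    using I by (simp add: card_Pow card_Diff_singleton) (metis One_nat_def Suc_pred card_gt_0_iff empty_iff mult.commute power_Suc)
  have eq: "Pow ?J - ?bad = {A \<in> G. i \<notin> A \<and> insert i A \<in> G}" using G I by auto
  have "?bad \<subseteq> (\<lambda>B. B - {i}) ` (Pow I - G)"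
  proof
    fix A assume A: "A \<in> ?bad"
    show "A \<in> (\<lambda>B. B - {i}) ` (Pow I - G)"
    proof (cases "A \<in> G")
      case True
      with A I show ?thesis by (intro image_eqI[of _ _ "insert i A"]) auto
    next
      case False
      with A I show ?thesis by (intro image_eqI[of _ _ A]) auto
    qed
  qed
  then have "card ?bad \<le> card (Pow I - G)"
    by (meson I(1) card_image_le card_mono fin finite_Diff finite_imageI le_trans)
  moreover have "card (Pow ?J - ?bad) = card (Pow ?J) - card ?bad"
    by (rule card_Diff_subset) (use I in auto)
  ultimately show ?thesis using P G(2) unfolding eq by linarith
qed

text \<open>A set \<open>A\<close> of indices encodes the sign pattern that is \<open>+1\<close> exactly on \<open>A\<close>; flipping the \<open>i\<close>-th sign leads from
  \<open>A\<close> to \<open>insert i A\<close>. Only patterns in \<open>G\<close> may be used, and as \<open>G\<close> contains three quarters of all patterns, at least half of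
  the flips stay inside \<open>G\<close>.\<close>

lemma assouad:
  fixes f :: "'i set \<Rightarrow> 'v::euclidean_space \<Rightarrow> real" and loss :: "'i \<Rightarrow> bool \<Rightarrow> (nat \<Rightarrow> 'v) \<Rightarrow> ennreal"
  assumes I: "finite I" and G: "G \<subseteq> Pow I" "4 * card (Pow I - G) \<le> 2 ^ card I"
    and f: "\<And>A. A \<subseteq> I \<Longrightarrow> prob_density (f A)" and b: "b > 0"
    and ge: "\<And>i A z. i \<in> I \<Longrightarrow> A \<subseteq> I \<Longrightarrow> i \<notin> A \<Longrightarrow> f A z \<noteq> f (insert i A) z \<Longrightarrow> f A z \<ge> b"
    and close: "\<And>i A. i \<in> I \<Longrightarrow> A \<subseteq> I \<Longrightarrow> i \<notin> A \<Longrightarrow> 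
        (\<integral>\<^sup>+z. ennreal ((f A z - f (insert i A) z)\<^sup>2) \<partial>lborel) \<le> ennreal (b * t)"
    and t: "t \<ge> 0" "real n * t \<le> 1" "t \<le> 1"
    and loss: "\<And>i s. i \<in> I \<Longrightarrow> loss i s \<in> borel_measurable (\<Pi>\<^sub>M i\<in>{..<n}. borel)"
    and c: "\<And>i xs. i \<in> I \<Longrightarrow> xs \<in> space (\<Pi>\<^sub>M i\<in>{..<n}. borel) \<Longrightarrow> ennreal (c i) \<le> loss i False xs + loss i True xs" "\<And>i. i \<in> I \<Longrightarrow> c i \<ge> 0"
  shows "ennreal ((\<Sum>i\<in>I. c i) / 32) \<le> (SUP A\<in>G. \<integral>\<^sup>+xs. (\<Sum>i\<in>I. loss i (i \<in> A) xs) \<partial>sample_measure n (f A))"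
proof -
  have finG: "finite G" using G I finite_subset by auto
  define g where "g i A = (\<integral>\<^sup>+xs. loss i (i \<in> A) xs \<partial>sample_measure n (f A))" for i A
  let ?S = "SUP A\<in>G. \<integral>\<^sup>+xs. (\<Sum>i\<in>I. loss i (i \<in> A) xs) \<partial>sample_measure n (f A)"
  have sets: "sets (sample_measure n h) = sets (\<Pi>\<^sub>M i\<in>{..<n}. borel)" for h :: "'v \<Rightarrow> real"
    unfolding sample_measure_def by (intro sets_PiM_cong) auto
  have loss': "loss i s \<in> borel_measurable (sample_measure n h)" if "i \<in> I" for i s and h :: "'v \<Rightarrow> real"
    using loss[OF that, of s] measurable_cong_sets[OF sets refl] by blast
  have split: "(\<integral>\<^sup>+xs. (\<Sum>i\<in>I. loss i (i \<in> A) xs) \<partial>sample_measure n (f A)) = (\<Sum>i\<in>I. g i A)" for A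
    unfolding g_def by (intro nn_integral_sum loss')
  \<comment> \<open>The constant 32 is 8 times 4: the two-point bound yields \<open>c i / 8\<close>
    for each admissible flip, and the number of admissible flips is at least a quarter of the number
    of all patterns.\<close>
  have i_bound: "ennreal (2 ^ card I * (c i / 32)) \<le> (\<Sum>A\<in>G. g i A)" if i: "i \<in> I" for i
  proof -
    let ?P = "{A \<in> G. i \<notin> A \<and> insert i A \<in> G}"
    have pair: "ennreal (c i / 8) \<le> g i A + g i (insert i A)" if "A \<in> ?P" for A
    proof -
      have A: "A \<subseteq> I" "i \<notin> A" using that G by auto
      have "ennreal (c i / 8) \<le> (\<integral>\<^sup>+xs. loss i False xs \<partial>sample_measure n (f A)) + (\<integral>\<^sup>+xs. loss i True xs \<partial>sample_measure n (f (insert i A)))"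
        using A i by (intro two_point_bound[where b = b and t = t] f b ge close t loss c) auto
      then show ?thesis using A by (simp add: g_def)
    qed
    have "ennreal (2 ^ card I * (c i / 32)) \<le> ennreal (real (card ?P) * (c i / 8))"
    proof (rule ennreal_leI)
      have "real (2 ^ card I) \<le> real (4 * card ?P)"
        using card_good_pairs[OF I i G] by (simp only: of_nat_le_iff)
      then show "2 ^ card I * (c i / 32) \<le> real (card ?P) * (c i / 8)"
        using mult_right_mono[of "2 ^ card I" "4 * real (card ?P)" "c i / 32"] c(2)[OF i] by (simp add: mult_ac)
    qed
    also have "\<dots> = ennreal (real (card ?P)) * ennreal (c i / 8)"
      using c(2)[OF i] by (intro ennreal_mult) auto
    also have "\<dots> = (\<Sum>A\<in>?P. ennreal (c i / 8))"
      by (simp add: ennreal_of_nat_eq_real_of_nat)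
    also have "\<dots> \<le> (\<Sum>A\<in>?P. g i A + g i (insert i A))" by (intro sum_mono pair)
    also have "\<dots> = (\<Sum>A\<in>?P. g i A) + (\<Sum>A\<in>insert i ` ?P. g i A)"
    proof -
      have "inj_on (insert i) ?P" by (auto simp: inj_on_def)
      then show ?thesis by (simp add: sum.distrib sum.reindex)
    qed
    \<comment> \<open>Only the upper end of a flip contains \<open>i\<close>, so no pattern of
      \<open>G\<close> is counted twice.\<close>
    also have "\<dots> = (\<Sum>A\<in>?P \<union> insert i ` ?P. g i A)"
      by (rule sum.union_disjoint[symmetric]) (use finG in auto)
    also have "\<dots> \<le> (\<Sum>A\<in>G. g i A)"
      by (intro sum_mono2 finG) auto
    finally show ?thesis .
  qed
  have "ennreal (2 ^ card I) * ennreal ((\<Sum>i\<in>I. c i) / 32) = (\<Sum>i\<in>I. ennreal (2 ^ card I * (c i / 32)))"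
    using c(2) by (subst sum_ennreal) (auto simp: sum_distrib_left sum_divide_distrib sum_nonneg simp flip: ennreal_mult)
  also have "\<dots> \<le> (\<Sum>i\<in>I. \<Sum>A\<in>G. g i A)" by (intro sum_mono i_bound)
  also have "\<dots> = (\<Sum>A\<in>G. \<Sum>i\<in>I. g i A)" by (rule sum.swap)
  also have "\<dots> \<le> (\<Sum>A\<in>G. ?S)" by (intro sum_mono) (auto simp: split[symmetric] intro: SUP_upper)
  also have "\<dots> = of_nat (card G) * ?S" by simp
  also have "\<dots> \<le> ennreal (2 ^ card I) * ?S"
  proof (rule mult_right_mono)
    have "card G \<le> 2 ^ card I" using card_mono[OF _ G(1)] I by (simp add: card_Pow)
    then have "real (card G) \<le> real (2 ^ card I)" by (simp only: of_nat_le_iff)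
    then show "of_nat (card G) \<le> ennreal (2 ^ card I)"
      by (simp add: ennreal_of_nat_eq_real_of_nat ennreal_leI)
  qed simp
  finally show ?thesis
    by (subst (asm) ennreal_mult_le_mult_iff) auto
qed

section \<open>Random signs\<close>

definition sg :: "'i set \<Rightarrow> 'i \<Rightarrow> real" where
  "sg A i = (if i \<in> A then 1 else - 1)"

text \<open>The subgaussian bound \<open>cosh x <= exp (x^2)\<close> for a random sign. The sharper
  exponent \<open>x^2 / 2\<close> would only improve constants.\<close>

lemma exp_plus_exp_minus_le: "exp x + exp (- x) \<le> 2 * exp (x\<^sup>2)" for x :: real
proof -
  have "exp y + exp (- y) \<le> 2 * exp (y\<^sup>2)" if "y \<ge> 0" for y :: real
  proof (cases "y \<le> 1")
    case True
    have "exp (- y) \<le> 1 / (1 + y)"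
      using exp_ge_add_one_self[of y] that by (simp add: exp_minus field_simps)
    also have "\<dots> \<le> 1 - y + y\<^sup>2"
      using that by (simp add: field_simps power2_eq_square)
    finally have "exp y + exp (- y) \<le> (1 + y + y\<^sup>2) + (1 - y + y\<^sup>2)"
      using exp_bound[OF that True] by linarith
    also have "\<dots> \<le> 2 * exp (y\<^sup>2)" using exp_ge_add_one_self[of "y\<^sup>2"] by linarith
    finally show ?thesis .
  next
    case False
    then have "y \<le> y\<^sup>2" using mult_left_mono[of 1 y y] by (simp add: power2_eq_square)
    then have "exp y \<le> exp (y\<^sup>2)" "exp (- y) \<le> exp (y\<^sup>2)" using that by auto
    then show ?thesis by linarith
  qed
  from this[of "\<bar>x\<bar>"] show ?thesis by (cases "x \<ge> 0") auto
qed

lemma powr_le_exp: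
  fixes x p :: real
  assumes "p > 0" "x \<ge> 0" shows "x powr p \<le> p powr p * exp x"
proof -
  have "x / p \<le> exp (x / p)" using exp_ge_add_one_self[of "x / p"] by linarith
  then have "(x / p) powr p \<le> exp (x / p) powr p" using assms by (intro powr_mono2) auto
  also have "\<dots> = exp x" using assms by (simp add: powr_def)
  finally show ?thesis using assms by (simp add: powr_divide field_simps)
qed

text \<open>The upper Khintchine inequality by exponential moments. After scaling to
  \<open>B = 1\<close>, the power is dominated by \<open>p powr p\<close> times \<open>exp\<close>
  of the absolute value, which is at most the sum of two exponentials of the signed sum. Summed over
  all sign patterns, each of these factors into a product of terms
  \<open>exp (e i) + exp (- e i)\<close>; hence the constant \<open>2 * exp 1\<close>.\<close>

lemma khintchine:
  fixes c :: "'i \<Rightarrow> real"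
  assumes I: "finite I" and p: "p > 0" and B: "B > 0" and c: "(\<Sum>i\<in>I. (c i)\<^sup>2) \<le> B\<^sup>2"
  shows "(\<Sum>A\<in>Pow I. \<bar>\<Sum>i\<in>I. sg A i * c i\<bar> powr p) \<le> 2 ^ card I * (2 * exp 1 * p powr p * B powr p)"
proof -
  define d where "d i = c i / B" for i
  have d: "(\<Sum>i\<in>I. (d i)\<^sup>2) \<le> 1"
    using c B by (simp add: d_def power_divide flip: sum_divide_distrib)
  have exp_sum: "(\<Sum>A\<in>Pow I. exp (\<Sum>i\<in>I. sg A i * e i)) \<le> 2 ^ card I * exp 1" if e: "(\<Sum>i\<in>I. (e i)\<^sup>2) \<le> 1" for e :: "'i \<Rightarrow> real"
  proof -
    have "(\<Sum>A\<in>Pow I. exp (\<Sum>i\<in>I. sg A i * e i)) = (\<Sum>A\<in>Pow I. (\<Prod>i\<in>A. exp (e i)) * (\<Prod>i\<in>I - A. exp (- e i)))"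
    proof (rule sum.cong[OF refl])
      fix A assume A: "A \<in> Pow I"
      then have fA: "finite A" using I finite_subset by auto
      have "(\<Sum>i\<in>I. sg A i * e i) = (\<Sum>i\<in>A. e i) + (\<Sum>i\<in>I - A. - e i)"
        using sum.subset_diff[of A I "\<lambda>i. sg A i * e i"] A I by (simp add: sg_def)
      then show "exp (\<Sum>i\<in>I. sg A i * e i) = (\<Prod>i\<in>A. exp (e i)) * (\<Prod>i\<in>I - A. exp (- e i))"
        using I fA by (simp only: exp_add exp_sum finite_Diff)
    qed
    also have "\<dots> = (\<Prod>i\<in>I. exp (e i) + exp (- e i))" by (rule prod_add[OF I, symmetric])
    also have "\<dots> \<le> (\<Prod>i\<in>I. 2 * exp ((e i)\<^sup>2))"
      by (intro prod_mono) (auto intro: exp_plus_exp_minus_le add_nonneg_nonneg)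
    also have "\<dots> = 2 ^ card I * exp (\<Sum>i\<in>I. (e i)\<^sup>2)" using I by (simp add: prod.distrib exp_sum)
    also have "\<dots> \<le> 2 ^ card I * exp 1" using e by simp
    finally show ?thesis .
  qed
  have "(\<Sum>A\<in>Pow I. \<bar>\<Sum>i\<in>I. sg A i * c i\<bar> powr p) = (\<Sum>A\<in>Pow I. B powr p * \<bar>\<Sum>i\<in>I. sg A i * d i\<bar> powr p)"
  proof (rule sum.cong[OF refl])
    fix A
    have "(\<Sum>i\<in>I. sg A i * c i) = B * (\<Sum>i\<in>I. sg A i * d i)"
      using B by (simp add: d_def sum_distrib_left)
    then show "\<bar>\<Sum>i\<in>I. sg A i * c i\<bar> powr p = B powr p * \<bar>\<Sum>i\<in>I. sg A i * d i\<bar> powr p"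
      using B by (simp add: abs_mult powr_mult)
  qed
  also have "\<dots> \<le> (\<Sum>A\<in>Pow I. B powr p * (p powr p * (exp (\<Sum>i\<in>I. sg A i * d i) + exp (\<Sum>i\<in>I. sg A i * (- d i)))))"
  proof (intro sum_mono mult_left_mono)
    fix A
    let ?x = "\<Sum>i\<in>I. sg A i * d i"
    have "\<bar>?x\<bar> powr p \<le> p powr p * exp \<bar>?x\<bar>" by (rule powr_le_exp) (use p in auto)
    also have "exp \<bar>?x\<bar> \<le> exp ?x + exp (- ?x)" by (cases "?x \<ge> 0") auto
    finally show "\<bar>?x\<bar> powr p \<le> p powr p * (exp ?x + exp (\<Sum>i\<in>I. sg A i * (- d i)))"
      by (simp add: sum_negf mult_left_mono)
  qed auto
  also have "\<dots> = B powr p * p powr p * ((\<Sum>A\<in>Pow I. exp (\<Sum>i\<in>I. sg A i * d i)) + (\<Sum>A\<in>Pow I. exp (\<Sum>i\<in>I. sg A i * (- d i))))"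
    by (simp add: sum_distrib_left sum.distrib distrib_left mult_ac)
  also have "\<dots> \<le> B powr p * p powr p * (2 ^ card I * exp 1 + 2 ^ card I * exp 1)"
    by (intro mult_left_mono add_mono exp_sum) (use d in auto)
  finally show ?thesis by (simp add: mult_ac)
qed

text \<open>Khintchine at each point \<open>z\<close>, integrated over \<open>Q\<close>, bounds the
  average over the patterns of each integral. The threshold is \<open>4 * card K\<close> times this
  average, so by Markov's inequality each \<open>k\<close> excludes at most the share
  \<open>1 / (4 * card K)\<close> of the patterns, and the union bound leaves three
  quarters.\<close>

lemma most_sign_choices_good:
  fixes h :: "'k \<Rightarrow> 'i \<Rightarrow> 'v::euclidean_space \<Rightarrow> real"
  assumes I: "finite I" and K: "finite K" and p: "p > 0" and B: "B > 0"
    and [measurable]: "\<And>k i. k \<in> K \<Longrightarrow> i \<in> I \<Longrightarrow> h k i \<in> borel_measurable borel" "Q \<in> sets borel"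
    and h: "\<And>k z. k \<in> K \<Longrightarrow> (\<Sum>i\<in>I. (h k i z)\<^sup>2) \<le> B\<^sup>2 * indicator Q z"
    and V: "emeasure lborel Q = ennreal V" "V > 0"
  shows "4 * card {A \<in> Pow I. \<not> (\<forall>k\<in>K. (\<integral>\<^sup>+z. ennreal (\<bar>\<Sum>i\<in>I. sg A i * h k i z\<bar> powr p) \<partial>lborel)
       \<le> ennreal (4 * real (card K) * (2 * exp 1 * p powr p * B powr p) * V))} \<le> 2 ^ card I"
proof -
  define L where "L = 2 * exp 1 * p powr p * B powr p * V"
  have L: "L > 0" using p B V by (simp add: L_def)
  define F where "F A k = (\<integral>\<^sup>+z. ennreal (\<bar>\<Sum>i\<in>I. sg A i * h k i z\<bar> powr p) \<partial>lborel)" for A k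
  define bad where "bad k = {A \<in> Pow I. \<not> F A k \<le> ennreal (4 * real (card K) * L)}" for k
  have bad: "real (4 * card K * card (bad k)) \<le> 2 ^ card I" if k: "k \<in> K" for k
  proof -
    have fb: "finite (bad k)" using I by (auto simp: bad_def)
    have [measurable]: "i \<in> I \<Longrightarrow> h k i \<in> borel_measurable borel" for i using k by simp
    have "ennreal (real (card (bad k)) * (4 * real (card K) * L)) = (\<Sum>A\<in>bad k. ennreal (4 * real (card K) * L))"
      using L by (simp add: ennreal_of_nat_eq_real_of_nat ennreal_mult[of "real (card (bad k))"])
    also have "\<dots> \<le> (\<Sum>A\<in>bad k. F A k)" by (intro sum_mono) (auto simp: bad_def)
    also have "\<dots> \<le> (\<Sum>A\<in>Pow I. F A k)" by (intro sum_mono2) (auto simp: bad_def I)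
    also have "\<dots> = (\<integral>\<^sup>+z. (\<Sum>A\<in>Pow I. ennreal (\<bar>\<Sum>i\<in>I. sg A i * h k i z\<bar> powr p)) \<partial>lborel)"
      unfolding F_def by (subst nn_integral_sum) auto
    also have "\<dots> \<le> (\<integral>\<^sup>+z. ennreal (2 ^ card I * (2 * exp 1 * p powr p * B powr p)) * indicator Q z \<partial>lborel)"
    proof (intro nn_integral_mono)
      fix z
      show "(\<Sum>A\<in>Pow I. ennreal (\<bar>\<Sum>i\<in>I. sg A i * h k i z\<bar> powr p)) 
         \<le> ennreal (2 ^ card I * (2 * exp 1 * p powr p * B powr p)) * indicator Q z"
      proof (cases "z \<in> Q")
        case True
        then show ?thesis using khintchine[OF I p B, of "\<lambda>i. h k i z"] h[OF k, of z] 
          by (simp add: ennreal_leI)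
      next
        case False
        then have "(\<Sum>i\<in>I. (h k i z)\<^sup>2) \<le> 0" using h[OF k, of z] by simp
        then have "\<forall>i\<in>I. h k i z = 0" using I
          by (metis (no_types, lifting) order_antisym sum_nonneg sum_nonneg_eq_0_iff zero_eq_power2 zero_le_power2)
        then show ?thesis by simp
      qed
    qed
    also have "\<dots> = ennreal (2 ^ card I * (2 * exp 1 * p powr p * B powr p)) * ennreal V"
      by (subst nn_integral_cmult_indicator) (auto simp: V)
    also have "\<dots> = ennreal (2 ^ card I * L)"
      using V p B by (simp add: L_def mult_ac flip: ennreal_mult)
    finally have "real (card (bad k)) * (4 * real (card K) * L) \<le> 2 ^ card I * L"
      using L by (subst (asm) ennreal_le_iff) auto
    then have "real (4 * card K * card (bad k)) * L \<le> 2 ^ card I * L" by (simp add: mult_ac)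
    then show ?thesis using L by (simp only: mult_le_cancel_right_pos)
  qed
  have eq: "{A \<in> Pow I. \<not> (\<forall>k\<in>K. F A k \<le> ennreal (4 * real (card K) * L))} = (\<Union>k\<in>K. bad k)"
    by (auto simp: bad_def)
  have "real (4 * card (\<Union>k\<in>K. bad k)) \<le> 2 ^ card I"
  proof (cases "K = {}")
    case False
    then have cK: "real (card K) > 0" using K by (simp add: card_gt_0_iff)
    have "real (4 * card (\<Union>k\<in>K. bad k)) \<le> (\<Sum>k\<in>K. real (4 * card (bad k)))"
      using card_UN_le[OF K, of bad] by (simp flip: of_nat_sum sum_distrib_left)
    also have "\<dots> \<le> (\<Sum>k\<in>K. 2 ^ card I / real (card K))"
      using bad cK by (intro sum_mono) (simp add: field_simps)
    also have "\<dots> = 2 ^ card I" using cK by simp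
    finally show ?thesis .
  qed simp
  then have "real (4 * card (\<Union>k\<in>K. bad k)) \<le> real (2 ^ card I)" by simp
  then have "4 * card (\<Union>k\<in>K. bad k) \<le> 2 ^ card I" by (simp only: of_nat_le_iff)
  then show ?thesis using eq by (simp add: F_def L_def mult.assoc)
qed

section \<open>The smooth wavelet and the base density\<close>

definition bump :: "real \<Rightarrow> real" where
  "bump x = flat_exp 1 x * flat_exp 1 (- 1 * x + 1)"

text \<open>A smooth copy of \<open>haar\<close>: the product of the two is nonnegative, so their
  integral against each other is positive. The summands \<open>+ 0\<close> and \<open>+ - 1\<close>
  match the rule for affine substitutions literally.\<close>

definition wav :: "real \<Rightarrow> real" where
  "wav x = bump (2 * x + 0) + - 1 * bump (2 * x + - 1)"

text \<open>The support is the interval from -1 to 2, so \<open>theta\<close> is bounded away from 0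
  on \<open>{0..1}\<close>, the part that becomes the region of the wavelets after dilation. The
  leading factor makes the integral 1.\<close>

definition theta :: "real \<Rightarrow> real" where
  "theta x = (1 / (3 * (\<integral>x. bump x \<partial>lborel))) * bump (1 / 3 * x + 1 / 3)"

lemma smooth_alg_bump: "smooth_alg bump"
  unfolding bump_def by (intro smooth_alg.mult smooth_alg_affine_real smooth_alg_flat_exp)

lemma smooth_alg_wav: "smooth_alg wav"
  unfolding wav_def by (intro smooth_alg.add smooth_alg_cmult smooth_alg_affine_real smooth_alg_bump)

lemma smooth_alg_theta: "smooth_alg theta"
  unfolding theta_def by (intro smooth_alg_cmult smooth_alg_affine_real smooth_alg_bump)

lemmas [measurable] = smooth_alg_measurable[OF smooth_alg_bump] smooth_alg_measurable[OF smooth_alg_wav]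
  smooth_alg_measurable[OF smooth_alg_theta]

lemma bump_eq_0: "x \<le> 0 \<or> 1 \<le> x \<Longrightarrow> bump x = 0"
  by (auto simp: bump_def flat_exp_1)

lemma bump_pos: "0 < x \<Longrightarrow> x < 1 \<Longrightarrow> bump x > 0"
  by (auto simp: bump_def flat_exp_1)

lemma bump_nonneg: "bump x \<ge> 0"
  by (auto simp: bump_def flat_exp_1)

lemma integrable_smooth_alg:
  fixes g :: "real \<Rightarrow> real"
  assumes "smooth_alg g" "\<And>x. x \<notin> {a..b} \<Longrightarrow> g x = 0"
  shows "integrable lborel g"
proof -
  have "integrable lborel (\<lambda>z. indicator {a..b} z *\<^sub>R g z)"
    by (rule borel_integrable_compact) (auto intro: smooth_alg_continuous_on assms)
  also have "(\<lambda>z. indicator {a..b} z *\<^sub>R g z) = g"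
    using assms(2) by (auto simp: indicator_def fun_eq_iff)
  finally show ?thesis .
qed

lemma integrable_bump: "integrable lborel bump"
  by (rule integrable_smooth_alg[OF smooth_alg_bump, of 0 1]) (auto simp: bump_eq_0)

lemma integral_pos_lborel:
  fixes g :: "real \<Rightarrow> real"
  assumes "integrable lborel g" "\<And>x. g x \<ge> 0" "a < b" "\<And>x. a < x \<Longrightarrow> x < b \<Longrightarrow> g x > 0"
  shows "(\<integral>x. g x \<partial>lborel) > 0"
proof -
  have "(\<integral>x. g x \<partial>lborel) \<noteq> 0"
  proof
    assume "(\<integral>x. g x \<partial>lborel) = 0"
    then have "AE x in lborel. g x = 0"
      using integral_nonneg_eq_0_iff_AE[OF assms(1)] assms(2) by simp
    then have "AE x in lborel. x \<notin> {a<..<b}" by eventually_elim (use assms(4) in force)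
    then have "emeasure lborel {a<..<b} = 0" by (subst (asm) AE_iff_measurable[of "{a<..<b}"]) auto
    then show False using assms(3) by simp
  qed
  then show ?thesis using Bochner_Integration.integral_nonneg[of lborel g] assms(2) by (simp add: order_less_le)
qed

lemma integral_bump_pos: "(\<integral>x. bump x \<partial>lborel) > 0"
  by (rule integral_pos_lborel[OF integrable_bump bump_nonneg, of 0 1]) (auto intro: bump_pos)

lemma wav_eq_0: "x \<notin> {0<..<1} \<Longrightarrow> wav x = 0"
  by (auto simp: wav_def bump_eq_0 not_less)

lemma wav_nonzero: "wav x \<noteq> 0 \<Longrightarrow> 0 < x \<and> x < 1"
  using wav_eq_0[of x] by auto

lemma integrable_wav: "integrable lborel wav"
  by (rule integrable_smooth_alg[OF smooth_alg_wav, of 0 1]) (auto simp: wav_eq_0)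

lemma integral_wav: "(\<integral>x. wav x \<partial>lborel) = 0"
proof -
  have i: "integrable lborel (\<lambda>x. bump (2 * x + d))" for d
    using lborel_integrable_real_affine[OF integrable_bump, of 2 d] by (simp add: add.commute)
  have h: "(\<integral>x. bump (2 * x + d) \<partial>lborel) = (\<integral>x. bump x \<partial>lborel) / 2" for d
    using lborel_integral_real_affine[of 2 bump d] by (simp add: add.commute)
  show ?thesis unfolding wav_def using i[of 0] i[of "- 1"] h[of 0] h[of "- 1"] by simp
qed

lemma wav_haar_pos: "(\<integral>x. wav x * haar x \<partial>lborel) > 0"
proof -
  have i: "integrable lborel (\<lambda>x. bump (2 * x + d))" for d
    using lborel_integrable_real_affine[OF integrable_bump, of 2 d] by (simp add: add.commute)
  have "(\<lambda>x. wav x * haar x) = (\<lambda>x. bump (2 * x + 0) + bump (2 * x + - 1))"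
  proof
    fix x :: real
    consider "x < 0" | "0 \<le> x" "x < 1/2" | "1/2 \<le> x" "x < 1" | "x \<ge> 1" by linarith
    then show "wav x * haar x = bump (2 * x + 0) + bump (2 * x + - 1)"
      by cases (auto simp: wav_def haar_eq indicator_def bump_eq_0)
  qed
  moreover have h: "(\<integral>x. bump (2 * x + d) \<partial>lborel) = (\<integral>x. bump x \<partial>lborel) / 2" for d
    using lborel_integral_real_affine[of 2 bump d] by (simp add: add.commute)
  ultimately show ?thesis using i[of 0] i[of "- 1"] h[of 0] h[of "- 1"] integral_bump_pos by simp
qed

lemma wav_powr_pos:
  assumes "p > 0" 
  shows "integrable lborel (\<lambda>x. \<bar>wav x\<bar> powr p)" "(\<integral>x. \<bar>wav x\<bar> powr p \<partial>lborel) > 0"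
proof -
  have c: "continuous_on {0..1} (\<lambda>x. \<bar>wav x\<bar> powr p)"
    using assms by (intro continuous_on_powr' continuous_on_rabs continuous_on_const smooth_alg_continuous_on smooth_alg_wav) auto
  have "integrable lborel (\<lambda>z. indicator {0..1::real} z *\<^sub>R \<bar>wav z\<bar> powr p)"
    by (rule borel_integrable_compact) (auto intro: c)
  also have "(\<lambda>z. indicator {0..1::real} z *\<^sub>R \<bar>wav z\<bar> powr p) = (\<lambda>x. \<bar>wav x\<bar> powr p)"
    by (auto simp: indicator_def fun_eq_iff dest: wav_nonzero)
  finally show i: "integrable lborel (\<lambda>x. \<bar>wav x\<bar> powr p)" .
  show "(\<integral>x. \<bar>wav x\<bar> powr p \<partial>lborel) > 0"
  proof (rule integral_pos_lborel[OF i, of 0 "1/2"])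
    fix x :: real assume "0 < x" "x < 1/2"
    then have "wav x > 0" using bump_pos[of "2 * x"] by (simp add: wav_def bump_eq_0)
    then show "\<bar>wav x\<bar> powr p > 0" by simp
  qed auto
qed

lemma theta_nonneg: "theta x \<ge> 0"
  using integral_bump_pos by (simp add: theta_def bump_nonneg)

lemma theta_eq_0: "x \<notin> {- 1<..<2} \<Longrightarrow> theta x = 0"
  by (auto simp: theta_def bump_eq_0 not_less)

lemma integrable_theta: "integrable lborel theta"
  by (rule integrable_smooth_alg[OF smooth_alg_theta, of "- 1" 2]) (auto simp: theta_eq_0)

lemma integral_theta: "(\<integral>x. theta x \<partial>lborel) = 1"
  using lborel_integral_real_affine[of "1/3" bump "1/3"] integral_bump_pos
  by (simp add: theta_def add.commute)

lemma theta_lower_bound: "\<exists>\<beta>>0. \<forall>x\<in>{0..1}. theta x \<ge> \<beta>"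
proof -
  have "\<exists>x\<in>{0..1::real}. \<forall>y\<in>{0..1}. theta x \<le> theta y"
    by (rule continuous_attains_inf) (auto intro: smooth_alg_continuous_on smooth_alg_theta)
  then obtain x where x: "x \<in> {0..1}" "\<And>y. y \<in> {0..1} \<Longrightarrow> theta x \<le> theta y" by blast
  have "theta x > 0" using x(1) integral_bump_pos by (simp add: theta_def bump_pos)
  with x show ?thesis by blast
qed

text \<open>Outside the closed interval all derivatives vanish for local reasons; at the two end
  points they vanish by continuity.\<close>

lemma higher_deriv_eq_0:
  fixes g :: "real \<Rightarrow> real"
  assumes g: "smooth_alg g" "\<And>x. x \<notin> {a<..<b} \<Longrightarrow> g x = 0" and x: "x \<notin> {a<..<b}"
  shows "(deriv ^^ i) g x = 0"
proof -
  have fold: "(deriv ^^ i) g = foldr dir_deriv (replicate i 1) g"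
  proof -
    have "dir_deriv (1::real) = deriv" by (rule ext) (rule dir_deriv_1)
    then show ?thesis by (simp add: foldr_replicate)
  qed
  have 0: "(deriv ^^ i) g y = 0" if "y \<in> - {a..b}" for y
    unfolding fold by (rule foldr_dir_deriv_eq_0[of "- {a..b}"]) (use that g(2) in auto)
  have c: "continuous_on X ((deriv ^^ i) g)" for X
    by (intro smooth_alg_continuous_on smooth_alg_higher_deriv g)
  have "(deriv ^^ i) g x = 0" if "x \<le> a"
    by (rule continuous_constant_on_closure[of "{..<a}"]) (use that 0 c in auto)
  moreover have "(deriv ^^ i) g x = 0" if "b \<le> x"
    by (rule continuous_constant_on_closure[of "{b<..}"]) (use that 0 c in auto)
  ultimately show ?thesis using x by fastforce
qed

lemma higher_deriv_bounded:
  fixes g :: "real \<Rightarrow> real"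
  assumes g: "smooth_alg g" "\<And>x. x \<notin> {a<..<b} \<Longrightarrow> g x = 0"
  shows "\<exists>U. \<forall>i\<le>S. \<forall>x. \<bar>(deriv ^^ i) g x\<bar> \<le> U"
proof -
  have "\<exists>U. \<forall>x. \<bar>(deriv ^^ i) g x\<bar> \<le> U" for i
  proof -
    have "bounded ((deriv ^^ i) g ` {a..b})"
      by (intro compact_imp_bounded compact_continuous_image smooth_alg_continuous_on smooth_alg_higher_deriv g) auto
    then obtain U where "\<forall>y\<in>(deriv ^^ i) g ` {a..b}. norm y \<le> U" unfolding bounded_iff by blast
    then have U: "\<bar>(deriv ^^ i) g x\<bar> \<le> U" if "x \<in> {a..b}" for x using that by auto
    have "\<bar>(deriv ^^ i) g x\<bar> \<le> \<bar>U\<bar>" for x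
      using U[of x] higher_deriv_eq_0[OF g, where x = x and i = i] by (cases "x \<in> {a..b}") auto
    then show ?thesis by blast
  qed
  then obtain U where U: "\<And>i x. \<bar>(deriv ^^ i) g x\<bar> \<le> U i" by metis
  have "\<bar>(deriv ^^ i) g x\<bar> \<le> (\<Sum>i\<le>S. \<bar>U i\<bar>)" if "i \<le> S" for i x
  proof -
    have "\<bar>U i\<bar> \<le> (\<Sum>i\<le>S. \<bar>U i\<bar>)" by (rule member_le_sum) (use that in auto)
    then show ?thesis using U[of i x] by linarith
  qed
  then show ?thesis by blast
qed

definition deriv_bound :: "nat \<Rightarrow> real \<Rightarrow> bool" where
  "deriv_bound S U \<longleftrightarrow> U \<ge> 1 \<and> (\<forall>i\<le>S. \<forall>x. \<bar>(deriv ^^ i) wav x\<bar> \<le> U \<and> \<bar>(deriv ^^ i) theta x\<bar> \<le> U)"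

lemma deriv_bound_exists: "\<exists>U. deriv_bound S U"
proof -
  obtain U1 where "\<forall>i\<le>S. \<forall>x. \<bar>(deriv ^^ i) wav x\<bar> \<le> U1"
    using higher_deriv_bounded[OF smooth_alg_wav wav_eq_0] by blast
  moreover obtain U2 where "\<forall>i\<le>S. \<forall>x. \<bar>(deriv ^^ i) theta x\<bar> \<le> U2"
    using higher_deriv_bounded[OF smooth_alg_theta theta_eq_0] by blast
  ultimately show ?thesis unfolding deriv_bound_def
    by (intro exI[of _ "max 1 (max U1 U2)"]) (auto simp: le_max_iff_disj)
qed

section \<open>The family of perturbed densities\<close>

definition big_box :: "nat \<Rightarrow> 'v::euclidean_space set" where
  "big_box K = cbox 0 (real K *\<^sub>R One)"

definition base_dens :: "nat \<Rightarrow> 'v::euclidean_space \<Rightarrow> real" where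
  "base_dens K = tprod (\<lambda>b x. 1 / real K * theta (1 / real K * x + 0))"

text \<open>For each \<open>j\<close> the cells at these positions tile \<open>big_box K\<close>.
  \<open>PiE\<close> fixes the values outside \<open>Basis\<close>, which keeps the index set finite
  and lets positions be identified by their values on \<open>Basis\<close>.\<close>

definition cells :: "nat \<Rightarrow> nat \<Rightarrow> (nat \<Rightarrow> 'v::euclidean_space \<Rightarrow> nat) \<Rightarrow> (nat \<times> ('v \<Rightarrow> nat)) set" where
  "cells J K N = (SIGMA j:{..<J}. PiE Basis (\<lambda>b. {..<K * 2 ^ N j b}))"

definition psi :: "(nat \<Rightarrow> 'v::euclidean_space \<Rightarrow> nat) \<Rightarrow> nat \<times> ('v \<Rightarrow> nat) \<Rightarrow> 'v \<Rightarrow> real" where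
  "psi N i = cellfun wav (N (fst i)) (snd i)"

definition fam :: "nat \<Rightarrow> nat \<Rightarrow> (nat \<Rightarrow> 'v::euclidean_space \<Rightarrow> nat) \<Rightarrow> real 
    \<Rightarrow> (nat \<times> ('v \<Rightarrow> nat)) set \<Rightarrow> 'v \<Rightarrow> real" where
  "fam J K N a A z = base_dens K z + (\<Sum>i\<in>cells J K N. sg A i * (a * psi N i z))"

lemma mem_big_box: "z \<in> big_box K \<longleftrightarrow> (\<forall>b\<in>Basis. 0 \<le> z \<bullet> b \<and> z \<bullet> b \<le> real K)"
  by (simp add: big_box_def mem_box)

lemma emeasure_big_box: "emeasure lborel (big_box K :: 'v::euclidean_space set) = ennreal (real K ^ DIM('v))"
  unfolding big_box_def by (subst emeasure_lborel_cbox) auto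

lemma big_box_measurable [measurable]: "big_box K \<in> sets borel"
  by (simp add: big_box_def)

lemma finite_cells: "finite (cells J K N)"
  unfolding cells_def by (intro finite_SigmaI finite_PiE) auto

lemma psi_eq: "psi N (j, k) = tprod (\<lambda>b x. wav (2 ^ N j b * x + - real (k b)))"
  by (simp add: psi_def cellfun_def)

lemma foldr_dir_deriv_psi:
  assumes "set l \<subseteq> Basis"
  shows "foldr dir_deriv l (psi N (j, k)) z 
    = (\<Prod>b\<in>Basis. (2 ^ N j b) ^ count_list l b * (deriv ^^ count_list l b) wav (2 ^ N j b * (z \<bullet> b) - real (k b)))"
proof -
  have "foldr dir_deriv l (psi N (j, k)) = tprod (\<lambda>b. (deriv ^^ count_list l b) (\<lambda>x. wav (2 ^ N j b * x + - real (k b))))"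
    unfolding psi_eq by (rule foldr_dir_deriv_tprod[OF _ assms]) (intro smooth_alg_affine_real smooth_alg_wav)
  moreover have "(deriv ^^ m) (\<lambda>x. wav (c * x - d)) = (\<lambda>x. c ^ m * (deriv ^^ m) wav (c * x - d))" for m c d
    using higher_deriv_affine[OF smooth_alg_wav, of m c "- d"] by simp
  ultimately show ?thesis by (simp add: tprod_def)
qed

lemma smooth_alg_psi: "smooth_alg (psi N i)"
  by (cases i) (auto simp: psi_eq intro!: smooth_alg_tprod smooth_alg_affine_real smooth_alg_wav simp del: add_uminus_conv_diff)

lemma psi_support:
  assumes l: "set l \<subseteq> Basis" and nz: "foldr dir_deriv l (psi N (j, k)) z \<noteq> 0" and b: "b \<in> Basis"
  shows "2 ^ N j b * (z \<bullet> b) - real (k b) \<in> {0<..<1}"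
proof (rule ccontr)
  assume "2 ^ N j b * (z \<bullet> b) - real (k b) \<notin> {0<..<1}"
  from higher_deriv_eq_0[OF smooth_alg_wav wav_eq_0 this]
  have "\<exists>b\<in>Basis. (2 ^ N j b) ^ count_list l b * (deriv ^^ count_list l b) wav (2 ^ N j b * (z \<bullet> b) - real (k b)) = 0"
    using b by auto
  from prod_zero[OF finite_Basis this] nz show False
    unfolding foldr_dir_deriv_psi[OF l] by (rule notE[rotated])
qed

lemma psi_support_floor:
  assumes "set l \<subseteq> Basis" "foldr dir_deriv l (psi N (j, k)) z \<noteq> 0" "b \<in> Basis"
  shows "k b = nat \<lfloor>2 ^ N j b * (z \<bullet> b)\<rfloor>"
proof -
  have "\<lfloor>2 ^ N j b * (z \<bullet> b)\<rfloor> = int (k b)"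
    using psi_support[OF assms] by (auto simp: floor_eq_iff)
  then show ?thesis by simp
qed

lemma psi_support_box:
  assumes "set l \<subseteq> Basis" "foldr dir_deriv l (psi N i) z \<noteq> 0" "i \<in> cells J K N"
  shows "z \<in> big_box K"
  unfolding mem_big_box
proof
  fix b :: 'a assume b: "b \<in> Basis"
  obtain j k where i: "i = (j, k)" by (cases i)
  have "2 ^ N j b * (z \<bullet> b) - real (k b) \<in> {0<..<1}" using psi_support[OF assms(1) assms(2)[unfolded i] b] .
  then have "real (k b) < 2 ^ N j b * (z \<bullet> b)" "2 ^ N j b * (z \<bullet> b) < real (k b) + 1" by auto
  moreover have "k b \<in> {..<K * 2 ^ N j b}" using assms(3) i b by (auto simp: cells_def dest: PiE_mem)
  then have "k b + 1 \<le> K * 2 ^ N j b" by simp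
  then have "real (k b + 1) \<le> real (K * 2 ^ N j b)" by (simp only: of_nat_le_iff)
  then have "real (k b) + 1 \<le> 2 ^ N j b * real K" by (simp add: mult.commute)
  ultimately have "2 ^ N j b * 0 < 2 ^ N j b * (z \<bullet> b)" "2 ^ N j b * (z \<bullet> b) < 2 ^ N j b * real K" by linarith+
  then show "0 \<le> z \<bullet> b \<and> z \<bullet> b \<le> real K" by (simp only: mult_less_cancel_left_pos zero_less_power zero_less_numeral) simp
qed

text \<open>For fixed \<open>j\<close> a point lies in at most one cell, the one with position
  \<open>k0\<close> read off from the floors of its coordinates. Each of the \<open>J\<close> scales
  thus contributes at most one term, and this stays true for derivatives of the wavelets.\<close>

lemma sum_cells_le:
  fixes F :: "nat \<times> ('v::euclidean_space \<Rightarrow> nat) \<Rightarrow> real"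
  assumes l: "set l \<subseteq> Basis" and B: "B \<ge> 0"
    and F: "\<And>i. i \<in> cells J K N \<Longrightarrow> F i \<le> B" "\<And>i. i \<in> cells J K N \<Longrightarrow> foldr dir_deriv l (psi N i) z = 0 \<Longrightarrow> F i = 0"
  shows "(\<Sum>i\<in>cells J K N. F i) \<le> real J * B"
proof -
  have "(\<Sum>i\<in>cells J K N. F i) = (\<Sum>j<J. \<Sum>k\<in>PiE Basis (\<lambda>b. {..<K * 2 ^ N j b}). F (j, k))"
    unfolding cells_def by (subst sum.Sigma) (auto intro: finite_PiE)
  also have "\<dots> \<le> (\<Sum>j<J. B)"
  proof (rule sum_mono)
    fix j assume j: "j \<in> {..<J}"
    let ?P = "PiE (Basis :: 'v set) (\<lambda>b. {..<K * 2 ^ N j b})"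
    define k0 where "k0 = restrict (\<lambda>b. nat \<lfloor>2 ^ N j b * (z \<bullet> b)\<rfloor>) Basis"
    have P: "(j, k) \<in> cells J K N" if "k \<in> ?P" for k using that j by (auto simp: cells_def)
    have 0: "F (j, k) = 0" if k: "k \<in> ?P - {k0}" for k
    proof (rule F(2)[OF P])
      show "k \<in> ?P" using k by auto
      show "foldr dir_deriv l (psi N (j, k)) z = 0"
      proof (rule ccontr)
        assume "foldr dir_deriv l (psi N (j, k)) z \<noteq> 0"
        then have "k b = k0 b" if "b \<in> Basis" for b
          using psi_support_floor[OF l _ that] that by (simp add: k0_def)
        then have "k = k0" using k by (intro extensionalityI[of _ Basis]) (auto simp: k0_def PiE_def)
        then show False using k by auto
      qed
    qed
    have "(\<Sum>k\<in>?P. F (j, k)) = (\<Sum>k\<in>?P \<inter> {k0}. F (j, k))"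
      by (rule sum.mono_neutral_right) (use 0 in \<open>auto intro: finite_PiE\<close>)
    also have "\<dots> \<le> B"
      by (cases "k0 \<in> ?P") (use F(1)[OF P] B in \<open>auto simp: Int_insert_right\<close>)
    finally show "(\<Sum>k\<in>?P. F (j, k)) \<le> B" .
  qed
  finally show ?thesis by simp
qed

text \<open>Each derivative in direction \<open>b\<close> costs the factor \<open>2 ^ N j b\<close>.
  The exponent \<open>e\<close> bounds the total cost, and it is through \<open>e\<close> that the
  scales enter the Sobolev norm.\<close>

lemma psi_deriv_bound:
  fixes N :: "nat \<Rightarrow> 'v::euclidean_space \<Rightarrow> nat"
  assumes l: "set l \<subseteq> Basis" "length l \<le> S" and U: "deriv_bound S U"
    and e: "(\<Sum>b\<in>Basis. N j b * count_list l b) \<le> e"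
  shows "\<bar>foldr dir_deriv l (psi N (j, k)) z\<bar> \<le> U ^ DIM('v) * 2 ^ e"
proof -
  have "\<bar>foldr dir_deriv l (psi N (j, k)) z\<bar> \<le> (\<Prod>b\<in>(Basis::'v set). 2 ^ (N j b * count_list l b) * U)"
    unfolding foldr_dir_deriv_psi[OF l(1)] abs_prod
  proof (intro prod_mono conjI)
    fix b :: 'v
    have "count_list l b \<le> S" using count_le_length[of l b] l(2) by linarith
    then have "\<bar>(deriv ^^ count_list l b) wav x\<bar> \<le> U" for x using U by (simp add: deriv_bound_def)
    then show "\<bar>(2 ^ N j b) ^ count_list l b * (deriv ^^ count_list l b) wav (2 ^ N j b * (z \<bullet> b) - real (k b))\<bar>
      \<le> 2 ^ (N j b * count_list l b) * U"
      by (simp add: abs_mult power_mult)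
  qed simp
  also have "\<dots> = U ^ DIM('v) * 2 ^ (\<Sum>b\<in>Basis. N j b * count_list l b)"
    by (simp add: prod.distrib power_sum)
  also have "\<dots> \<le> U ^ DIM('v) * 2 ^ e"
    using U e by (intro mult_left_mono power_increasing) (auto simp: deriv_bound_def)
  finally show ?thesis .
qed

lemma abs_psi_le:
  fixes N :: "nat \<Rightarrow> 'v::euclidean_space \<Rightarrow> nat"
  assumes U: "deriv_bound S U"
  shows "\<bar>psi N i z\<bar> \<le> U ^ DIM('v)"
  using psi_deriv_bound[of "[]" S U N "fst i" 0 "snd i" z] U by (cases i) auto

text \<open>The worst case over all signs, hence the factor \<open>J\<close>. It serves only to keep
  the densities positive, where it is harmless because the amplitude tends to 0 for fixed
  \<open>J\<close>.\<close>

lemma sum_psi_le: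
  fixes N :: "nat \<Rightarrow> 'v::euclidean_space \<Rightarrow> nat"
  assumes U: "deriv_bound S U" and a: "a \<ge> 0"
  shows "\<bar>\<Sum>i\<in>cells J K N. sg A i * (a * psi N i z)\<bar> \<le> real J * (a * U ^ DIM('v))"
proof -
  have "\<bar>\<Sum>i\<in>cells J K N. sg A i * (a * psi N i z)\<bar> \<le> (\<Sum>i\<in>cells J K N. \<bar>sg A i * (a * psi N i z)\<bar>)" by (rule sum_abs)
  also have "\<dots> \<le> real J * (a * U ^ DIM('v))"
  proof (rule sum_cells_le[of "[]" _ J K N _ z])
    fix i
    have "a * \<bar>psi N i z\<bar> \<le> a * U ^ DIM('v)" by (intro mult_left_mono abs_psi_le[OF U] a)
    then show "\<bar>sg A i * (a * psi N i z)\<bar> \<le> a * U ^ DIM('v)" using a by (auto simp: abs_mult sg_def)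
  qed (use U a in \<open>auto simp: deriv_bound_def\<close>)
  finally show ?thesis .
qed

lemma sum_psi_eq_0: "z \<notin> big_box K \<Longrightarrow> (\<Sum>i\<in>cells J K N. sg A i * (a * psi N i z)) = 0"
  using psi_support_box[of "[]" N _ z J K] by (intro sum.neutral) auto

text \<open>The square function needed for Khintchine's inequality. One cell per scale contributes
  at each point, so it grows like \<open>sqrt J\<close> and not like \<open>J\<close>.\<close>

lemma sum_psi_deriv_square_le:
  fixes N :: "nat \<Rightarrow> 'v::euclidean_space \<Rightarrow> nat"
  assumes l: "set l \<subseteq> Basis" "length l \<le> S" and U: "deriv_bound S U"
    and e: "\<And>j. j < J \<Longrightarrow> (\<Sum>b\<in>Basis. N j b * count_list l b) \<le> e"
  shows "(\<Sum>i\<in>cells J K N. (a * foldr dir_deriv l (psi N i) z)\<^sup>2) \<le> (\<bar>a\<bar> * sqrt (real J) * U ^ DIM('v) * 2 ^ e)\<^sup>2 * indicator (big_box K) z"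
proof (cases "z \<in> big_box K")
  case True
  have "(\<Sum>i\<in>cells J K N. (a * foldr dir_deriv l (psi N i) z)\<^sup>2) \<le> real J * (a * (U ^ DIM('v) * 2 ^ e))\<^sup>2"
  proof (rule sum_cells_le[OF l(1), of _ J K N _ z])
    fix i assume "i \<in> cells J K N"
    then obtain j k where i: "i = (j, k)" "j < J" by (auto simp: cells_def)
    have "\<bar>a * foldr dir_deriv l (psi N i) z\<bar> \<le> \<bar>a * (U ^ DIM('v) * 2 ^ e)\<bar>"
      unfolding i abs_mult[of a] using psi_deriv_bound[OF l U, of N j e k z] e[OF i(2)]
      by (intro mult_left_mono[OF order_trans[OF _ abs_ge_self]]) auto
    then show "(a * foldr dir_deriv l (psi N i) z)\<^sup>2 \<le> (a * (U ^ DIM('v) * 2 ^ e))\<^sup>2"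
      by (simp only: abs_le_square_iff)
  qed auto
  then show ?thesis using True by (simp add: power_mult_distrib mult_ac)
next
  case False
  then have "foldr dir_deriv l (psi N i) z = 0" if "i \<in> cells J K N" for i
    using psi_support_box[OF l(1) _ that] by blast
  then show ?thesis using False by simp
qed

lemma base_dens_eq: "base_dens K z = (\<Prod>b\<in>Basis. theta (z \<bullet> b / real K) / real K)"
  by (simp add: base_dens_def tprod_def)

lemma smooth_alg_base_dens: "smooth_alg (base_dens K)"
  unfolding base_dens_def
  by (intro smooth_alg_tprod smooth_alg_cmult smooth_alg_affine_real smooth_alg_theta)

lemma base_dens_nonneg: "base_dens K z \<ge> 0"
  unfolding base_dens_eq by (intro prod_nonneg) (auto simp: theta_nonneg)

lemma base_dens_ge:
  fixes z :: "'v::euclidean_space"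
  assumes "\<forall>x\<in>{0..1}. theta x \<ge> \<beta>" "\<beta> > 0" "K \<ge> 1" "z \<in> big_box K"
  shows "base_dens K z \<ge> (\<beta> / real K) ^ DIM('v)"
proof -
  have "(\<Prod>b\<in>(Basis :: 'v set). \<beta> / real K) \<le> base_dens K z"
    unfolding base_dens_eq
  proof (intro prod_mono conjI divide_right_mono)
    fix b :: 'v assume "b \<in> Basis"
    then have "z \<bullet> b / real K \<in> {0..1}" using assms(3,4) by (auto simp: mem_big_box)
    then show "\<beta> \<le> theta (z \<bullet> b / real K)" using assms(1) by blast
  qed (use assms in auto)
  then show ?thesis by simp
qed

definition outer_box :: "nat \<Rightarrow> 'v::euclidean_space set" where
  "outer_box K = cbox (- (real K *\<^sub>R One)) ((2 * real K) *\<^sub>R One)"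

lemma outer_box_measurable [measurable]: "outer_box K \<in> sets borel"
  by (simp add: outer_box_def)

lemma mem_outer_box: "z \<in> outer_box K \<longleftrightarrow> (\<forall>b\<in>Basis. - real K \<le> z \<bullet> b \<and> z \<bullet> b \<le> 2 * real K)"
  by (simp add: outer_box_def mem_box)

lemma big_box_subset_outer_box: "big_box K \<subseteq> outer_box K"
  by (force simp: mem_big_box mem_outer_box)

lemma emeasure_outer_box: "emeasure lborel (outer_box K :: 'v::euclidean_space set) = ennreal ((3 * real K) ^ DIM('v))"
  unfolding outer_box_def by (subst emeasure_lborel_cbox) (auto simp: algebra_simps)

lemma foldr_dir_deriv_base_dens:
  assumes "set l \<subseteq> Basis"
  shows "foldr dir_deriv l (base_dens K) z 
    = (\<Prod>b\<in>Basis. 1 / real K * ((1 / real K) ^ count_list l b * (deriv ^^ count_list l b) theta (z \<bullet> b / real K)))"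
proof -
  have "foldr dir_deriv l (base_dens K) = tprod (\<lambda>b. (deriv ^^ count_list l b) (\<lambda>x. 1 / real K * theta (1 / real K * x + 0)))"
    unfolding base_dens_def
    by (rule foldr_dir_deriv_tprod[OF _ assms]) (intro smooth_alg_cmult smooth_alg_affine_real smooth_alg_theta)
  moreover have aff: "(deriv ^^ m) (\<lambda>x. c * theta (d * x + e)) = (\<lambda>x. c * (d ^ m * (deriv ^^ m) theta (d * x + e)))" for m c d e
  proof -
    have fold: "(deriv ^^ m) g = foldr dir_deriv (replicate m 1) g" for g :: "real \<Rightarrow> real"
    proof -
      have "dir_deriv (1::real) = deriv" by (rule ext) (rule dir_deriv_1)
      then show ?thesis by (simp add: foldr_replicate)
    qed
    have "(deriv ^^ m) (\<lambda>x. c * theta (d * x + e)) = (\<lambda>x. c * (deriv ^^ m) (\<lambda>x. theta (d * x + e)) x)"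
      unfolding fold by (intro foldr_dir_deriv_cmult smooth_alg_affine_real smooth_alg_theta)
    then show ?thesis by (simp add: higher_deriv_affine[OF smooth_alg_theta])
  qed
  ultimately have "foldr dir_deriv l (base_dens K) z = (\<Prod>b\<in>Basis. 1 / real K * 
      ((1 / real K) ^ count_list l b * (deriv ^^ count_list l b) theta (1 / real K * (z \<bullet> b) + 0)))"
    by (simp only: tprod_def)
  then show ?thesis by simp
qed

text \<open>Dilation by \<open>K\<close> costs a factor \<open>1 / K\<close> per coordinate to keep
  the mass 1 and gains another \<open>1 / K\<close> per derivative.\<close>

lemma base_dens_deriv_bound:
  fixes z :: "'v::euclidean_space"
  assumes l: "set l \<subseteq> Basis" "length l \<le> S" and U: "deriv_bound S U" and K: "K \<ge> 1"
  shows "\<bar>foldr dir_deriv l (base_dens K) z\<bar> \<le> U ^ DIM('v) / real K ^ (DIM('v) + length l) * indicator (outer_box K) z"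
proof (cases "z \<in> outer_box K")
  case True
  have "\<bar>foldr dir_deriv l (base_dens K) z\<bar> \<le> (\<Prod>b\<in>(Basis::'v set). (1 / real K * (1 / real K) ^ count_list l b) * U)"
    unfolding foldr_dir_deriv_base_dens[OF l(1)] abs_prod
  proof (intro prod_mono conjI)
    fix b :: 'v
    have "count_list l b \<le> S" using count_le_length[of l b] l(2) by linarith
    then have "\<bar>(deriv ^^ count_list l b) theta x\<bar> \<le> U" for x using U by (simp add: deriv_bound_def)
    then have "(1 / real K * (1 / real K) ^ count_list l b) * \<bar>(deriv ^^ count_list l b) theta (z \<bullet> b / real K)\<bar>
       \<le> (1 / real K * (1 / real K) ^ count_list l b) * U"
      by (intro mult_left_mono) auto
    then show "\<bar>1 / real K * ((1 / real K) ^ count_list l b * (deriv ^^ count_list l b) theta (z \<bullet> b / real K))\<bar>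
      \<le> (1 / real K * (1 / real K) ^ count_list l b) * U"
      by (simp add: abs_mult)
  qed simp
  also have "\<dots> = U ^ DIM('v) * (1 / real K) ^ DIM('v) * (1 / real K) ^ (\<Sum>b\<in>Basis. count_list l b)"
    by (simp only: prod.distrib prod_constant power_sum mult_ac)
  also have "(\<Sum>b\<in>Basis. count_list l b) = length l" using sum_count_set[OF l(1)] by simp
  finally show ?thesis using True by (simp add: power_add power_divide)
next
  case False
  then obtain b where b: "b \<in> Basis" "\<not> (- real K \<le> z \<bullet> b \<and> z \<bullet> b \<le> 2 * real K)" by (auto simp: mem_outer_box)
  then have "z \<bullet> b / real K \<notin> {- 1<..<2}" using K by (auto simp: field_simps)
  from higher_deriv_eq_0[OF smooth_alg_theta theta_eq_0 this]
  have "\<exists>b\<in>Basis. 1 / real K * ((1 / real K) ^ count_list l b * (deriv ^^ count_list l b) theta (z \<bullet> b / real K)) = 0"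
    using b(1) by auto
  from prod_zero[OF finite_Basis this] show ?thesis
    using False unfolding foldr_dir_deriv_base_dens[OF l(1)] by simp
qed

lemma base_dens_eq_0: "z \<notin> outer_box K \<Longrightarrow> K \<ge> 1 \<Longrightarrow> base_dens K z = 0"
  using base_dens_deriv_bound[of "[]" 0 _ K z] deriv_bound_exists[of 0] by force

lemma base_dens_integral:
  assumes "K \<ge> 1"
  shows "integrable lborel (base_dens K)" "(\<integral>z. base_dens K z \<partial>lborel) = 1"
proof -
  have i: "integrable lborel (\<lambda>x. 1 / real K * theta (1 / real K * x + 0))"
    using lborel_integrable_real_affine[OF integrable_theta, of "1 / real K" 0] assms by simp
  have v: "(\<integral>x. 1 / real K * theta (1 / real K * x + 0) \<partial>lborel) = 1"
    using lborel_integral_real_affine[of "1 / real K" theta 0] assms by (simp add: integral_theta)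
  show "integrable lborel (base_dens K)" "(\<integral>z. base_dens K z \<partial>lborel) = 1"
    unfolding base_dens_def by (subst tprod_integral | rule i | simp only: v prod.neutral_const)+
qed

lemma psi_integral: "integrable lborel (psi N i)" "(\<integral>z. psi N (i :: nat \<times> ('v::euclidean_space \<Rightarrow> nat)) z \<partial>lborel) = 0"
proof -
  obtain j k where i: "i = (j, k)" by (cases i)
  have int: "integrable lborel (\<lambda>x. wav (2 ^ N j b * x - real (k b)))" for b
    by (rule bump_integrable_dyadic[OF integrable_wav])
  show "integrable lborel (psi N i)" unfolding i psi_eq by (rule tprod_integral) (use int in simp)
  have "(\<Prod>b\<in>(Basis :: 'v set). \<integral>x. wav (2 ^ N j b * x + - real (k b)) \<partial>lborel) = 0"
    using bump_integral_dyadic[of wav] integral_wav SOME_Basis by (intro prod_zero) auto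
  then show "(\<integral>z. psi N i z \<partial>lborel) = 0"
    unfolding i psi_eq by (subst tprod_integral(2)) (use int in auto)
qed

lemma psi_square_integral:
  fixes N :: "nat \<Rightarrow> 'v::euclidean_space \<Rightarrow> nat"
  assumes U: "deriv_bound S U"
  shows "(\<integral>\<^sup>+z. ennreal ((psi N (j, k) z)\<^sup>2) \<partial>lborel) \<le> ennreal ((U ^ DIM('v))\<^sup>2 / 2 ^ (\<Sum>b\<in>Basis. N j b))"
proof -
  have i: "integrable lborel (\<lambda>x. wav x * wav x)"
    by (rule integrable_smooth_alg[of _ 0 1]) (auto intro: smooth_alg.mult smooth_alg_wav simp: wav_eq_0)
  have le: "(\<integral>x. wav x * wav x \<partial>lborel) \<le> U\<^sup>2"
  proof -
    have w: "wav x * wav x \<le> U\<^sup>2 * indicator {0..1} x" for x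
    proof (cases "x \<in> {0..1}")
      case True
      have "\<bar>wav x\<bar> \<le> U" using U by (auto simp: deriv_bound_def dest: spec[of _ 0])
      then have "(wav x)\<^sup>2 \<le> U\<^sup>2" using power_mono[of "\<bar>wav x\<bar>" U 2] by simp
      then show ?thesis using True by (simp add: power2_eq_square)
    qed (auto simp: wav_eq_0)
    have "(\<integral>x. wav x * wav x \<partial>lborel) \<le> (\<integral>x. U\<^sup>2 * indicator {0..1::real} x \<partial>lborel)"
      using i w by (intro integral_mono_AE AE_I2) simp_all
    then show ?thesis by simp
  qed
  have int: "integrable lborel (\<lambda>x. wav (2 ^ N j b * x - real (k b)) * wav (2 ^ N j b * x - real (k b)))" for b
    using bump_integrable_dyadic[OF i] by simp
  have val: "(\<integral>x. wav (2 ^ N j b * x - real (k b)) * wav (2 ^ N j b * x - real (k b)) \<partial>lborel) = (\<integral>x. wav x * wav x \<partial>lborel) / 2 ^ N j b" for b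
    using bump_integral_dyadic[of "\<lambda>x. wav x * wav x"] by simp
  have eq: "(psi N (j, k) z)\<^sup>2 = tprod (\<lambda>b x. wav (2 ^ N j b * x - real (k b)) * wav (2 ^ N j b * x - real (k b))) z" for z
    by (simp add: psi_eq power2_eq_square tprod_mult)
  have "(\<integral>\<^sup>+z. ennreal ((psi N (j, k) z)\<^sup>2) \<partial>lborel) = ennreal (\<integral>z. (psi N (j, k) z)\<^sup>2 \<partial>lborel)"
  proof (rule nn_integral_eq_integral)
    show "integrable lborel (\<lambda>z. (psi N (j, k) z)\<^sup>2)" unfolding eq by (rule tprod_integral) (rule int)
  qed simp
  also have "(\<integral>z. (psi N (j, k) z)\<^sup>2 \<partial>lborel) = (\<Prod>b\<in>(Basis :: 'v set). (\<integral>x. wav x * wav x \<partial>lborel) / 2 ^ N j b)"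
    unfolding eq by (subst tprod_integral(2)) (auto simp: int val)
  also have "\<dots> \<le> (\<Prod>b\<in>(Basis :: 'v set). U\<^sup>2 / 2 ^ N j b)"
    by (intro prod_mono conjI divide_right_mono le) (auto intro!: divide_nonneg_nonneg)
  also have "\<dots> = (U ^ DIM('v))\<^sup>2 / 2 ^ (\<Sum>b\<in>Basis. N j b)"
    by (simp add: prod_dividef power_sum power_mult[symmetric] mult.commute)
  finally show ?thesis by (simp add: ennreal_leI)
qed

lemma smooth_alg_fam: "smooth_alg (fam J K N a A)"
  unfolding fam_def
  by (intro smooth_alg.add smooth_alg_base_dens smooth_alg_sum smooth_alg_cmult smooth_alg_psi)

lemma fam_eq_0: "z \<notin> outer_box K \<Longrightarrow> K \<ge> 1 \<Longrightarrow> fam J K N a A z = 0"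
  using subsetD[OF big_box_subset_outer_box, of z K] unfolding fam_def
  by (subst sum_psi_eq_0) (auto simp: base_dens_eq_0)

lemma foldr_dir_deriv_fam:
  "foldr dir_deriv l (fam J K N a A) = (\<lambda>z. foldr dir_deriv l (base_dens K) z
     + (\<Sum>i\<in>cells J K N. sg A i * (a * foldr dir_deriv l (psi N i) z)))"
  unfolding fam_def
  by (simp only: foldr_dir_deriv_add foldr_dir_deriv_sum foldr_dir_deriv_cmult smooth_alg_base_dens 
      smooth_alg_sum smooth_alg_cmult smooth_alg_psi)

lemma fam_ge:
  fixes N :: "nat \<Rightarrow> 'v::euclidean_space \<Rightarrow> nat"
  assumes \<beta>: "\<forall>x\<in>{0..1}. theta x \<ge> \<beta>" "\<beta> > 0" and K: "K \<ge> 1" and U: "deriv_bound S U"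
    and a: "a \<ge> 0" "real J * (a * U ^ DIM('v)) \<le> (\<beta> / real K) ^ DIM('v) / 2" and z: "z \<in> big_box K"
  shows "fam J K N a A z \<ge> (\<beta> / real K) ^ DIM('v) / 2"
  using base_dens_ge[OF \<beta> K z] sum_psi_le[OF U a(1), where J = J and K = K and N = N and A = A and z = z] a(2)
  unfolding fam_def by linarith

text \<open>The wavelets have mean 0, so the mass remains 1. The perturbation vanishes outside
  \<open>big_box K\<close> and amounts inside to at most half of the lower bound of the base
  density.\<close>

lemma prob_density_fam:
  fixes N :: "nat \<Rightarrow> 'v::euclidean_space \<Rightarrow> nat"
  assumes \<beta>: "\<forall>x\<in>{0..1}. theta x \<ge> \<beta>" "\<beta> > 0" and K: "K \<ge> 1" and U: "deriv_bound S U"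
    and a: "a \<ge> 0" "real J * (a * U ^ DIM('v)) \<le> (\<beta> / real K) ^ DIM('v) / 2"
  shows "prob_density (fam J K N a A)"
proof -
  have nn: "fam J K N a A z \<ge> 0" for z
  proof (cases "z \<in> big_box K")
    case True
    have "(\<beta> / real K) ^ DIM('v) / 2 \<ge> 0" using \<beta> by simp
    then show ?thesis using fam_ge[OF assms True] by (rule order_trans)
  qed (simp add: fam_def sum_psi_eq_0 base_dens_nonneg)
  have int: "integrable lborel (fam J K N a A)"
    unfolding fam_def[abs_def] using K
    by (intro Bochner_Integration.integrable_add Bochner_Integration.integrable_sum integrable_mult_right base_dens_integral psi_integral)
  have "(\<integral>z. fam J K N a A z \<partial>lborel) = 1"
    unfolding fam_def using K
    by (simp add: base_dens_integral psi_integral Bochner_Integration.integrable_sum)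
  then have "(\<integral>\<^sup>+z. ennreal (fam J K N a A z) \<partial>lborel) = 1"
    using nn_integral_eq_integral[OF int] nn by simp
  then show ?thesis
    using nn smooth_alg_measurable[OF smooth_alg_fam] by (auto simp: prob_density_def)
qed

lemma fam_insert_diff:
  assumes "i \<in> cells J K N" "i \<notin> A"
  shows "fam J K N a A z - fam J K N a (insert i A) z = - (2 * a * psi N i z)"
proof -
  have s: "(\<Sum>j\<in>cells J K N. sg B j * (a * psi N j z)) = sg B i * (a * psi N i z) + (\<Sum>j\<in>cells J K N - {i}. sg B j * (a * psi N j z))" for B
    using assms(1) finite_cells by (rule sum.remove[rotated])
  have "(\<Sum>j\<in>cells J K N - {i}. sg (insert i A) j * (a * psi N j z)) = (\<Sum>j\<in>cells J K N - {i}. sg A j * (a * psi N j z))"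
    by (intro sum.cong) (auto simp: sg_def)
  then show ?thesis unfolding fam_def using s[of A] s[of "insert i A"] assms(2) by (simp add: sg_def)
qed

lemma fam_close:
  fixes N :: "nat \<Rightarrow> 'v::euclidean_space \<Rightarrow> nat"
  assumes U: "deriv_bound S U" and i: "i \<in> cells J K N" "i \<notin> A"
    and M: "\<And>j. j < J \<Longrightarrow> M \<le> (\<Sum>b\<in>Basis. N j b)"
    and t: "4 * a\<^sup>2 * (U ^ DIM('v))\<^sup>2 / 2 ^ M \<le> b * t"
  shows "(\<integral>\<^sup>+z. ennreal ((fam J K N a A z - fam J K N a (insert i A) z)\<^sup>2) \<partial>lborel) \<le> ennreal (b * t)"
proof -
  obtain j k where jk: "i = (j, k)" "j < J" using i(1) by (auto simp: cells_def)
  have [measurable]: "psi N i \<in> borel_measurable borel" by (rule smooth_alg_measurable[OF smooth_alg_psi])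
  have "(\<integral>\<^sup>+z. ennreal ((fam J K N a A z - fam J K N a (insert i A) z)\<^sup>2) \<partial>lborel) 
     = (\<integral>\<^sup>+z. ennreal (4 * a\<^sup>2) * ennreal ((psi N i z)\<^sup>2) \<partial>lborel)"
    unfolding fam_insert_diff[OF i] by (simp add: power_mult_distrib flip: ennreal_mult)
  also have "\<dots> = ennreal (4 * a\<^sup>2) * (\<integral>\<^sup>+z. ennreal ((psi N i z)\<^sup>2) \<partial>lborel)"
    by (subst nn_integral_cmult) auto
  also have "\<dots> \<le> ennreal (4 * a\<^sup>2) * ennreal ((U ^ DIM('v))\<^sup>2 / 2 ^ (\<Sum>b\<in>Basis. N j b))"
    unfolding jk by (intro mult_left_mono psi_square_integral[OF U]) auto
  also have "\<dots> = ennreal (4 * a\<^sup>2 * ((U ^ DIM('v))\<^sup>2 / 2 ^ (\<Sum>b\<in>Basis. N j b)))"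
    by (rule ennreal_mult[symmetric]) auto
  also have "\<dots> \<le> ennreal (4 * a\<^sup>2 * ((U ^ DIM('v))\<^sup>2 / 2 ^ M))"
    using M[OF jk(2)] by (intro ennreal_leI mult_left_mono divide_left_mono power_increasing) auto
  also have "\<dots> \<le> ennreal (b * t)" using t by (intro ennreal_leI) simp
  finally show ?thesis .
qed

lemma fam_diff_ge:
  fixes N :: "nat \<Rightarrow> 'v::euclidean_space \<Rightarrow> nat"
  assumes \<beta>: "\<forall>x\<in>{0..1}. theta x \<ge> \<beta>" "\<beta> > 0" and K: "K \<ge> 1" and U: "deriv_bound S U"
    and a: "a \<ge> 0" "real J * (a * U ^ DIM('v)) \<le> (\<beta> / real K) ^ DIM('v) / 2"
    and ne: "fam J K N a A z \<noteq> fam J K N a B z"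
  shows "fam J K N a A z \<ge> (\<beta> / real K) ^ DIM('v) / 2"
proof (rule fam_ge[OF \<beta> K U a])
  show "z \<in> big_box K"
  proof (rule ccontr)
    assume "z \<notin> big_box K"
    then have "fam J K N a A z = fam J K N a B z" by (simp add: fam_def sum_psi_eq_0)
    with ne show False by simp
  qed
qed

section \<open>Norms of the perturbed densities\<close>

lemma ennreal_powr_powr_inverse:
  assumes "p > 0" shows "ennreal_powr (ennreal_powr x (1 / p)) p = x"
  using assms by (cases x) (auto simp: ennreal_powr_def powr_powr)

lemma risk_eq: "p > 0 \<Longrightarrow> risk p n T f = (\<integral>\<^sup>+xs. (\<integral>\<^sup>+z. ennreal (\<bar>T xs z - f z\<bar> powr p) \<partial>lborel) \<partial>sample_measure n f)"
  by (simp add: risk_def Lp_norm_def ennreal_powr_powr_inverse)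

lemma Lp_norm_leI:
  assumes p: "p > 0" and B: "B \<ge> 0" and le: "(\<integral>\<^sup>+z. ennreal (\<bar>f z\<bar> powr p) \<partial>lborel) \<le> ennreal (B powr p)"
  shows "Lp_norm p f \<le> ennreal B"
proof -
  obtain r where r: "(\<integral>\<^sup>+z. ennreal (\<bar>f z\<bar> powr p) \<partial>lborel) = ennreal r" "r \<ge> 0"
    using le by (cases "\<integral>\<^sup>+z. ennreal (\<bar>f z\<bar> powr p) \<partial>lborel") (auto simp: top_unique)
  then have "r powr (1 / p) \<le> (B powr p) powr (1 / p)"
    using le p by (intro powr_mono2) auto
  then show ?thesis using r p B by (auto simp: Lp_norm_def ennreal_powr_def powr_powr intro!: ennreal_leI)
qed

text \<open>A crude substitute for Minkowski's inequality: \<open>(2 * max) powr p\<close> gives the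
  factor \<open>2 powr p\<close>, and the two summands give another 2, which is at most
  \<open>2 powr p\<close>. The resulting 4 is compensated by the choice of \<open>\<eta>\<close> in
  the final proof.\<close>

lemma Lp_norm_add_le:
  assumes p: "p \<ge> 1" and e: "e \<ge> 0"
    and f: "f \<in> borel_measurable borel" "(\<integral>\<^sup>+z. ennreal (\<bar>f z\<bar> powr p) \<partial>lborel) \<le> ennreal (e powr p)"
    and g: "g \<in> borel_measurable borel" "(\<integral>\<^sup>+z. ennreal (\<bar>g z\<bar> powr p) \<partial>lborel) \<le> ennreal (e powr p)"
  shows "Lp_norm p (\<lambda>z. f z + g z) \<le> ennreal (4 * e)"
proof (rule Lp_norm_leI)
  note [measurable] = f(1) g(1)
  have pw: "\<bar>x + y\<bar> powr p \<le> 2 powr p * (\<bar>x\<bar> powr p + \<bar>y\<bar> powr p)" for x y :: real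
  proof -
    have "\<bar>x + y\<bar> powr p \<le> (2 * max \<bar>x\<bar> \<bar>y\<bar>) powr p" using p by (intro powr_mono2) auto
    also have "\<dots> = 2 powr p * (max \<bar>x\<bar> \<bar>y\<bar>) powr p" by (simp add: powr_mult)
    also have "(max \<bar>x\<bar> \<bar>y\<bar>) powr p \<le> \<bar>x\<bar> powr p + \<bar>y\<bar> powr p" by (auto simp: max_def)
    finally show ?thesis by simp
  qed
  have "(\<integral>\<^sup>+z. ennreal (\<bar>f z + g z\<bar> powr p) \<partial>lborel) 
      \<le> (\<integral>\<^sup>+z. ennreal (2 powr p) * (ennreal (\<bar>f z\<bar> powr p) + ennreal (\<bar>g z\<bar> powr p)) \<partial>lborel)"
    by (intro nn_integral_mono) (auto simp flip: ennreal_plus ennreal_mult intro!: ennreal_leI pw)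
  also have "\<dots> = ennreal (2 powr p) * ((\<integral>\<^sup>+z. ennreal (\<bar>f z\<bar> powr p) \<partial>lborel) + (\<integral>\<^sup>+z. ennreal (\<bar>g z\<bar> powr p) \<partial>lborel))"
    by (simp add: nn_integral_cmult nn_integral_add)
  also have "\<dots> \<le> ennreal (2 powr p) * (ennreal (e powr p) + ennreal (e powr p))"
    by (intro mult_left_mono add_mono f g) auto
  also have "\<dots> = ennreal (2 powr p * (2 * e powr p))"
    by (simp flip: ennreal_plus ennreal_mult)
  also have "\<dots> \<le> ennreal ((4 * e) powr p)"
  proof (rule ennreal_leI)
    have "2 powr 1 \<le> 2 powr p" using p by (intro powr_mono) auto
    then have "2 powr p * (2 * e powr p) \<le> 2 powr p * (2 powr p * e powr p)" by (intro mult_left_mono mult_right_mono) auto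
    also have "\<dots> = (4 * e) powr p" by (simp flip: powr_mult)
    finally show "2 powr p * (2 * e powr p) \<le> (4 * e) powr p" .
  qed
  finally show "(\<integral>\<^sup>+z. ennreal (\<bar>f z + g z\<bar> powr p) \<partial>lborel) \<le> ennreal ((4 * e) powr p)" .
qed (use p e in auto)

lemma base_dens_deriv_Lp:
  assumes l: "set l \<subseteq> (Basis :: 'v::euclidean_space set)" "length l \<le> S" and U: "deriv_bound S U" and K: "K \<ge> 1" and p: "p > 0"
    and e: "U ^ DIM('v) / real K ^ (DIM('v) + length l) * (3 * real K) powr (DIM('v) / p) \<le> e"
  shows "(\<integral>\<^sup>+z. ennreal (\<bar>foldr dir_deriv l (base_dens K) (z::'v)\<bar> powr p) \<partial>lborel) \<le> ennreal (e powr p)"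
proof -
  define C where "C = U ^ DIM('v) / real K ^ (DIM('v) + length l)"
  have C: "C \<ge> 0" using U by (auto simp: C_def deriv_bound_def)
  have "(\<integral>\<^sup>+z. ennreal (\<bar>foldr dir_deriv l (base_dens K) (z::'v)\<bar> powr p) \<partial>lborel) 
    \<le> (\<integral>\<^sup>+z. ennreal (C powr p) * indicator (outer_box K) (z::'v) \<partial>lborel)"
  proof (intro nn_integral_mono)
    fix z :: 'v
    show "ennreal (\<bar>foldr dir_deriv l (base_dens K) z\<bar> powr p) \<le> ennreal (C powr p) * indicator (outer_box K) z"
      using base_dens_deriv_bound[OF l U K, of z] p
      by (cases "z \<in> outer_box K") (auto simp: C_def intro!: ennreal_leI powr_mono2)
  qed
  also have "\<dots> = ennreal (C powr p) * ennreal ((3 * real K) ^ DIM('v))"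
    by (subst nn_integral_cmult_indicator) (auto simp: emeasure_outer_box)
  also have "\<dots> = ennreal ((C * (3 * real K) powr (DIM('v) / p)) powr p)"
    using C K p by (simp add: powr_mult powr_powr powr_realpow flip: ennreal_mult)
  also have "\<dots> \<le> ennreal (e powr p)"
    using e C p by (intro ennreal_leI powr_mono2 mult_nonneg_nonneg) (auto simp: C_def)
  finally show ?thesis .
qed

section \<open>Lower bounds for the risk over the perturbed densities\<close>

definition cell_vol :: "(nat \<Rightarrow> 'v::euclidean_space \<Rightarrow> nat) \<Rightarrow> nat \<times> ('v \<Rightarrow> nat) \<Rightarrow> real" where
  "cell_vol N i = 1 / 2 ^ (\<Sum>b\<in>Basis. N (fst i) b)"

lemma cell_vol_pos: "cell_vol N i > 0"
  by (simp add: cell_vol_def)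

lemma sum_cell_vol:
  "(\<Sum>i\<in>cells J K N. cell_vol N i) = real J * real K ^ DIM('v)" for N :: "nat \<Rightarrow> 'v::euclidean_space \<Rightarrow> nat"
proof -
  have "(\<Sum>i\<in>cells J K N. cell_vol N i) = (\<Sum>j<J. \<Sum>k\<in>PiE Basis (\<lambda>b. {..<K * 2 ^ N j b}). cell_vol N (j, k))"
    unfolding cells_def by (subst sum.Sigma) (auto intro: finite_PiE)
  also have "\<dots> = (\<Sum>j<J. real K ^ DIM('v))"
    by (intro sum.cong refl) (simp add: cell_vol_def card_PiE prod.distrib power_sum)
  finally show ?thesis by simp
qed

lemma estimator_measurable:
  assumes "T \<in> estimators n"
  shows "(\<lambda>(xs, z). T xs z) \<in> borel_measurable ((\<Pi>\<^sub>M i\<in>{..<n}. borel) \<Otimes>\<^sub>M lborel)"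
    and "xs \<in> space (\<Pi>\<^sub>M i\<in>{..<n}. borel) \<Longrightarrow> T xs \<in> borel_measurable borel"
proof -
  have T: "(\<lambda>(xs, z). T xs z) \<in> borel_measurable ((\<Pi>\<^sub>M i\<in>{..<n}. borel) \<Otimes>\<^sub>M borel)"
    using assms by (simp add: estimators_def)
  have "sets ((\<Pi>\<^sub>M i\<in>{..<n}. borel :: 'a measure) \<Otimes>\<^sub>M (lborel :: 'a measure)) = sets ((\<Pi>\<^sub>M i\<in>{..<n}. borel) \<Otimes>\<^sub>M borel)"
    by (intro sets_pair_measure_cong) auto
  with T show "(\<lambda>(xs, z). T xs z) \<in> borel_measurable ((\<Pi>\<^sub>M i\<in>{..<n}. borel) \<Otimes>\<^sub>M lborel)"
    using measurable_cong_sets by blast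
  show "T xs \<in> borel_measurable borel" if "xs \<in> space (\<Pi>\<^sub>M i\<in>{..<n}. borel)"
    using measurable_compose[OF measurable_Pair1'[OF that] T] by simp
qed

lemma sets_sample_measure: "sets (sample_measure n f) = sets (\<Pi>\<^sub>M i\<in>{..<n}. borel)"
  unfolding sample_measure_def by (intro sets_PiM_cong) auto

lemma prob_space_sample_measure: "prob_density f \<Longrightarrow> prob_space (sample_measure n f)"
  unfolding sample_measure_def by (intro prob_space_PiM prob_space_density_prob_density)

lemma cellfun_haar_measurable [measurable]: "cellfun haar N k \<in> borel_measurable borel"
  unfolding cellfun_def tprod_def by measurable

lemma integrable_wav_vanish: "integrable lborel wav" "\<And>x. x \<notin> {0..<1} \<Longrightarrow> wav x = 0"
  using integrable_wav wav_eq_0 by (auto simp: not_less)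

lemma haar_vanish: "integrable lborel haar" "\<And>x. x \<notin> {0..<1} \<Longrightarrow> haar x = 0"
  using haar_integral haar_eq_0 by auto

lemma integral_haar_square: "(\<integral>x. haar x * haar x \<partial>lborel) = 1"
  by (simp add: haar_square)

text \<open>With \<open>f = haar\<close> this is the orthogonality of the Haar functions that
  Bessel's inequality needs, with \<open>f = wav\<close> the biorthogonality that isolates a single
  sign. Condition \<open>sep\<close> is imposed on both orderings of a pair, so the Haar function is
  always the coarser one in some coordinate.\<close>

lemma haar_system:
  fixes N :: "nat \<Rightarrow> 'v::euclidean_space \<Rightarrow> nat" and f :: "real \<Rightarrow> real"
  assumes f: "integrable lborel f" "\<And>x. x \<notin> {0..<1} \<Longrightarrow> f x = 0" "(\<integral>x. f x \<partial>lborel) = 0"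
    and sep: "\<And>j j'. j < J \<Longrightarrow> j' < J \<Longrightarrow> j \<noteq> j' \<Longrightarrow> \<exists>b\<in>Basis. N j' b < N j b"
    and i: "i \<in> cells J K N" "i' \<in> cells J K N"
  shows "(\<integral>z. cellfun f (N (fst i)) (snd i) z * cellfun haar (N (fst i')) (snd i') z \<partial>lborel)
    = (if i = i' then (\<integral>x. f x * haar x \<partial>lborel) ^ DIM('v) * cell_vol N i else 0)"
proof (cases "i = i'")
  case True
  then show ?thesis using cellfun_haar_diagonal[OF f(1,2), of "N (fst i)" "snd i"] by (simp add: cell_vol_def)
next
  case False
  obtain j k j' k' where jk: "i = (j, k)" "i' = (j', k')" by (cases i, cases i')
  obtain b where b: "b \<in> Basis" "N j' b < N j b \<or> N j' b = N j b \<and> k b \<noteq> k' b"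
  proof (cases "j = j'")
    case True
    with False jk have "k \<noteq> k'" by simp
    moreover have "k \<in> extensional Basis" "k' \<in> extensional Basis"
      using i jk by (auto simp: cells_def PiE_def)
    ultimately obtain b where "b \<in> Basis" "k b \<noteq> k' b"
      by (metis extensionalityI)
    then show ?thesis using True that[of b] by auto
  next
    case False
    then show ?thesis using sep[of j j'] i jk that by (auto simp: cells_def)
  qed
  have "(\<integral>z. cellfun f (N j) k z * cellfun haar (N j') k' z \<partial>lborel) = 0"
    using cellfun_haar_orthogonal[OF f b(1), where N = "N j" and N' = "N j'" and k = k and k' = k'] b(2) by blast
  then show ?thesis by (simp only: jk fst_conv snd_conv if_not_P[OF False[unfolded jk]])
qed

lemma powr_minus_2_mult_square: "x > 0 \<Longrightarrow> x powr (p - 2) * x\<^sup>2 = x powr p" for x p :: real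
  by (simp add: powr_add[symmetric] flip: powr_numeral)

lemma ennreal_le_of_double_le_add:
  assumes "ennreal (2 * c) \<le> R + ennreal c" "c \<ge> 0"
  shows "ennreal c \<le> R"
proof (cases R)
  case (real r)
  then have "2 * c \<le> r + c" using assms by (simp flip: ennreal_plus)
  then show ?thesis using real by (simp add: ennreal_leI)
qed simp

text \<open>The loss of sign \<open>i\<close> is the squared error of the \<open>i\<close>-th Haar
  coefficient, divided by the squared norm of the Haar function. By Bessel these losses add up to at
  most the squared loss over the cube, to which Assouad's lemma applies. The passage to exponent
  \<open>p\<close> uses \<open>s powr (p - 2) * x^2 <= |x| powr p + s powr p\<close>, where the last
  term is integrated over the cube of volume \<open>K ^ d\<close> only, \<open>d\<close> being the
  dimension.\<close>

lemma risk_lower_bound_ge2: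
  fixes N :: "nat \<Rightarrow> 'v::euclidean_space \<Rightarrow> nat" and T :: "(nat \<Rightarrow> 'v) \<Rightarrow> 'v \<Rightarrow> real"
  assumes p: "p \<ge> 2" and T: "T \<in> estimators n" and J: "J \<ge> 1" and n: "n \<ge> 1"
    and G: "G \<subseteq> Pow (cells J K N)" "4 * card (Pow (cells J K N) - G) \<le> 2 ^ card (cells J K N)"
    and \<beta>: "\<forall>x\<in>{0..1}. theta x \<ge> \<beta>" "\<beta> > 0" and K: "K \<ge> 1" and U: "deriv_bound S U"
    and a: "a > 0" "real J * (a * U ^ DIM('v)) \<le> (\<beta> / real K) ^ DIM('v) / 2"
    and M: "\<And>j. j < J \<Longrightarrow> M \<le> (\<Sum>b\<in>Basis. N j b)"
    and t: "4 * a\<^sup>2 * (U ^ DIM('v))\<^sup>2 / 2 ^ M \<le> (\<beta> / real K) ^ DIM('v) / 2 * (1 / real n)"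
    and sep: "\<And>j j'. j < J \<Longrightarrow> j' < J \<Longrightarrow> j \<noteq> j' \<Longrightarrow> \<exists>b\<in>Basis. N j' b < N j b"
  shows "ennreal (real K ^ DIM('v) * ((\<integral>x. wav x * haar x \<partial>lborel) ^ DIM('v) / sqrt 32 * (a * sqrt (real J))) powr p)
    \<le> (SUP A\<in>G. risk p n T (fam J K N a A))"
proof -
  define I where "I = cells J K N"
  have I: "finite I" by (simp add: I_def finite_cells)
  define Q :: "'v set" where "Q = big_box K"
  define \<kappa> where "\<kappa> = (\<integral>x. wav x * haar x \<partial>lborel) ^ DIM('v)"
  have \<kappa>: "\<kappa> > 0" unfolding \<kappa>_def using wav_haar_pos by simp
  define h where "h i = cellfun haar (N (fst i)) (snd i)" for i :: "nat \<times> ('v \<Rightarrow> nat)"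
  define v where "v = cell_vol N"
  have v: "v i > 0" for i by (simp add: v_def cell_vol_pos)
  have [measurable]: "h i \<in> borel_measurable borel" "Q \<in> sets borel" for i by (simp_all add: h_def Q_def)
  have [measurable]: "base_dens K \<in> borel_measurable borel" by (rule smooth_alg_measurable[OF smooth_alg_base_dens])
  have [measurable]: "psi N i \<in> borel_measurable borel" for i by (rule smooth_alg_measurable[OF smooth_alg_psi])
  have [measurable]: "fam J K N a A \<in> borel_measurable borel" for A by (rule smooth_alg_measurable[OF smooth_alg_fam])
  have hh: "(\<integral>z. h i z * h j z \<partial>lborel) = (if i = j then v i else 0)" if "i \<in> I" "j \<in> I" for i j
    using haar_system[OF haar_vanish haar_integral(1) sep that[unfolded I_def]]
    by (simp add: h_def v_def integral_haar_square)
  have hh_int: "integrable lborel (\<lambda>z. h i z * h j z)" for i j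
    unfolding h_def by (rule cellfun_haar_integrable[OF haar_vanish])
  have ph: "(\<integral>z. psi N i z * h j z \<partial>lborel) = (if i = j then \<kappa> * v i else 0)" if "i \<in> I" "j \<in> I" for i j
    using haar_system[OF integrable_wav_vanish integral_wav sep that[unfolded I_def]]
    by (simp add: h_def v_def psi_def \<kappa>_def)
  have ph_int: "integrable lborel (\<lambda>z. psi N i z * h j z)" for i j
    unfolding h_def psi_def by (rule cellfun_haar_integrable[OF integrable_wav_vanish])
  have psi_Q: "indicator Q z * psi N i z = psi N i z" if "i \<in> I" for i z
    using psi_support_box[of "[]" N i z J K] that by (auto simp: I_def Q_def indicator_def)
  define tau where "tau i xs = (\<integral>z. (indicator Q z * (T xs z - base_dens K z)) * h i z \<partial>lborel)" for i xs
  define loss where "loss i \<sigma> xs = ennreal ((tau i xs - (if \<sigma> then 1 else - 1) * (a * \<kappa> * v i))\<^sup>2 / v i)" for i \<sigma> xs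
  \<comment> \<open>Chosen so that Assouad's bound for the squared loss is exactly
    \<open>2 * s\<^sup>2 * real K ^ DIM('v)\<close>. After multiplication by
    \<open>s powr (p - 2)\<close> it is twice the error term
    \<open>s powr p * real K ^ DIM('v)\<close>, and half of it survives the subtraction.\<close>
  define s where "s = \<kappa> / sqrt 32 * (a * sqrt (real J))"
  have s: "s > 0" using \<kappa> a J by (simp add: s_def)
  have s2: "s\<^sup>2 = \<kappa>\<^sup>2 * a\<^sup>2 * real J / 32" by (simp add: s_def power_mult_distrib power_divide)
  note [measurable] = estimator_measurable(1)[OF T, unfolded case_prod_beta']
  have [measurable]: "tau i \<in> borel_measurable (\<Pi>\<^sub>M i\<in>{..<n}. borel)" for i
    unfolding tau_def by (rule lborel.borel_measurable_lebesgue_integral) (simp add: case_prod_beta')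
  have loss_m: "loss i \<sigma> \<in> borel_measurable (\<Pi>\<^sub>M i\<in>{..<n}. borel)" for i \<sigma>
    unfolding loss_def by measurable
  have sum_loss: "(\<Sum>i\<in>I. loss i (i \<in> A) xs) \<le> (\<integral>\<^sup>+z. ennreal ((indicator Q z * (T xs z - fam J K N a A z))\<^sup>2) \<partial>lborel)"
    if xs: "xs \<in> space (\<Pi>\<^sub>M i\<in>{..<n}. borel)" for A xs
  proof -
    note [measurable] = estimator_measurable(2)[OF T xs]
    define g where "g z = indicator Q z * (T xs z - fam J K N a A z)" for z
    have [measurable]: "g \<in> borel_measurable borel" unfolding g_def by measurable
    show ?thesis
    \<comment> \<open>If the squared loss is infinite, the claim is trivial; this case is split off
      because the coefficients \<open>tau\<close> are Bochner integrals and then carry no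
      information.\<close>
    proof (cases "integrable lborel (\<lambda>z. (g z)\<^sup>2)")
      case True
      have B1: "(\<Sum>i\<in>I. (\<integral>z. g z * h i z \<partial>lborel)\<^sup>2 / v i) \<le> (\<integral>z. (g z)\<^sup>2 \<partial>lborel)"
        by (rule bessel_inequality(1)[OF I _ _ hh v _ True]) (auto intro: hh_int)
      have B2: "integrable lborel (\<lambda>z. g z * h i z)" if "i \<in> I" for i
        by (rule bessel_inequality(2)[OF I _ _ hh v _ True that]) (auto intro: hh_int)
      have gh: "(\<integral>z. g z * h i z \<partial>lborel) = tau i xs - sg A i * (a * \<kappa> * v i)" if i: "i \<in> I" for i
      proof -
        have eq: "(indicator Q z * (T xs z - base_dens K z)) * h i z = g z * h i z + (\<Sum>j\<in>I. (sg A j * a) * (psi N j z * h i z))" for z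
        proof -
          have "indicator Q z * (\<Sum>j\<in>I. sg A j * (a * psi N j z)) = (\<Sum>j\<in>I. sg A j * (a * psi N j z))"
            by (simp add: sum_distrib_left mult.left_commute[of "indicator Q z"] psi_Q cong: sum.cong)
          then have "indicator Q z * (T xs z - base_dens K z) = g z + (\<Sum>j\<in>I. sg A j * (a * psi N j z))"
            by (simp add: g_def fam_def I_def algebra_simps)
          then show ?thesis by (simp add: distrib_left distrib_right sum_distrib_left sum_distrib_right mult_ac)
        qed
        have "tau i xs = (\<integral>z. g z * h i z \<partial>lborel) + (\<Sum>j\<in>I. (sg A j * a) * (\<integral>z. psi N j z * h i z \<partial>lborel))"
          unfolding tau_def eq using B2[OF i] by (simp add: ph_int Bochner_Integration.integrable_sum)
        also have "(\<Sum>j\<in>I. (sg A j * a) * (\<integral>z. psi N j z * h i z \<partial>lborel)) = (\<Sum>j\<in>I. if j = i then (sg A i * a) * (\<kappa> * v i) else 0)"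
          using i by (intro sum.cong refl) (auto simp: ph)
        also have "\<dots> = sg A i * (a * \<kappa> * v i)" using i I by (simp add: sum.delta)
        finally show ?thesis by simp
      qed
      have "(\<Sum>i\<in>I. loss i (i \<in> A) xs) = (\<Sum>i\<in>I. ennreal ((\<integral>z. g z * h i z \<partial>lborel)\<^sup>2 / v i))"
        by (intro sum.cong refl) (simp add: loss_def gh sg_def)
      also have "\<dots> = ennreal (\<Sum>i\<in>I. (\<integral>z. g z * h i z \<partial>lborel)\<^sup>2 / v i)"
        by (rule sum_ennreal) (simp add: v less_imp_le)
      also have "\<dots> \<le> ennreal (\<integral>z. (g z)\<^sup>2 \<partial>lborel)" by (intro ennreal_leI B1)
      also have "\<dots> = (\<integral>\<^sup>+z. ennreal ((g z)\<^sup>2) \<partial>lborel)" by (rule nn_integral_eq_integral[symmetric, OF True]) simp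
      finally show ?thesis by (simp add: g_def)
    next
      case False
      then have "(\<integral>\<^sup>+z. ennreal ((g z)\<^sup>2) \<partial>lborel) = \<infinity>"
        by (simp add: integrable_iff_bounded less_top[symmetric])
      then show ?thesis by (simp add: g_def)
    qed
  qed
  have key: "ennreal (s powr (p - 2)) * (\<integral>\<^sup>+xs. (\<Sum>i\<in>I. loss i (i \<in> A) xs) \<partial>sample_measure n (fam J K N a A))
      \<le> risk p n T (fam J K N a A) + ennreal (s powr p * real K ^ DIM('v))" if A: "A \<in> G" for A
  proof -
    interpret P: prob_space "sample_measure n (fam J K N a A)"
      using a by (intro prob_space_sample_measure prob_density_fam[OF \<beta> K U]) auto
    have sp: "space (sample_measure n (fam J K N a A)) = space (\<Pi>\<^sub>M i\<in>{..<n}. borel)"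
      by (rule sets_eq_imp_space_eq[OF sets_sample_measure])
    have Lm: "(\<lambda>xs. \<Sum>i\<in>I. loss i (i \<in> A) xs) \<in> borel_measurable (sample_measure n (fam J K N a A))"
      unfolding measurable_cong_sets[OF sets_sample_measure refl] by (intro borel_measurable_sum loss_m)
    have Rm: "(\<lambda>xs. \<integral>\<^sup>+z. ennreal (\<bar>T xs z - fam J K N a A z\<bar> powr p) \<partial>lborel) \<in> borel_measurable (sample_measure n (fam J K N a A))"
      unfolding measurable_cong_sets[OF sets_sample_measure refl]
      by (rule lborel.borel_measurable_nn_integral) (simp add: case_prod_beta')
    have pw: "ennreal (s powr (p - 2)) * (\<Sum>i\<in>I. loss i (i \<in> A) xs) 
       \<le> (\<integral>\<^sup>+z. ennreal (\<bar>T xs z - fam J K N a A z\<bar> powr p) \<partial>lborel) + ennreal (s powr p * real K ^ DIM('v))"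
      if xs: "xs \<in> space (\<Pi>\<^sub>M i\<in>{..<n}. borel)" for xs
    proof -
      note [measurable] = estimator_measurable(2)[OF T xs]
      have "ennreal (s powr (p - 2)) * (\<Sum>i\<in>I. loss i (i \<in> A) xs) 
        \<le> ennreal (s powr (p - 2)) * (\<integral>\<^sup>+z. ennreal ((indicator Q z * (T xs z - fam J K N a A z))\<^sup>2) \<partial>lborel)"
        by (intro mult_left_mono sum_loss xs) auto
      also have "\<dots> = (\<integral>\<^sup>+z. ennreal (s powr (p - 2)) * ennreal ((indicator Q z * (T xs z - fam J K N a A z))\<^sup>2) \<partial>lborel)"
        by (rule nn_integral_cmult[symmetric]) measurable
      also have "\<dots> \<le> (\<integral>\<^sup>+z. ennreal (\<bar>T xs z - fam J K N a A z\<bar> powr p) + ennreal (s powr p) * indicator Q z \<partial>lborel)"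
      proof (intro nn_integral_mono)
        fix z
        let ?x = "T xs z - fam J K N a A z"
        \<comment> \<open>replaces the power mean inequality between the \<open>L\<^sup>2\<close> and the \<open>L\<^sup>p\<close> loss\<close>
        have "s powr (p - 2) * ?x\<^sup>2 \<le> \<bar>?x\<bar> powr p + s powr p"
        proof (cases "\<bar>?x\<bar> \<le> s")
          case True
          then have "?x\<^sup>2 \<le> s\<^sup>2" using s by (simp add: abs_le_square_iff[symmetric])
          then have "s powr (p - 2) * ?x\<^sup>2 \<le> s powr (p - 2) * s\<^sup>2" by (intro mult_left_mono) auto
          also have "\<dots> = s powr p" by (rule powr_minus_2_mult_square[OF s])
          finally show ?thesis by (simp add: add_increasing)
        next
          case False
          then have "s powr (p - 2) * ?x\<^sup>2 \<le> \<bar>?x\<bar> powr (p - 2) * ?x\<^sup>2" 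
            using s p by (intro mult_right_mono powr_mono2) auto
          also have "\<dots> = \<bar>?x\<bar> powr p" using powr_minus_2_mult_square[of "\<bar>?x\<bar>" p] False s by simp
          finally show ?thesis by (simp add: add_increasing2)
        qed
        then show "ennreal (s powr (p - 2)) * ennreal ((indicator Q z * ?x)\<^sup>2) \<le> ennreal (\<bar>?x\<bar> powr p) + ennreal (s powr p) * indicator Q z"
          by (cases "z \<in> Q") (auto simp flip: ennreal_mult ennreal_plus intro!: ennreal_leI)
      qed
      also have "\<dots> = (\<integral>\<^sup>+z. ennreal (\<bar>T xs z - fam J K N a A z\<bar> powr p) \<partial>lborel) + ennreal (s powr p) * ennreal (real K ^ DIM('v))"
        by (subst nn_integral_add) (auto simp: nn_integral_cmult_indicator Q_def emeasure_big_box)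
      finally show ?thesis by (simp add: ennreal_mult)
    qed
    have "ennreal (s powr (p - 2)) * (\<integral>\<^sup>+xs. (\<Sum>i\<in>I. loss i (i \<in> A) xs) \<partial>sample_measure n (fam J K N a A))
      = (\<integral>\<^sup>+xs. ennreal (s powr (p - 2)) * (\<Sum>i\<in>I. loss i (i \<in> A) xs) \<partial>sample_measure n (fam J K N a A))"
      by (rule nn_integral_cmult[OF Lm, symmetric])
    also have "\<dots> \<le> (\<integral>\<^sup>+xs. (\<integral>\<^sup>+z. ennreal (\<bar>T xs z - fam J K N a A z\<bar> powr p) \<partial>lborel) + ennreal (s powr p * real K ^ DIM('v)) \<partial>sample_measure n (fam J K N a A))"
      by (intro nn_integral_mono pw) (simp add: sp)
    also have "\<dots> = risk p n T (fam J K N a A) + ennreal (s powr p * real K ^ DIM('v))"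
      using p by (subst nn_integral_add[OF Rm]) (auto simp: risk_eq P.emeasure_space_1)
    finally show ?thesis .
  qed
  have "ennreal ((\<Sum>i\<in>I. 2 * (a\<^sup>2 * \<kappa>\<^sup>2 * v i)) / 32) \<le> (SUP A\<in>G. \<integral>\<^sup>+xs. (\<Sum>i\<in>I. loss i (i \<in> A) xs) \<partial>sample_measure n (fam J K N a A))"
  proof (rule assouad[where b = "(\<beta> / real K) ^ DIM('v) / 2" and t = "1 / real n"])
    show "prob_density (fam J K N a A)" for A using a by (intro prob_density_fam[OF \<beta> K U]) auto
    show "fam J K N a A z \<ge> (\<beta> / real K) ^ DIM('v) / 2" if "fam J K N a A z \<noteq> fam J K N a (insert i A) z" for A i z
      using a that by (intro fam_diff_ge[OF \<beta> K U]) auto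
    show "(\<integral>\<^sup>+z. ennreal ((fam J K N a A z - fam J K N a (insert i A) z)\<^sup>2) \<partial>lborel) \<le> ennreal ((\<beta> / real K) ^ DIM('v) / 2 * (1 / real n))"
      if "i \<in> I" "i \<notin> A" for A i
      using that by (intro fam_close[OF U _ _ M t]) (auto simp: I_def)
    show "loss i \<sigma> \<in> borel_measurable (\<Pi>\<^sub>M i\<in>{..<n}. borel)" for i \<sigma> by (rule loss_m)
    show "ennreal (2 * (a\<^sup>2 * \<kappa>\<^sup>2 * v i)) \<le> loss i False xs + loss i True xs" for i xs
    proof -
      \<comment> \<open>The two squares add up to at least twice the square of half the distance
        between the two target values, whatever value \<open>tau i xs\<close> takes.\<close>
      have "2 * (a\<^sup>2 * \<kappa>\<^sup>2 * v i) \<le> (tau i xs + a * \<kappa> * v i)\<^sup>2 / v i + (tau i xs - a * \<kappa> * v i)\<^sup>2 / v i"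
        using v[of i] by (simp add: field_simps power2_eq_square)
      then have "ennreal (2 * (a\<^sup>2 * \<kappa>\<^sup>2 * v i)) \<le> ennreal ((tau i xs + a * \<kappa> * v i)\<^sup>2 / v i + (tau i xs - a * \<kappa> * v i)\<^sup>2 / v i)"
        by (rule ennreal_leI)
      then show ?thesis using v[of i] by (simp add: loss_def less_imp_le)
    qed
    show "2 * (a\<^sup>2 * \<kappa>\<^sup>2 * v i) \<ge> 0" for i using v[of i] by simp
  qed (use I G \<beta> K n in \<open>auto simp: I_def\<close>)
  also have "(\<Sum>i\<in>I. 2 * (a\<^sup>2 * \<kappa>\<^sup>2 * v i)) / 32 = 2 * s\<^sup>2 * real K ^ DIM('v)"
    using sum_cell_vol[of N J K] by (simp add: s2 v_def I_def flip: sum_distrib_left)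
  finally have sup: "ennreal (2 * s\<^sup>2 * real K ^ DIM('v)) \<le> (SUP A\<in>G. \<integral>\<^sup>+xs. (\<Sum>i\<in>I. loss i (i \<in> A) xs) \<partial>sample_measure n (fam J K N a A))" .
  let ?R = "SUP A\<in>G. risk p n T (fam J K N a A)"
  have sp: "s powr (p - 2) * s\<^sup>2 = s powr p" by (rule powr_minus_2_mult_square[OF s])
  have "ennreal (2 * (s powr p * real K ^ DIM('v))) = ennreal (s powr (p - 2)) * ennreal (2 * s\<^sup>2 * real K ^ DIM('v))"
    by (simp add: mult_ac flip: ennreal_mult sp)
  also have "\<dots> \<le> ennreal (s powr (p - 2)) * (SUP A\<in>G. \<integral>\<^sup>+xs. (\<Sum>i\<in>I. loss i (i \<in> A) xs) \<partial>sample_measure n (fam J K N a A))"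
    by (intro mult_left_mono sup) auto
  also have "\<dots> = (SUP A\<in>G. ennreal (s powr (p - 2)) * (\<integral>\<^sup>+xs. (\<Sum>i\<in>I. loss i (i \<in> A) xs) \<partial>sample_measure n (fam J K N a A)))"
    by (rule SUP_mult_left_ennreal)
  also have "\<dots> \<le> ?R + ennreal (s powr p * real K ^ DIM('v))"
    by (rule SUP_least, rule order_trans[OF key]) (auto intro: add_right_mono SUP_upper)
  finally have fin: "ennreal (2 * (s powr p * real K ^ DIM('v))) \<le> ?R + ennreal (s powr p * real K ^ DIM('v))" .
  from ennreal_le_of_double_le_add[OF fin] have "ennreal (s powr p * real K ^ DIM('v)) \<le> ?R" by simp
  then show ?thesis by (simp add: s_def \<kappa>_def mult.commute)
qed

text \<open>With a single scale the half-open cells are pairwise disjoint, and on each of them only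
  one sign is visible. The \<open>p\<close>-th power of the error then splits over the cells
  directly, without Bessel's inequality and for every \<open>p > 0\<close>.\<close>

lemma risk_lower_bound_single_scale:
  fixes N :: "nat \<Rightarrow> 'v::euclidean_space \<Rightarrow> nat" and T :: "(nat \<Rightarrow> 'v) \<Rightarrow> 'v \<Rightarrow> real"
  assumes p: "p > 0" and T: "T \<in> estimators n" and n: "n \<ge> 1"
    and G: "G \<subseteq> Pow (cells 1 K N)" "4 * card (Pow (cells 1 K N) - G) \<le> 2 ^ card (cells 1 K N)"
    and \<beta>: "\<forall>x\<in>{0..1}. theta x \<ge> \<beta>" "\<beta> > 0" and K: "K \<ge> 1" and U: "deriv_bound S U"
    and a: "a > 0" "a * U ^ DIM('v) \<le> (\<beta> / real K) ^ DIM('v) / 2"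
    and M: "M \<le> (\<Sum>b\<in>Basis. N 0 b)"
    and t: "4 * a\<^sup>2 * (U ^ DIM('v))\<^sup>2 / 2 ^ M \<le> (\<beta> / real K) ^ DIM('v) / 2 * (1 / real n)"
  shows "ennreal (real K ^ DIM('v) * ((\<integral>x. \<bar>wav x\<bar> powr p \<partial>lborel) ^ DIM('v) / 32 * a powr p))
    \<le> (SUP A\<in>G. risk p n T (fam 1 K N a A))"
proof -
  define I where "I = cells 1 K N"
  have I: "finite I" by (simp add: I_def finite_cells)
  define \<kappa> where "\<kappa> = (\<integral>x. \<bar>wav x\<bar> powr p \<partial>lborel) ^ DIM('v)"
  have \<kappa>: "\<kappa> > 0" unfolding \<kappa>_def using wav_powr_pos[OF p] by simp
  define cell where "cell i = {z. \<forall>b\<in>Basis. 2 ^ N 0 b * (z \<bullet> b) - real (snd i b) \<in> {0..<1}}" for i :: "nat \<times> ('v \<Rightarrow> nat)"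
  have [measurable]: "base_dens K \<in> borel_measurable borel" by (rule smooth_alg_measurable[OF smooth_alg_base_dens])
  have [measurable]: "psi N i \<in> borel_measurable borel" for i by (rule smooth_alg_measurable[OF smooth_alg_psi])
  have [measurable]: "fam 1 K N a A \<in> borel_measurable borel" for A by (rule smooth_alg_measurable[OF smooth_alg_fam])
  have [measurable]: "cell i \<in> sets borel" for i unfolding cell_def by measurable
  have eq_cell: "i = i'" if c: "i \<in> I" "i' \<in> I" "z \<in> cell i" "z \<in> cell i'" for i i' z
  proof -
    have "snd i b = snd i' b" if b: "b \<in> Basis" for b
    proof -
      have "\<lfloor>2 ^ N 0 b * (z \<bullet> b)\<rfloor> = int (snd i b)" "\<lfloor>2 ^ N 0 b * (z \<bullet> b)\<rfloor> = int (snd i' b)"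
        using c(3,4)[unfolded cell_def] b by (auto simp: floor_eq_iff)
      then show ?thesis by simp
    qed
    moreover have "snd i \<in> extensional Basis" "snd i' \<in> extensional Basis" "fst i = fst i'"
      using c by (auto simp: I_def cells_def PiE_def)
    ultimately show ?thesis by (metis extensionalityI prod_eqI)
  qed
  have psi_cell: "z \<in> cell i" if "i \<in> I" "psi N i z \<noteq> 0" for i z
    using psi_support[of "[]" N 0 "snd i" z] that by (cases i) (auto simp: I_def cells_def cell_def less_imp_le)
  define loss where "loss i \<sigma> xs = (\<integral>\<^sup>+z. indicator (cell i) z * 
      ennreal (\<bar>T xs z - base_dens K z - (if \<sigma> then 1 else - 1) * (a * psi N i z)\<bar> powr p) \<partial>lborel)" for i \<sigma> xs
  note [measurable] = estimator_measurable(1)[OF T, unfolded case_prod_beta']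
  have loss_m: "loss i \<sigma> \<in> borel_measurable (\<Pi>\<^sub>M i\<in>{..<n}. borel)" for i \<sigma>
    unfolding loss_def by (rule lborel.borel_measurable_nn_integral) (simp add: case_prod_beta')
  have sum_loss: "(\<Sum>i\<in>I. loss i (i \<in> A) xs) \<le> (\<integral>\<^sup>+z. ennreal (\<bar>T xs z - fam 1 K N a A z\<bar> powr p) \<partial>lborel)"
    if xs: "xs \<in> space (\<Pi>\<^sub>M i\<in>{..<n}. borel)" for A xs
  proof -
    note [measurable] = estimator_measurable(2)[OF T xs]
    have "(\<Sum>i\<in>I. loss i (i \<in> A) xs) = (\<integral>\<^sup>+z. (\<Sum>i\<in>I. indicator (cell i) z * 
      ennreal (\<bar>T xs z - base_dens K z - (if i \<in> A then 1 else - 1) * (a * psi N i z)\<bar> powr p)) \<partial>lborel)"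
      unfolding loss_def by (rule nn_integral_sum[symmetric]) measurable
    also have "\<dots> \<le> (\<integral>\<^sup>+z. ennreal (\<bar>T xs z - fam 1 K N a A z\<bar> powr p) \<partial>lborel)"
    proof (intro nn_integral_mono)
      fix z
      show "(\<Sum>i\<in>I. indicator (cell i) z * ennreal (\<bar>T xs z - base_dens K z - (if i \<in> A then 1 else - 1) * (a * psi N i z)\<bar> powr p))
        \<le> ennreal (\<bar>T xs z - fam 1 K N a A z\<bar> powr p)"
      proof (cases "\<exists>i\<in>I. z \<in> cell i")
        case True
        then obtain i where i: "i \<in> I" "z \<in> cell i" by blast
        have o: "z \<notin> cell j" "psi N j z = 0" if "j \<in> I - {i}" for j
          using eq_cell[of i j z] psi_cell[of j z] i that by auto
        have "fam 1 K N a A z = base_dens K z + sg A i * (a * psi N i z)"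
          unfolding fam_def I_def[symmetric] using o(2) i I by (subst sum.remove[OF I i(1)]) simp
        moreover have "(\<Sum>i\<in>I. indicator (cell i) z * ennreal (\<bar>T xs z - base_dens K z - (if i \<in> A then 1 else - 1) * (a * psi N i z)\<bar> powr p))
          = ennreal (\<bar>T xs z - base_dens K z - (if i \<in> A then 1 else - 1) * (a * psi N i z)\<bar> powr p)"
          using o(1) i I by (subst sum.remove[OF I i(1)]) simp
        ultimately show ?thesis by (simp add: sg_def algebra_simps)
      qed simp
    qed
    finally show ?thesis .
  qed
  have "ennreal ((\<Sum>i\<in>I. a powr p * \<kappa> * cell_vol N i) / 32) \<le> (SUP A\<in>G. \<integral>\<^sup>+xs. (\<Sum>i\<in>I. loss i (i \<in> A) xs) \<partial>sample_measure n (fam 1 K N a A))"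
  proof (rule assouad[where b = "(\<beta> / real K) ^ DIM('v) / 2" and t = "1 / real n"])
    show "prob_density (fam 1 K N a A)" for A using a by (intro prob_density_fam[OF \<beta> K U]) auto
    show "fam 1 K N a A z \<ge> (\<beta> / real K) ^ DIM('v) / 2" if "fam 1 K N a A z \<noteq> fam 1 K N a (insert i A) z" for A i z
      using a that by (intro fam_diff_ge[OF \<beta> K U]) auto
    show "(\<integral>\<^sup>+z. ennreal ((fam 1 K N a A z - fam 1 K N a (insert i A) z)\<^sup>2) \<partial>lborel) \<le> ennreal ((\<beta> / real K) ^ DIM('v) / 2 * (1 / real n))"
      if "i \<in> I" "i \<notin> A" for A i
      using that M by (intro fam_close[OF U _ _ _ t]) (auto simp: I_def)
    show "loss i \<sigma> \<in> borel_measurable (\<Pi>\<^sub>M i\<in>{..<n}. borel)" for i \<sigma> by (rule loss_m)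
    show "a powr p * \<kappa> * cell_vol N i \<ge> 0" for i using cell_vol_pos[of N i] \<kappa> by simp
    show "ennreal (a powr p * \<kappa> * cell_vol N i) \<le> loss i False xs + loss i True xs" if i: "i \<in> I" and xs: "xs \<in> space (\<Pi>\<^sub>M i\<in>{..<n}. borel)" for i xs
    proof -
      note [measurable] = estimator_measurable(2)[OF T xs]
      obtain k where k: "i = (0, k)" using i by (cases i) (auto simp: I_def cells_def)
      have int: "integrable lborel (\<lambda>x. \<bar>wav (2 ^ N 0 b * x - real (k b))\<bar> powr p)" for b
        by (rule bump_integrable_dyadic[OF wav_powr_pos(1)[OF p]])
      have val: "(\<integral>x. \<bar>wav (2 ^ N 0 b * x - real (k b))\<bar> powr p \<partial>lborel) = (\<integral>x. \<bar>wav x\<bar> powr p \<partial>lborel) / 2 ^ N 0 b" for b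
        using bump_integral_dyadic[of "\<lambda>x. \<bar>wav x\<bar> powr p"] by simp
      have eq: "\<bar>psi N i z\<bar> powr p = tprod (\<lambda>b x. \<bar>wav (2 ^ N 0 b * x - real (k b))\<bar> powr p) z" for z
        by (simp add: k psi_eq tprod_def abs_prod prod_powr_distrib)
      have "ennreal (a powr p * \<kappa> * cell_vol N i) = ennreal (a powr p) * ennreal (\<integral>z. \<bar>psi N i z\<bar> powr p \<partial>lborel)"
        unfolding eq by (subst tprod_integral(2)) (simp_all add: int val \<kappa>_def cell_vol_def k prod_dividef power_sum flip: ennreal_mult')
      also have "ennreal (\<integral>z. \<bar>psi N i z\<bar> powr p \<partial>lborel) = (\<integral>\<^sup>+z. ennreal (\<bar>psi N i z\<bar> powr p) \<partial>lborel)"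
      proof (rule nn_integral_eq_integral[symmetric])
        show "integrable lborel (\<lambda>z. \<bar>psi N i z\<bar> powr p)" unfolding eq by (rule tprod_integral) (rule int)
      qed simp
      also have "ennreal (a powr p) * \<dots> = (\<integral>\<^sup>+z. ennreal (a powr p) * ennreal (\<bar>psi N i z\<bar> powr p) \<partial>lborel)"
        by (rule nn_integral_cmult[symmetric]) measurable
      also have "\<dots> \<le> (\<integral>\<^sup>+z. indicator (cell i) z * ennreal (\<bar>T xs z - base_dens K z - (if False then 1 else - 1) * (a * psi N i z)\<bar> powr p)
         + indicator (cell i) z * ennreal (\<bar>T xs z - base_dens K z - (if True then 1 else - 1) * (a * psi N i z)\<bar> powr p) \<partial>lborel)"
      proof (intro nn_integral_mono)
        fix z
        show "ennreal (a powr p) * ennreal (\<bar>psi N i z\<bar> powr p) 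
          \<le> indicator (cell i) z * ennreal (\<bar>T xs z - base_dens K z - (if False then 1 else - 1) * (a * psi N i z)\<bar> powr p)
         + indicator (cell i) z * ennreal (\<bar>T xs z - base_dens K z - (if True then 1 else - 1) * (a * psi N i z)\<bar> powr p)"
        proof (cases "z \<in> cell i")
          case False
          then show ?thesis using psi_cell[OF i, of z] by auto
        next
          case True
          let ?y = "T xs z - base_dens K z" and ?x = "a * psi N i z"
          \<comment> \<open>Whatever the estimate is at \<open>z\<close>, one of the two signs is
            missed by at least \<open>a * |psi N i z|\<close>.\<close>
          have "\<bar>?x\<bar> \<le> max \<bar>?y + ?x\<bar> \<bar>?y - ?x\<bar>" by linarith
          then have "\<bar>?x\<bar> powr p \<le> (max \<bar>?y + ?x\<bar> \<bar>?y - ?x\<bar>) powr p" using p by (intro powr_mono2) auto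
          also have "\<dots> \<le> \<bar>?y + ?x\<bar> powr p + \<bar>?y - ?x\<bar> powr p" by (auto simp: max_def)
          finally have "ennreal (\<bar>?x\<bar> powr p) \<le> ennreal (\<bar>?y + ?x\<bar> powr p + \<bar>?y - ?x\<bar> powr p)" by (rule ennreal_leI)
          then show ?thesis using True a by (simp add: abs_mult powr_mult ennreal_mult)
        qed
      qed
      also have "\<dots> = loss i False xs + loss i True xs"
        unfolding loss_def by (rule nn_integral_add) measurable
      finally show ?thesis .
    qed
  qed (use I G \<beta> K n in \<open>auto simp: I_def\<close>)
  also have "(\<Sum>i\<in>I. a powr p * \<kappa> * cell_vol N i) / 32 = real K ^ DIM('v) * (\<kappa> / 32 * a powr p)"
    using sum_cell_vol[of N 1 K] by (simp add: I_def flip: sum_distrib_left)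
  also have "(SUP A\<in>G. \<integral>\<^sup>+xs. (\<Sum>i\<in>I. loss i (i \<in> A) xs) \<partial>sample_measure n (fam 1 K N a A)) \<le> (SUP A\<in>G. risk p n T (fam 1 K N a A))"
  proof (intro SUP_mono' )
    fix A
    have sp: "space (sample_measure n (fam 1 K N a A)) = space (\<Pi>\<^sub>M i\<in>{..<n}. borel)"
      by (rule sets_eq_imp_space_eq[OF sets_sample_measure])
    show "(\<integral>\<^sup>+xs. (\<Sum>i\<in>I. loss i (i \<in> A) xs) \<partial>sample_measure n (fam 1 K N a A)) \<le> risk p n T (fam 1 K N a A)"
      unfolding risk_eq[OF p] by (intro nn_integral_mono sum_loss) (simp only: sp)
  qed
  finally show ?thesis by (simp add: \<kappa>_def)
qed

definition risk_const :: "real \<Rightarrow> nat \<Rightarrow> real" where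
  "risk_const p d = min (((\<integral>x. wav x * haar x \<partial>lborel) ^ d / sqrt 32) powr p) ((\<integral>x. \<bar>wav x\<bar> powr p \<partial>lborel) ^ d / 32)"

lemma risk_const_pos: "p > 0 \<Longrightarrow> risk_const p d > 0"
  using wav_haar_pos wav_powr_pos[of p] by (simp add: risk_const_def)

text \<open>Assouad's lemma is run on the patterns for which all listed derivatives of the
  perturbation have small norm, three quarters of all patterns by
  \<open>most_sign_choices_good\<close>. The class \<open>F\<close> enters only through a membership
  criterion, so that balls with and without the support condition are treated at once.\<close>

lemma minimax_lower_bound:
  fixes N :: "nat \<Rightarrow> 'v::euclidean_space \<Rightarrow> nat" and F :: "('v \<Rightarrow> real) set"
    and lst :: "'l \<Rightarrow> 'v list"
  assumes p: "p \<ge> 1" and J: "J \<ge> 1" and n: "n \<ge> 1" and K: "K \<ge> 1" and U: "deriv_bound S U"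
    and L: "finite L" "\<And>l. l \<in> L \<Longrightarrow> set (lst l) \<subseteq> Basis \<and> length (lst l) \<le> S"
    and \<beta>: "\<forall>x\<in>{0..1}. theta x \<ge> \<beta>" "\<beta> > 0"
    and a: "a > 0" "real J * (a * U ^ DIM('v)) \<le> (\<beta> / real K) ^ DIM('v) / 2"
    and M: "\<And>j. j < J \<Longrightarrow> M \<le> (\<Sum>b\<in>Basis. N j b)"
    and t: "4 * a\<^sup>2 * (U ^ DIM('v))\<^sup>2 / 2 ^ M \<le> (\<beta> / real K) ^ DIM('v) / 2 * (1 / real n)"
    and e: "\<And>l j. l \<in> L \<Longrightarrow> j < J \<Longrightarrow> (\<Sum>b\<in>Basis. N j b * count_list (lst l) b) \<le> e"
    and sep: "\<And>j j'. j < J \<Longrightarrow> j' < J \<Longrightarrow> j \<noteq> j' \<Longrightarrow> \<exists>b\<in>Basis. N j' b < N j b"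
    and base: "\<And>l. l \<in> L \<Longrightarrow> U ^ DIM('v) / real K ^ (DIM('v) + length (lst l)) * (3 * real K) powr (DIM('v) / p) \<le> \<epsilon>"
    and pert: "(8 * (real (card L) + 1) * exp 1 * p powr p) powr (1 / p) * U ^ DIM('v) * (a * sqrt (real J) * 2 ^ e) * real K powr (DIM('v) / p) \<le> \<epsilon>"
    and F: "\<And>A. (\<And>l. l \<in> L \<Longrightarrow> Lp_norm p (foldr dir_deriv (lst l) (fam J K N a A)) \<le> ennreal (4 * \<epsilon>)) \<Longrightarrow> fam J K N a A \<in> F"
    and pJ: "p \<ge> 2 \<or> J = 1"
  shows "ennreal (risk_const p DIM('v) * (real K ^ DIM('v) * (a * sqrt (real J)) powr p)) \<le> minimax_risk p n F"
proof -
  define I where "I = cells J K N"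
  have I: "finite I" by (simp add: I_def finite_cells)
  have U1: "U \<ge> 1" using U by (simp add: deriv_bound_def)
  define B where "B = \<bar>a\<bar> * sqrt (real J) * U ^ DIM('v) * 2 ^ e"
  have B: "B > 0" using a J U1 by (simp add: B_def)
  define h where "h l i z = a * foldr dir_deriv (lst l) (psi N i) z" for l i z
  have hm: "h l i \<in> borel_measurable borel" for l i
    unfolding h_def by (intro smooth_alg_measurable smooth_alg_cmult smooth_alg_foldr smooth_alg_psi)
  have \<epsilon>0: "\<epsilon> \<ge> 0"
    by (rule order_trans[OF _ pert]) (use p U1 a in auto)
  \<comment> \<open>Hypothesis \<open>pert\<close> is the \<open>p\<close>-th root of this threshold
    from \<open>most_sign_choices_good\<close>, with \<open>card L\<close> enlarged by 1, which
    keeps the constant positive for every \<open>L\<close>.\<close>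
  have le_eps: "4 * real (card L) * (2 * exp 1 * p powr p * B powr p) * real K ^ DIM('v) \<le> \<epsilon> powr p"
  proof -
    have "4 * real (card L) * (2 * exp 1 * p powr p * B powr p) * real K ^ DIM('v) 
        \<le> (8 * (real (card L) + 1) * exp 1 * p powr p) * (B powr p * real K ^ DIM('v))"
    proof -
      have "(8 * real (card L) * exp 1 * p powr p) * (B powr p * real K ^ DIM('v)) 
        \<le> (8 * (real (card L) + 1) * exp 1 * p powr p) * (B powr p * real K ^ DIM('v))"
        by (intro mult_right_mono) auto
      then show ?thesis by (simp add: mult_ac)
    qed
    also have "\<dots> = ((8 * (real (card L) + 1) * exp 1 * p powr p) powr (1 / p) * B * real K powr (DIM('v) / p)) powr p"
      using p K B by (simp add: powr_mult powr_powr powr_realpow mult_ac)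
    also have "\<dots> \<le> \<epsilon> powr p"
    proof (rule powr_mono2)
      show "(8 * (real (card L) + 1) * exp 1 * p powr p) powr (1 / p) * B * real K powr (DIM('v) / p) \<le> \<epsilon>"
        using pert a(1) by (simp add: B_def mult_ac)
    qed (use p B in simp_all)
    finally show ?thesis .
  qed
  define G where "G = {A \<in> Pow I. \<forall>l\<in>L. (\<integral>\<^sup>+z. ennreal (\<bar>\<Sum>i\<in>I. sg A i * h l i z\<bar> powr p) \<partial>lborel) \<le> ennreal (\<epsilon> powr p)}"
  have "card (Pow I - G) \<le> card {A \<in> Pow I. \<not> (\<forall>l\<in>L. (\<integral>\<^sup>+z. ennreal (\<bar>\<Sum>i\<in>I. sg A i * h l i z\<bar> powr p) \<partial>lborel)
       \<le> ennreal (4 * real (card L) * (2 * exp 1 * p powr p * B powr p) * real K ^ DIM('v)))}"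
    using I by (intro card_mono) (auto simp: G_def intro: order_trans[OF _ ennreal_leI[OF le_eps]])
  moreover have "4 * card {A \<in> Pow I. \<not> (\<forall>l\<in>L. (\<integral>\<^sup>+z. ennreal (\<bar>\<Sum>i\<in>I. sg A i * h l i z\<bar> powr p) \<partial>lborel)
       \<le> ennreal (4 * real (card L) * (2 * exp 1 * p powr p * B powr p) * real K ^ DIM('v)))} \<le> 2 ^ card I"
  proof (rule most_sign_choices_good[OF I L(1) _ B, where Q = "big_box K"])
    show "(\<Sum>i\<in>I. (h l i z)\<^sup>2) \<le> B\<^sup>2 * indicator (big_box K) z" if "l \<in> L" for l z
      unfolding I_def h_def B_def using L(2)[OF that] e[OF that] by (intro sum_psi_deriv_square_le[OF _ _ U]) auto
  qed (use p K hm in \<open>auto simp: emeasure_big_box\<close>)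
  ultimately have G: "G \<subseteq> Pow I" "4 * card (Pow I - G) \<le> 2 ^ card I" by (auto simp: G_def)
  have GF: "fam J K N a A \<in> F" if A: "A \<in> G" for A
  proof (rule F)
    fix l assume l: "l \<in> L"
    have eq: "foldr dir_deriv (lst l) (fam J K N a A) = (\<lambda>z. foldr dir_deriv (lst l) (base_dens K) z + (\<Sum>i\<in>I. sg A i * h l i z))"
      by (simp add: foldr_dir_deriv_fam I_def h_def)
    show "Lp_norm p (foldr dir_deriv (lst l) (fam J K N a A)) \<le> ennreal (4 * \<epsilon>)"
      unfolding eq
    proof (rule Lp_norm_add_le[OF p \<epsilon>0])
      show "foldr dir_deriv (lst l) (base_dens K) \<in> borel_measurable borel"
        by (intro smooth_alg_measurable smooth_alg_foldr smooth_alg_base_dens)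
      show "(\<integral>\<^sup>+z. ennreal (\<bar>foldr dir_deriv (lst l) (base_dens K) (z::'v)\<bar> powr p) \<partial>lborel) \<le> ennreal (\<epsilon> powr p)"
        using L(2)[OF l] p by (intro base_dens_deriv_Lp[OF _ _ U K _ base[OF l]]) auto
      show "(\<lambda>z. \<Sum>i\<in>I. sg A i * h l i z) \<in> borel_measurable borel"
        using hm by measurable
      show "(\<integral>\<^sup>+z. ennreal (\<bar>\<Sum>i\<in>I. sg A i * h l i z\<bar> powr p) \<partial>lborel) \<le> ennreal (\<epsilon> powr p)"
        using A l by (auto simp: G_def)
    qed
  qed
  show ?thesis unfolding minimax_risk_def
  proof (rule INF_greatest)
    fix T :: "(nat \<Rightarrow> 'v) \<Rightarrow> 'v \<Rightarrow> real" assume T: "T \<in> estimators n"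
    have "ennreal (risk_const p DIM('v) * (real K ^ DIM('v) * (a * sqrt (real J)) powr p)) \<le> (SUP A\<in>G. risk p n T (fam J K N a A))"
      using pJ
    proof
      assume p2: "p \<ge> 2"
      have "risk_const p DIM('v) * (real K ^ DIM('v) * (a * sqrt (real J)) powr p)
         \<le> ((\<integral>x. wav x * haar x \<partial>lborel) ^ DIM('v) / sqrt 32) powr p * (real K ^ DIM('v) * (a * sqrt (real J)) powr p)"
        by (intro mult_right_mono) (auto simp: risk_const_def)
      also have "\<dots> = real K ^ DIM('v) * ((\<integral>x. wav x * haar x \<partial>lborel) ^ DIM('v) / sqrt 32 * (a * sqrt (real J))) powr p"
        by (simp only: powr_mult mult_ac)
      finally show ?thesis
        using risk_lower_bound_ge2[OF p2 T J n G[unfolded I_def] \<beta> K U a M t sep] by (meson ennreal_leI order_trans)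
    next
      assume J1: "J = 1"
      have "risk_const p DIM('v) * (real K ^ DIM('v) * (a * sqrt (real J)) powr p)
         \<le> ((\<integral>x. \<bar>wav x\<bar> powr p \<partial>lborel) ^ DIM('v) / 32) * (real K ^ DIM('v) * (a * sqrt (real J)) powr p)"
        by (intro mult_right_mono) (auto simp: risk_const_def)
      also have "\<dots> = real K ^ DIM('v) * ((\<integral>x. \<bar>wav x\<bar> powr p \<partial>lborel) ^ DIM('v) / 32 * a powr p)"
        using J1 by simp
      finally have *: "risk_const p DIM('v) * (real K ^ DIM('v) * (a * sqrt (real J)) powr p) \<le> \<dots>" .
      have "ennreal (real K ^ DIM('v) * ((\<integral>x. \<bar>wav x\<bar> powr p \<partial>lborel) ^ DIM('v) / 32 * a powr p))
        \<le> (SUP A\<in>G. risk p n T (fam J K N a A))"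
        unfolding J1 by (rule risk_lower_bound_single_scale[OF _ T n _ _ \<beta> K U a(1) _ _ t])
          (use G a p M J1 in \<open>auto simp: I_def\<close>)
      then show ?thesis using * by (meson ennreal_leI order_trans)
    qed
    also have "\<dots> \<le> (SUP f\<in>F. risk p n T f)"
      by (intro SUP_least SUP_upper GF)
    finally show "ennreal (risk_const p DIM('v) * (real K ^ DIM('v) * (a * sqrt (real J)) powr p)) \<le> (SUP f\<in>F. risk p n T f)" .
  qed
qed

section \<open>Choice of the scales\<close>

lemma dyadic_bracket:
  assumes "(1::real) \<le> x" "q > 0" shows "\<exists>N::nat. 2 ^ (q * N) \<le> x \<and> x < 2 ^ (q * (N + 1))"
proof -
  have "(2::real) ^ q > 1" using assms(2) by (simp add: one_less_power)
  then obtain N where N: "x < (2 ^ q) ^ N" using real_arch_pow by blast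
  define N0 where "N0 = (LEAST N. x < (2 ^ q) ^ N)"
  have 1: "x < (2 ^ q) ^ N0" unfolding N0_def using N by (rule LeastI)
  have "N0 \<noteq> 0" using 1 assms(1) by (cases N0) auto
  then obtain k where k: "N0 = Suc k" by (cases N0) auto
  have "\<not> x < (2 ^ q) ^ k" using not_less_Least[of k "\<lambda>N. x < (2 ^ q) ^ N"] k unfolding N0_def by simp
  then show ?thesis using 1 k by (intro exI[of _ k]) (auto simp: power_mult power_add not_less)
qed

text \<open>The exponents of the rate after taking logarithms. \<open>lK\<close> stands for
  \<open>ln K\<close>, and likewise for the other letters (\<open>lr\<close> for the radius,
  \<open>ln'\<close> for the sample size, \<open>le\<close> for \<open>\<eta>\<close>,
  \<open>lB\<close> for \<open>\<beta>\<close>); \<open>A\<close> is d/(2s+d), \<open>sg\<close> is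
  ps/(2s+d), \<open>ds\<close> is d/s and \<open>e2\<close> is the exponent of \<open>K\<close>.
  That \<open>lr\<close> and \<open>ln'\<close> have dropped out of the right-hand side is the
  independence of radius and sample size.\<close>

lemma log_balance:
  fixes p A d lK lr l2 lV lb lJ lC le lB x sg ds ln' :: real
  assumes "2 * sg = p * (1 - A)" "sg * ds = p * A" "p * x = d * lK" "lb = d * lB - d * lK - l2"
   "2 * e2 = d * (2 - p) * (1 - A)" "lY = lV + 2 * (le + lr) - (lb + lJ + 2 * lC + 2 * x)" 
   "lX = (lb + lJ) - (d * l2 + lV + ln') + A * (lY + ln')"
  shows "- sg * (ds * lr - ln') + (d * lK + p / 2 * lX)
    = - (d * p / 2) * l2 + sg * (d * lB - (l2 + lV)) + p * A * (le - lC) + (e2 * lK + sg * lJ)"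
proof -
  have "2 * (- sg * (ds * lr - ln')) + (2 * d * lK + p * lX)
    = - (d * p) * l2 + 2 * (sg * (d * lB - (l2 + lV))) + 2 * (p * A * (le - lC)) + 2 * (e2 * lK + sg * lJ)"
    using assms by algebra
  then show ?thesis by (simp add: field_simps)
qed

text \<open>The level \<open>N0\<close> is the largest one that the Sobolev budget permits, the
  amplitude \<open>a\<close> the largest one that keeps a sign undetectable. The constant
  \<open>c0\<close> is quantified before \<open>K\<close>, \<open>J\<close> and the radius, whose
  influence is displayed in full.\<close>

lemma rate_numerics:
  fixes d s :: nat and p U \<beta> C \<eta> :: real
  assumes "d \<ge> 1" "s \<ge> 1" "p > 0" "U \<ge> 1" "\<beta> > 0" "C > 0" "\<eta> > 0"
  shows "\<exists>c0>0. \<forall>K J N1 :: nat. \<forall>rs::real. K \<ge> 1 \<longrightarrow> J \<ge> 1 \<longrightarrow> rs > 0 \<longrightarrow>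
    (\<forall>\<^sub>F n in sequentially. \<exists>N0 a. N0 \<ge> N1 \<and> a > 0 \<and>
      real J * (a * U ^ d) \<le> (\<beta> / real K) ^ d / 2 \<and>
      4 * a\<^sup>2 * (U ^ d)\<^sup>2 / 2 ^ (d * N0) \<le> (\<beta> / real K) ^ d / 2 * (1 / real n) \<and>
      C * (a * sqrt (real J) * 2 ^ (s * N0)) * real K powr (d / p) \<le> \<eta> * rs \<and>
      c0 * (real K powr (real d * real s * (2 - p) / (2 * real s + real d)) * real J powr (p * real s / (2 * real s + real d)))
        \<le> (rs powr (d / s) / real n) powr (- (p * real s / (2 * real s + real d))) * (real K ^ d * (a * sqrt (real J)) powr p))"
proof -
  define q where "q = 2 * s + d"
  have q: "q > 0" "real q = 2 * real s + real d" "real d / real q < 1" using assms by (auto simp: q_def)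
  define V where "V = 4 * (U ^ d)\<^sup>2"
  have V: "V > 0" using assms by (simp add: V_def)
  \<comment> \<open>The first factor is the loss from rounding the optimal scale to a power of 2;
    the other two collect what remains of \<open>\<beta>\<close>, \<open>V\<close>,
    \<open>\<eta>\<close> and \<open>C\<close> once the powers of \<open>K\<close>, \<open>J\<close>
    and \<open>rs\<close> are separated.\<close>
  define c0 where "c0 = (1 / 2) powr (d * p / 2) * (\<beta> ^ d / (2 * V)) powr (p * s / q) * (\<eta> / C) powr (p * d / q)"
  have "c0 > 0" using assms V by (simp add: c0_def)
  moreover have "\<forall>\<^sub>F n in sequentially. \<exists>N0 a. N0 \<ge> N1 \<and> a > 0 \<and>
      real J * (a * U ^ d) \<le> (\<beta> / real K) ^ d / 2 \<and>
      4 * a\<^sup>2 * (U ^ d)\<^sup>2 / 2 ^ (d * N0) \<le> (\<beta> / real K) ^ d / 2 * (1 / real n) \<and>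
      C * (a * sqrt (real J) * 2 ^ (s * N0)) * real K powr (d / p) \<le> \<eta> * rs \<and>
      c0 * (real K powr (real d * real s * (2 - p) / (2 * real s + real d)) * real J powr (p * real s / (2 * real s + real d)))
        \<le> (rs powr (d / s) / real n) powr (- (p * real s / (2 * real s + real d))) * (real K ^ d * (a * sqrt (real J)) powr p)"
    if KJ: "K \<ge> 1" "J \<ge> 1" and rs: "rs > 0" for K J N1 :: nat and rs :: real
  proof -
    define b where "b = (\<beta> / real K) ^ d / 2"
    have b: "b > 0" using assms KJ by (simp add: b_def)
    \<comment> \<open>With \<open>a\<^sup>2 = b * H / (V * real n)\<close> and
      \<open>H = 2 ^ (d * N0)\<close>, the squared Sobolev constraint becomes precisely
      \<open>2 ^ (q * N0) \<le> Y * real n\<close>.\<close>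
    define Y where "Y = V * (\<eta> * rs)\<^sup>2 / (b * real J * C\<^sup>2 * (real K powr (d / p))\<^sup>2)"
    have Y: "Y > 0" using V assms rs b KJ by (simp add: Y_def)
    \<comment> \<open>This yields \<open>N0 \<ge> N1\<close>, the room needed later for shifting
      levels up and down between the two blocks of coordinates.\<close>
    have ev1: "\<forall>\<^sub>F n in sequentially. 2 ^ (q * (N1 + 1)) \<le> Y * real n" 
    proof -
      have "filterlim (\<lambda>n. Y * real n) at_top sequentially"
        by (rule filterlim_tendsto_pos_mult_at_top[OF tendsto_const Y filterlim_real_sequentially])
      then show ?thesis by (simp add: filterlim_at_top)
    qed
    \<comment> \<open>The positivity constraint after squaring. The left-hand side grows like
      \<open>n\<close> to the power \<open>d / q\<close>, and \<open>d / q < 1\<close>, so it holds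
      for large \<open>n\<close> however big \<open>J\<close> is.\<close>
    have ev2: "\<forall>\<^sub>F n in sequentially. (real J)\<^sup>2 * (Y * real n) powr (d / q) \<le> 4 * b * real n"
    proof -
      have "((\<lambda>n. (real J)\<^sup>2 * Y powr (d / q) * real n powr (d / q - 1)) \<longlongrightarrow> (real J)\<^sup>2 * Y powr (d / q) * 0) sequentially"
        using q by (intro tendsto_mult tendsto_const tendsto_neg_powr filterlim_real_sequentially) auto
      then have "\<forall>\<^sub>F n in sequentially. (real J)\<^sup>2 * Y powr (d / q) * real n powr (d / q - 1) < 4 * b"
        by (rule order_tendstoD(2)) (use b in simp)
      then show ?thesis using eventually_gt_at_top[of 0]
      proof eventually_elim
        case (elim n)
        have "(real J)\<^sup>2 * (Y * real n) powr (d / q) = ((real J)\<^sup>2 * Y powr (d / q) * real n powr (d / q - 1)) * real n"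
          using elim Y by (simp add: powr_mult powr_diff)
        also have "\<dots> \<le> 4 * b * real n" using elim by (intro mult_right_mono) auto
        finally show ?case .
      qed
    qed
    show ?thesis using ev1 ev2 eventually_gt_at_top[of 0]
    proof eventually_elim
      case (elim n)
      then have n: "real n > 0" by simp
      have Yn: "1 \<le> Y * real n" using elim(1) one_le_power[of "2::real" "q * (N1 + 1)"] by linarith
      obtain N0 where N0: "2 ^ (q * N0) \<le> Y * real n" "Y * real n < 2 ^ (q * (N0 + 1))"
        using dyadic_bracket[OF Yn q(1)] by blast
      have "(2::real) ^ (q * (N1 + 1)) < 2 ^ (q * (N0 + 1))" using elim(1) N0(2) by linarith
      then have "q * (N1 + 1) < q * (N0 + 1)" by (rule power_less_imp_less_exp[rotated]) simp
      then have N01: "N0 \<ge> N1" using q(1) by simp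
      define H :: real where "H = 2 ^ (d * N0)"
      have H: "H > 0" by (simp add: H_def)
      have Hq: "H = (2 ^ (q * N0)) powr (d / q)"
        using q(1) by (simp add: H_def powr_powr mult.commute flip: powr_realpow)
      have H_le: "H \<le> (Y * real n) powr (d / q)" unfolding Hq using N0(1) by (intro powr_mono2) auto
      have H_ge: "(Y * real n) powr (d / q) \<le> 2 ^ d * H"
      proof -
        have "(Y * real n) powr (d / q) \<le> (2 ^ (q * (N0 + 1))) powr (d / q)"
          using N0(2) Yn by (intro powr_mono2) auto
        also have "\<dots> = 2 ^ d * H" using q(1)
          by (simp add: H_def powr_powr powr_add[symmetric] algebra_simps flip: powr_realpow)
        finally show ?thesis .
      qed
      \<comment> \<open>Equality in the constraint that keeps a single sign undetectable.\<close>
      define a where "a = sqrt (b * H / (V * real n))"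
      have a: "a > 0" using b H V n by (simp add: a_def)
      have a2: "a\<^sup>2 = b * H / (V * real n)" using b H V n by (simp add: a_def)
      have c1: "real J * (a * U ^ d) \<le> b"
      proof (rule power2_le_imp_le)
        have "(real J * (a * U ^ d))\<^sup>2 = (real J)\<^sup>2 * (U ^ d)\<^sup>2 * (b * H / (V * real n))"
          by (simp add: power_mult_distrib a2)
        also have "\<dots> = b / (4 * real n) * ((real J)\<^sup>2 * H)"
          using assms by (simp add: V_def field_simps)
        also have "\<dots> \<le> b / (4 * real n) * ((real J)\<^sup>2 * (Y * real n) powr (d / q))"
          using b n H_le by (intro mult_left_mono) auto
        also have "\<dots> \<le> b / (4 * real n) * (4 * b * real n)"
          using b n elim(2) by (intro mult_left_mono) auto
        also have "\<dots> = b\<^sup>2" using n by (simp add: power2_eq_square)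
        finally show "(real J * (a * U ^ d))\<^sup>2 \<le> b\<^sup>2" .
      qed (use b in simp)
      have c2: "4 * a\<^sup>2 * (U ^ d)\<^sup>2 / 2 ^ (d * N0) \<le> b * (1 / real n)"
      proof -
        have "4 * a\<^sup>2 * (U ^ d)\<^sup>2 / 2 ^ (d * N0) = V * a\<^sup>2 / H" by (simp add: V_def H_def)
        also have "\<dots> = b * (1 / real n)" using V H n by (simp add: a2)
        finally show ?thesis by simp
      qed
      have c3: "C * (a * sqrt (real J) * 2 ^ (s * N0)) * real K powr (d / p) \<le> \<eta> * rs"
      proof (rule power2_le_imp_le)
        have "H * (2 ^ (s * N0))\<^sup>2 = 2 ^ (q * N0)"
          by (simp add: H_def q_def power_mult[symmetric] power_add[symmetric] algebra_simps)
        then have "(C * (a * sqrt (real J) * 2 ^ (s * N0)) * real K powr (d / p))\<^sup>2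
          = b * real J * C\<^sup>2 * (real K powr (d / p))\<^sup>2 / (V * real n) * 2 ^ (q * N0)"
          by (simp add: power_mult_distrib a2 mult_ac) 
        also have "\<dots> \<le> b * real J * C\<^sup>2 * (real K powr (d / p))\<^sup>2 / (V * real n) * (Y * real n)"
          using N0(1) b V n by (intro mult_left_mono) auto
        also have "\<dots> = (\<eta> * rs)\<^sup>2"
          using b V n assms KJ by (simp add: Y_def)
        finally show "(C * (a * sqrt (real J) * 2 ^ (s * N0)) * real K powr (d / p))\<^sup>2 \<le> (\<eta> * rs)\<^sup>2" .
      qed (use assms rs in simp)
      have c4: "c0 * (real K powr (d * s * (2 - p) / q) * real J powr (p * s / q))
        \<le> (rs powr (d / s) / real n) powr (- (p * s / q)) * (real K ^ d * (a * sqrt (real J)) powr p)"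
      proof -
        have aJ: "(a * sqrt (real J)) powr p = (a\<^sup>2 * real J) powr (p / 2)"
        proof -
          have "(a\<^sup>2 * real J) powr (p / 2) = ((a * sqrt (real J)) powr 2) powr (p / 2)"
            using a KJ by (simp add: power_mult_distrib)
          then show ?thesis by (simp add: powr_powr)
        qed
        \<comment> \<open>\<open>a\<^sup>2 * real J\<close> with \<open>H\<close> replaced by its
          lower bound: a pure product of powers, of which logarithms can be taken.\<close>
        define X where "X = b * real J / (2 ^ d * V * real n) * (Y * real n) powr (d / q)"
        have "X \<le> b * real J / (2 ^ d * V * real n) * (2 ^ d * H)"
          unfolding X_def using b V n H_ge by (intro mult_left_mono) auto
        also have "\<dots> = a\<^sup>2 * real J" by (simp add: a2)
        finally have "X powr (p / 2) \<le> (a\<^sup>2 * real J) powr (p / 2)"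
          using assms b V n by (intro powr_mono2) (auto simp: X_def)
        then have "(rs powr (d / s) / real n) powr (- (p * s / q)) * (real K ^ d * X powr (p / 2)) 
          \<le> (rs powr (d / s) / real n) powr (- (p * s / q)) * (real K ^ d * (a * sqrt (real J)) powr p)"
          unfolding aJ by (intro mult_left_mono) auto
        moreover have "(rs powr (d / s) / real n) powr (- (p * s / q)) * (real K ^ d * X powr (p / 2)) 
          = c0 * (real K powr (d * s * (2 - p) / q) * real J powr (p * s / q))"
        proof -
          define A where "A = real d / real q"
          have lb: "ln b = d * ln \<beta> - d * ln K - ln 2"
            using assms KJ by (simp add: b_def ln_div ln_mult ln_realpow power_divide)
          have lY: "ln Y = ln V + 2 * (ln \<eta> + ln rs) - (ln b + ln J + 2 * ln C + 2 * (d / p * ln K))"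
            using assms KJ rs b V by (simp add: Y_def ln_div ln_mult ln_realpow ln_powr)
          have lX: "ln X = (ln b + ln J) - (d * ln 2 + ln V + ln n) + A * (ln Y + ln n)"
            using assms KJ rs b V n Y by (simp add: X_def ln_div ln_mult ln_realpow ln_powr A_def)
          have X: "X > 0" using b V n Y KJ by (simp add: X_def)
          have l1: "ln ((rs powr (d / s) / real n) powr (- (p * s / q)) * (real K ^ d * X powr (p / 2)))
             = - (p * s / q) * (d / s * ln rs - ln n) + (d * ln K + p / 2 * ln X)"
            using assms KJ rs n X by (simp add: ln_div ln_mult ln_realpow ln_powr)
          have l2: "ln (c0 * (real K powr (d * s * (2 - p) / q) * real J powr (p * s / q)))
            = - (d * p / 2) * ln 2 + (p * s / q) * (d * ln \<beta> - (ln 2 + ln V)) + (p * d / q) * (ln \<eta> - ln C)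
              + (d * s * (2 - p) / q * ln K + p * s / q * ln J)"
            using assms KJ V by (simp add: c0_def ln_div ln_mult ln_realpow ln_powr)
          have "- (p * s / q) * (d / s * ln rs - ln n) + (d * ln K + p / 2 * ln X)
            = - (d * p / 2) * ln 2 + (p * s / q) * (d * ln \<beta> - (ln 2 + ln V)) + p * A * (ln \<eta> - ln C)
              + (d * s * (2 - p) / q * ln K + p * s / q * ln J)"
          proof (rule log_balance)
            show "2 * (p * s / q) = p * (1 - A)" "p * s / q * (d / s) = p * A" 
              "2 * (d * s * (2 - p) / q) = d * (2 - p) * (1 - A)"
              using q(1,2) assms by (simp_all add: A_def field_simps)
            show "p * (d / p * ln K) = d * ln K" using assms by simp
          qed (rule lb lY lX)+
          moreover have "p * d / q = p * A" by (simp add: A_def)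
          ultimately have "- (p * s / q) * (d / s * ln rs - ln n) + (d * ln K + p / 2 * ln X)
            = - (d * p / 2) * ln 2 + (p * s / q) * (d * ln \<beta> - (ln 2 + ln V)) + (p * d / q) * (ln \<eta> - ln C)
              + (d * s * (2 - p) / q * ln K + p * s / q * ln J)" by simp
          then have "ln ((rs powr (d / s) / real n) powr (- (p * s / q)) * (real K ^ d * X powr (p / 2)))
            = ln (c0 * (real K powr (d * s * (2 - p) / q) * real J powr (p * s / q)))"
            unfolding l1 l2 .
          then show ?thesis
            using assms KJ rs n X V by (subst (asm) ln_inj_iff) (auto simp: c0_def)
        qed
        ultimately show ?thesis by simp
      qed
      show ?case
        using N01 a c1 c2 c3 c4 unfolding b_def q_def by (intro exI[of _ N0] exI[of _ a]) simp
    qed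
  qed
  ultimately show ?thesis by blast
qed

text \<open>The side lengths are \<open>2 ^ (- n1 j)\<close> and \<open>2 ^ (- n2 j)\<close>. The weighted sum \<open>s1 * n1 j + s2 * n2 j\<close> does not depend on \<open>j\<close>,
  and the direction of the anisotropy is chosen such that the cell volume does not grow with \<open>j\<close>.\<close>

lemma scale_exponents:
  fixes s1 s2 d1 d2 J N0 :: nat
  assumes "s1 \<ge> 1" "s2 \<ge> 1" "N0 \<ge> (s1 + s2) * J"
  shows "\<exists>n1 n2. \<forall>j<J. s1 * n1 j + s2 * n2 j \<le> (s1 + s2) * N0 \<and> (d1 + d2) * N0 \<le> d1 * n1 j + d2 * n2 j
     \<and> (\<forall>j'<J. j \<noteq> j' \<longrightarrow> n1 j' < n1 j \<or> n2 j' < n2 (j::nat))"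
\<comment> \<open>Here the levels are \<open>N0 - s2 * j\<close> and \<open>N0 + s1 * j\<close>, in
  the other case the roles are exchanged. The weighted sum is constant in \<open>j\<close>, and the
  case condition says that the change \<open>d2 * s1 - d1 * s2\<close> of the volume exponent per
  step is nonnegative. \<open>N0 \<ge> (s1 + s2) * J\<close> prevents truncation in the
  subtraction.\<close>
proof (cases "d1 * s2 \<le> d2 * s1")
  case True
  show ?thesis
  proof (intro exI allI impI conjI)
    fix j assume j: "j < J"
    have "s2 * j \<le> s2 * J" using j by (intro mult_le_mono2) simp
    moreover have "s2 * J \<le> N0" using assms(3) by (simp add: algebra_simps)
    ultimately have le: "s2 * j \<le> N0" by (rule le_trans)
    then obtain m where m: "N0 = s2 * j + m" using le_Suc_ex by blast
    have mm: "N0 - s2 * j = m" using m by simp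
    show "s1 * (N0 - s2 * j) + s2 * (N0 + s1 * j) \<le> (s1 + s2) * N0"
      unfolding mm unfolding m by (simp add: algebra_simps)
    have "d1 * (s2 * j) \<le> d2 * (s1 * j)" using mult_right_mono[OF True, of j] by (simp add: mult_ac)
    then show "(d1 + d2) * N0 \<le> d1 * (N0 - s2 * j) + d2 * (N0 + s1 * j)"
      unfolding mm unfolding m by (simp add: algebra_simps)
    fix j' assume j': "j' < J" "j \<noteq> j'"
    show "N0 - s2 * j' < N0 - s2 * j \<or> N0 + s1 * j' < N0 + s1 * j"
    proof (cases "j < j'")
      case True
      have "s2 * j' \<le> s2 * J" using j' by (intro mult_le_mono2) simp
      then have "s2 * j' \<le> N0" using \<open>s2 * J \<le> N0\<close> by (rule le_trans)
      moreover have "s2 * j < s2 * j'" using True assms by simp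
      ultimately show ?thesis by linarith
    next
      case False
      then show ?thesis using j' assms by simp
    qed
  qed
next
  case False
  then have F: "d2 * s1 \<le> d1 * s2" by simp
  show ?thesis
  proof (intro exI allI impI conjI)
    fix j assume j: "j < J"
    have "s1 * j \<le> s1 * J" using j by (intro mult_le_mono2) simp
    moreover have "s1 * J \<le> N0" using assms(3) by (simp add: algebra_simps)
    ultimately have le: "s1 * j \<le> N0" by (rule le_trans)
    then obtain m where m: "N0 = s1 * j + m" using le_Suc_ex by blast
    have mm: "N0 - s1 * j = m" using m by simp
    show "s1 * (N0 + s2 * j) + s2 * (N0 - s1 * j) \<le> (s1 + s2) * N0"
      unfolding mm unfolding m by (simp add: algebra_simps)
    have "d2 * (s1 * j) \<le> d1 * (s2 * j)" using mult_right_mono[OF F, of j] by (simp add: mult_ac)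
    then show "(d1 + d2) * N0 \<le> d1 * (N0 + s2 * j) + d2 * (N0 - s1 * j)"
      unfolding mm unfolding m by (simp add: algebra_simps)
    fix j' assume j': "j' < J" "j \<noteq> j'"
    show "N0 + s2 * j' < N0 + s2 * j \<or> N0 - s1 * j' < N0 - s1 * j"
    proof (cases "j < j'")
      case True
      have "s1 * j' \<le> s1 * J" using j' by (intro mult_le_mono2) simp
      then have "s1 * j' \<le> N0" using \<open>s1 * J \<le> N0\<close> by (rule le_trans)
      moreover have "s1 * j < s1 * j'" using True assms by simp
      ultimately show ?thesis by linarith
    next
      case False
      then show ?thesis using j' assms by simp
    qed
  qed
qed

lemma axis_1_neq_0: "axis i (1::real) \<noteq> 0"
  by (simp add: axis_eq_0_iff)

lemma sum_list_concat_replicate: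
  fixes g :: "'a \<Rightarrow> nat" and \<alpha> :: "'i::finite \<Rightarrow> nat"
  shows "sum_list (map g (concat (map (\<lambda>i. replicate (\<alpha> i) (e i)) indices))) = (\<Sum>i\<in>UNIV. \<alpha> i * g (e i))"
proof -
  have "sum_list (map g (concat (map (\<lambda>i. replicate (\<alpha> i) (e i)) xs))) = sum_list (map (\<lambda>i. \<alpha> i * g (e i)) xs)" for xs
    by (induction xs) (auto simp: sum_list_replicate)
  then show ?thesis using sum_list_distinct_conv_sum_set[OF indices(1), of "\<lambda>i. \<alpha> i * g (e i)"]
    by (simp add: indices)
qed

text \<open>\<open>K\<close> dilates the base density and \<open>J\<close> counts the superposed scales; the condition on \<open>W\<close> says that the base density is
  small in the Sobolev norm.\<close>

definition rate_lower_bound ::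
  "nat \<Rightarrow> real \<Rightarrow> real \<Rightarrow> (('m::finite \<Rightarrow> nat) \<times> ('n::finite \<Rightarrow> nat)) set \<Rightarrow> real \<Rightarrow> real \<Rightarrow> bool" where
  "rate_lower_bound s p \<eta> L c W \<longleftrightarrow> (let d = CARD('m) + CARD('n) in
     \<forall>(K::nat) (J::nat) (rs::real) (F :: ((real^'m) \<times> (real^'n) \<Rightarrow> real) set).
     K \<ge> 1 \<longrightarrow> J \<ge> 1 \<longrightarrow> rs > 0 \<longrightarrow> (p \<ge> 2 \<or> J = 1) \<longrightarrow>
     (\<forall>(\<alpha>1, \<alpha>2)\<in>L. W / real K ^ (d + (order \<alpha>1 + order \<alpha>2)) * (3 * real K) powr (d / p) \<le> \<eta> * rs) \<longrightarrow>
     (\<forall>f. smooth_alg f \<longrightarrow> prob_density f \<longrightarrow> (\<forall>z. z \<notin> outer_box K \<longrightarrow> f z = 0) \<longrightarrow>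
        (\<forall>(\<alpha>1, \<alpha>2)\<in>L. Lp_norm p (foldr dir_deriv (rev (deriv_dirs \<alpha>1 \<alpha>2)) f) \<le> ennreal (4 * (\<eta> * rs))) \<longrightarrow> f \<in> F) \<longrightarrow>
     (\<forall>\<^sub>F n in sequentially. ennreal (c * (real K powr (real d * real s * (2 - p) / (2 * real s + real d)) * real J powr (p * real s / (2 * real s + real d))))
        \<le> ennreal ((rs powr (d / s) / real n) powr (- (p * real s / (2 * real s + real d)))) * minimax_risk p n F))"

lemmas rate_lower_boundD = rate_lower_bound_def[unfolded Let_def, THEN iffD1,
  THEN spec, THEN spec, THEN spec, THEN spec, THEN mp, THEN mp, THEN mp, THEN mp, THEN mp, THEN mp]

text \<open>The quantifier order is the point: \<open>c\<close> and \<open>W\<close> come before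
  \<open>K\<close>, \<open>J\<close>, the radius and the class, so they cannot depend on r.\<close>

lemma minimax_rate:
  fixes L :: "(('m::finite \<Rightarrow> nat) \<times> ('n::finite \<Rightarrow> nat)) set" and s1 s2 :: nat and p \<eta> :: real
  assumes s12: "s1 \<ge> 1" "s2 \<ge> 1" and p: "p \<ge> 1" and \<eta>: "\<eta> > 0"
    and L: "L \<subseteq> multi_indices s1 \<times> multi_indices s2"
  shows "\<exists>c>0. \<exists>W. rate_lower_bound (s1 + s2) p \<eta> L c W"
proof -
  define d where "d = CARD('m) + CARD('n)"
  define s where "s = s1 + s2"
  have dim: "DIM((real^'m) \<times> (real^'n)) = d" by (simp add: d_def)
  have ds: "d \<ge> 1" "s \<ge> 1" using s12(1) by (simp_all add: d_def s_def Suc_leI)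
  obtain U where U: "deriv_bound s U" using deriv_bound_exists by blast
  then have U1: "U \<ge> 1" by (simp add: deriv_bound_def)
  obtain \<beta> where \<beta>: "\<beta> > 0" "\<forall>x\<in>{0..1}. theta x \<ge> \<beta>" using theta_lower_bound by blast
  \<comment> \<open>The constant in front of the perturbation norm in
    \<open>minimax_lower_bound\<close>.\<close>
  define C where "C = (8 * (real (card L) + 1) * exp 1 * p powr p) powr (1 / p) * U ^ d"
  have C: "C > 0" using U1 p by (simp add: C_def add_nonneg_pos)
  obtain c0 where c0: "c0 > 0" and rate: "\<And>K J N1 rs. K \<ge> 1 \<Longrightarrow> J \<ge> 1 \<Longrightarrow> rs > 0 \<Longrightarrow>
    (\<forall>\<^sub>F n in sequentially. \<exists>N0 a. N0 \<ge> N1 \<and> a > 0 \<and>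
      real J * (a * U ^ d) \<le> (\<beta> / real K) ^ d / 2 \<and>
      4 * a\<^sup>2 * (U ^ d)\<^sup>2 / 2 ^ (d * N0) \<le> (\<beta> / real K) ^ d / 2 * (1 / real n) \<and>
      C * (a * sqrt (real J) * 2 ^ (s * N0)) * real K powr (d / p) \<le> \<eta> * rs \<and>
      c0 * (real K powr (real d * real s * (2 - p) / (2 * real s + real d)) * real J powr (p * real s / (2 * real s + real d)))
        \<le> (rs powr (d / s) / real n) powr (- (p * real s / (2 * real s + real d))) * (real K ^ d * (a * sqrt (real J)) powr p))"
    using rate_numerics[OF ds _ U1 \<beta>(1) C \<eta>, of p] p by auto
  define \<gamma> where "\<gamma> = risk_const p d"
  have \<gamma>: "\<gamma> > 0" using p by (simp add: \<gamma>_def risk_const_pos)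
  have finL: "finite L"
    using L finite_multi_indices by (meson finite_SigmaI finite_subset)
  define lst :: "('m \<Rightarrow> nat) \<times> ('n \<Rightarrow> nat) \<Rightarrow> ((real^'m) \<times> (real^'n)) list"
    where "lst l = rev (deriv_dirs (fst l) (snd l))" for l
  have lst: "set (lst l) \<subseteq> Basis" "length (lst l) = order (fst l) + order (snd l)" for l
    using set_deriv_dirs by (auto simp: lst_def length_deriv_dirs)
  have main: "\<forall>\<^sub>F n in sequentially. ennreal (\<gamma> * c0 * (real K powr (real d * real s * (2 - p) / (2 * real s + real d)) * real J powr (p * real s / (2 * real s + real d))))
        \<le> ennreal ((rs powr (d / s) / real n) powr (- (p * real s / (2 * real s + real d)))) * minimax_risk p n F"
    if K: "K \<ge> 1" and J: "J \<ge> 1" and rs: "rs > 0" and pJ: "p \<ge> 2 \<or> J = 1"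
      and base: "\<forall>(\<alpha>1, \<alpha>2)\<in>L. U ^ d / real K ^ (d + (order \<alpha>1 + order \<alpha>2)) * (3 * real K) powr (d / p) \<le> \<eta> * rs"
      and F: "\<forall>f. smooth_alg f \<longrightarrow> prob_density f \<longrightarrow> (\<forall>z. z \<notin> outer_box K \<longrightarrow> f z = 0) \<longrightarrow>
        (\<forall>(\<alpha>1, \<alpha>2)\<in>L. Lp_norm p (foldr dir_deriv (rev (deriv_dirs \<alpha>1 \<alpha>2)) f) \<le> ennreal (4 * (\<eta> * rs))) \<longrightarrow> f \<in> F"
    for K J rs and F :: "((real^'m) \<times> (real^'n) \<Rightarrow> real) set"
    using rate[OF K J rs, of "(s1 + s2) * J"] eventually_ge_at_top[of 1]
  proof eventually_elim
    case (elim n)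
    then obtain N0 a where N0: "N0 \<ge> (s1 + s2) * J" and a: "a > 0" 
      and c1: "real J * (a * U ^ d) \<le> (\<beta> / real K) ^ d / 2"
      and c2: "4 * a\<^sup>2 * (U ^ d)\<^sup>2 / 2 ^ (d * N0) \<le> (\<beta> / real K) ^ d / 2 * (1 / real n)"
      and c3: "C * (a * sqrt (real J) * 2 ^ (s * N0)) * real K powr (d / p) \<le> \<eta> * rs"
      and c4: "c0 * (real K powr (real d * real s * (2 - p) / (2 * real s + real d)) * real J powr (p * real s / (2 * real s + real d)))
        \<le> (rs powr (d / s) / real n) powr (- (p * real s / (2 * real s + real d))) * (real K ^ d * (a * sqrt (real J)) powr p)"
      by blast
    obtain n1 n2 where n12: "\<And>j. j < J \<Longrightarrow> s1 * n1 j + s2 * n2 j \<le> (s1 + s2) * N0"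
        "\<And>j. j < J \<Longrightarrow> (CARD('m) + CARD('n)) * N0 \<le> CARD('m) * n1 j + CARD('n) * n2 j"
        "\<And>j j'. j < J \<Longrightarrow> j' < J \<Longrightarrow> j \<noteq> j' \<Longrightarrow> n1 j' < n1 j \<or> n2 j' < n2 (j::nat)"
      using scale_exponents[OF s12 N0, of "CARD('m)" "CARD('n)"] by blast
    \<comment> \<open>The condition \<open>snd b = 0\<close> singles out the basis vectors of the
      first block, so each scale has one level per block.\<close>
    define N :: "nat \<Rightarrow> (real^'m) \<times> (real^'n) \<Rightarrow> nat" where "N j b = (if snd b = 0 then n1 j else n2 j)" for j b
    have basis_sum: "(\<Sum>b\<in>(Basis :: ((real^'m) \<times> (real^'n)) set). N j b) = CARD('m) * n1 j + CARD('n) * n2 j" for j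
    proof -
      have "(\<Sum>b\<in>(Basis :: ((real^'m) \<times> (real^'n)) set). N j b) = (\<Sum>b\<in>(Basis :: (real^'m) set). N j (b, 0)) + (\<Sum>b\<in>(Basis :: (real^'n) set). N j (0, b))"
        unfolding Basis_prod_def
        by (subst sum.union_disjoint) (auto simp: sum.reindex inj_on_def)
      moreover have "(\<Sum>b\<in>(Basis :: (real^'n) set). N j (0, b)) = (\<Sum>b\<in>(Basis :: (real^'n) set). n2 j)"
        by (intro sum.cong) (auto simp: N_def nonzero_Basis)
      moreover have "(\<Sum>b\<in>(Basis :: (real^'m) set). N j (b, 0)) = (\<Sum>b\<in>(Basis :: (real^'m) set). n1 j)"
        by (simp add: N_def)
      ultimately show ?thesis by simp
    qed
    have list_sum: "(\<Sum>b\<in>Basis. N j b * count_list (lst l) b) = n1 j * order (fst l) + n2 j * order (snd l)" for j l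
    proof -
      have "(\<Sum>b\<in>Basis. N j b * count_list (lst l) b) = sum_list (map (N j) (lst l))"
        by (subst sum_list_map_eq_sum_count2[OF lst(1)]) (auto simp: mult.commute)
      also have "\<dots> = sum_list (map (N j) (deriv_dirs (fst l) (snd l)))"
        by (simp add: lst_def flip: rev_map)
      also have "\<dots> = n1 j * order (fst l) + n2 j * order (snd l)"
        unfolding deriv_dirs_def map_append sum_list_append sum_list_concat_replicate
        by (simp add: N_def axis_1_neq_0 order_def sum_distrib_left mult.commute)
      finally show ?thesis .
    qed
    have c': "real J * (a * U ^ DIM((real^'m) \<times> (real^'n))) \<le> (\<beta> / real K) ^ DIM((real^'m) \<times> (real^'n)) / 2"
      "4 * a\<^sup>2 * (U ^ DIM((real^'m) \<times> (real^'n)))\<^sup>2 / 2 ^ (d * N0) \<le> (\<beta> / real K) ^ DIM((real^'m) \<times> (real^'n)) / 2 * (1 / real n)"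
      "(8 * (real (card L) + 1) * exp 1 * p powr p) powr (1 / p) * U ^ DIM((real^'m) \<times> (real^'n))
         * (a * sqrt (real J) * 2 ^ (s * N0)) * real K powr (DIM((real^'m) \<times> (real^'n)) / p) \<le> \<eta> * rs"
      unfolding dim by (rule c1 c2 c3[unfolded C_def])+
    have "ennreal (risk_const p DIM((real^'m) \<times> (real^'n)) * (real K ^ DIM((real^'m) \<times> (real^'n)) * (a * sqrt (real J)) powr p)) \<le> minimax_risk p n F"
    proof (rule minimax_lower_bound[where lst = lst and L = L and N = N and M = "d * N0" and e = "s * N0" and S = s 
          and U = U and \<beta> = \<beta> and \<epsilon> = "\<eta> * rs"])
      show "set (lst l) \<subseteq> Basis \<and> length (lst l) \<le> s" if "l \<in> L" for l
        using lst that L by (auto simp: s_def multi_indices_def intro!: add_mono)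
      show "d * N0 \<le> (\<Sum>b\<in>Basis. N j b)" if "j < J" for j
        using n12(2)[OF that] by (simp only: basis_sum d_def)
      show "(\<Sum>b\<in>Basis. N j b * count_list (lst l) b) \<le> s * N0" if l: "l \<in> L" and j: "j < J" for l j
      proof -
        have "n1 j * order (fst l) \<le> s1 * n1 j" "n2 j * order (snd l) \<le> s2 * n2 j"
          using l L by (auto simp: multi_indices_def mult.commute)
        then show ?thesis unfolding list_sum s_def using n12(1)[OF j] by linarith
      qed
      show "\<exists>b\<in>Basis. N j' b < N j b" if "j < J" "j' < J" "j \<noteq> j'" for j j'
        using n12(3)[OF that]
      proof
        assume "n1 j' < n1 j"
        then show ?thesis
          by (intro bexI[of _ "(axis undefined 1, 0)"]) (auto simp: N_def Basis_prod_def Basis_vec_def)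
      next
        assume "n2 j' < n2 j"
        then show ?thesis
          by (intro bexI[of _ "(0, axis undefined 1)"]) (auto simp: N_def axis_1_neq_0 Basis_prod_def Basis_vec_def)
      qed
      show "U ^ DIM((real^'m) \<times> (real^'n)) / real K ^ (DIM((real^'m) \<times> (real^'n)) + length (lst l)) * (3 * real K) powr (DIM((real^'m) \<times> (real^'n)) / p) \<le> \<eta> * rs"
        if "l \<in> L" for l
        using base that unfolding dim lst(2) by (cases l) auto
      show "fam J K N a A \<in> F" if A: "\<And>l. l \<in> L \<Longrightarrow> Lp_norm p (foldr dir_deriv (lst l) (fam J K N a A)) \<le> ennreal (4 * (\<eta> * rs))" for A
      proof (rule F[rule_format])
        show "smooth_alg (fam J K N a A)" by (rule smooth_alg_fam)
        show "prob_density (fam J K N a A)"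
          by (rule prob_density_fam[OF \<beta>(2,1) K U less_imp_le[OF a] c'(1)])
        show "fam J K N a A z = 0" if "z \<notin> outer_box K" for z by (rule fam_eq_0[OF that K])
        show "case l of (\<alpha>1, \<alpha>2) \<Rightarrow> Lp_norm p (foldr dir_deriv (rev (deriv_dirs \<alpha>1 \<alpha>2)) (fam J K N a A)) \<le> ennreal (4 * (\<eta> * rs))"
          if "l \<in> L" for l
          using A[OF that] by (simp add: lst_def case_prod_beta)
      qed
    qed (rule p J elim(2) K U finL \<beta> a c' pJ)+
    then have mm: "ennreal (\<gamma> * (real K ^ d * (a * sqrt (real J)) powr p)) \<le> minimax_risk p n F"
      unfolding dim \<gamma>_def .
    have "ennreal (\<gamma> * c0 * (real K powr (real d * real s * (2 - p) / (2 * real s + real d)) * real J powr (p * real s / (2 * real s + real d))))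
      \<le> ennreal (\<gamma> * ((rs powr (d / s) / real n) powr (- (p * real s / (2 * real s + real d))) * (real K ^ d * (a * sqrt (real J)) powr p)))"
      using mult_left_mono[OF c4, of \<gamma>] \<gamma> by (intro ennreal_leI) (simp only: mult.assoc less_imp_le)
    also have "\<dots> = ennreal ((rs powr (d / s) / real n) powr (- (p * real s / (2 * real s + real d)))) * ennreal (\<gamma> * (real K ^ d * (a * sqrt (real J)) powr p))"
      using \<gamma> by (simp add: mult_ac flip: ennreal_mult)
    also have "\<dots> \<le> ennreal ((rs powr (d / s) / real n) powr (- (p * real s / (2 * real s + real d)))) * minimax_risk p n F"
      by (intro mult_left_mono mm) simp
    finally show ?case .
  qed
  have "rate_lower_bound s p \<eta> L (\<gamma> * c0) (U ^ d)"
    unfolding rate_lower_bound_def Let_def d_def[symmetric] by (intro allI impI, rule main; assumption)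
  moreover have "\<gamma> * c0 > 0" using \<gamma> c0 by simp
  ultimately show ?thesis unfolding s_def by blast
qed

text \<open>The left-hand side is a multiple of \<open>K\<close> to the power
  \<open>d / p - d - len l\<close>. This exponent is negative for \<open>p > 1\<close>, and for
  \<open>p = 1\<close> as soon as a derivative is involved; for \<open>p = 1\<close> without
  derivatives it is 0 and dilation has no effect.\<close>

lemma dilation_exists:
  fixes L :: "'l set" and len :: "'l \<Rightarrow> nat" and p W \<epsilon> :: real
  assumes L: "finite L" and d: "d \<ge> 1" and p: "p \<ge> 1" and \<epsilon>: "\<epsilon> > 0" and len: "\<And>l. l \<in> L \<Longrightarrow> p > 1 \<or> len l \<ge> 1"
  shows "\<exists>K::nat\<ge>1. \<forall>l\<in>L. W / real K ^ (d + len l) * (3 * real K) powr (d / p) \<le> \<epsilon>"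
proof -
  have "\<forall>\<^sub>F K in sequentially. W / real K ^ (d + len l) * (3 * real K) powr (d / p) \<le> \<epsilon>" if l: "l \<in> L" for l
  proof -
    have neg: "d / p - real (d + len l) < 0"
    proof (cases "p > 1")
      case True
      then have "d / p < d" using d by (simp add: field_simps)
      then show ?thesis by simp
    next
      case False
      then have "p = 1" using p by simp
      then show ?thesis using len[OF l] by simp
    qed
    have "((\<lambda>K. W * 3 powr (d / p) * real K powr (d / p - real (d + len l))) \<longlongrightarrow> W * 3 powr (d / p) * 0) sequentially"
      by (intro tendsto_mult tendsto_const tendsto_neg_powr neg filterlim_real_sequentially)
    then have "\<forall>\<^sub>F K in sequentially. W * 3 powr (d / p) * real K powr (d / p - real (d + len l)) < \<epsilon>"
      by (rule order_tendstoD(2)) (use \<epsilon> in simp)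
    then show ?thesis using eventually_gt_at_top[of 0]
    proof eventually_elim
      case (elim K)
      then have "W / real K ^ (d + len l) * (3 * real K) powr (d / p) = W * 3 powr (d / p) * real K powr (d / p - real (d + len l))"
        by (simp only: powr_diff powr_mult powr_realpow of_nat_0_less_iff) simp
      then show ?case using elim by simp
    qed
  qed
  then have "\<forall>\<^sub>F K in sequentially. \<forall>l\<in>L. W / real K ^ (d + len l) * (3 * real K) powr (d / p) \<le> \<epsilon>"
    using L by (simp add: eventually_ball_finite)
  then have "\<forall>\<^sub>F K in sequentially. 1 \<le> K \<and> (\<forall>l\<in>L. W / real K ^ (d + len l) * (3 * real K) powr (d / p) \<le> \<epsilon>)"
    using eventually_ge_at_top[of 1] by eventually_elim blast
  then show ?thesis using eventually_happens'[OF sequentially_bot] by blast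
qed

lemma powr_nat_unbounded:
  fixes e x :: real
  assumes "e > 0" "x > 0" shows "\<exists>J::nat\<ge>1. x \<le> real J powr e"
proof -
  obtain J :: nat where J: "max 1 (x powr (1 / e)) \<le> real J"
    using real_arch_simple by blast
  have "x = (x powr (1 / e)) powr e" using assms by (simp add: powr_powr)
  also have "\<dots> \<le> real J powr e" using J assms by (intro powr_mono2) auto
  finally show ?thesis using J by (intro exI[of _ J]) simp
qed

section \<open>Membership in the Sobolev balls and the two parts of the theorem\<close>

lemma deriv_dirs_0: "deriv_dirs (\<lambda>_. 0) (\<lambda>_. 0) = []"
  by (simp add: deriv_dirs_def)

lemma multi_order_eq_0_iff: "order \<alpha> = 0 \<longleftrightarrow> \<alpha> = (\<lambda>_. 0)"
  by (auto simp: order_def fun_eq_iff)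

lemma Lp_norm_1_prob_density: "prob_density f \<Longrightarrow> Lp_norm 1 f = 1"
  by (simp add: Lp_norm_def ennreal_powr_def prob_density_def)

theorem theorem3p6:
  fixes s1 s2 :: nat and S D :: real
  assumes "s1 \<ge> 1" and "s2 \<ge> 1"
    and "S = real s1 + real s2"
    and "D = real CARD('m::finite) + real CARD('n::finite)"
  shows
    "(\<forall>p::real. 2 \<le> p \<longrightarrow>
        (\<exists>c::real. c > 0 \<and> (\<forall>r::real. r > 0 \<longrightarrow>
           liminf (\<lambda>n. ennreal ((r powr (D / S) / real n) powr (- (p * S / (2 * S + D)))) *
               minimax_risk p n
                 (sobolev_densities p s1 s2 r :: ((real^'m) \<times> (real^'n) \<Rightarrow> real) set))
             \<ge> ennreal c)))
     \<and>
     (\<forall>p::real. 1 \<le> p \<and> p < 2 \<longrightarrow>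
        (\<exists>c::real. c > 0 \<and> (\<forall>r rs::real. r > 0 \<and> (p = 1 \<longrightarrow> r > 1) \<and>
             rs = (if p = 1 then r - 1 else r) \<longrightarrow>
           (\<exists>R0::real. R0 > 0 \<and> (\<forall>R::real. R \<ge> R0 \<longrightarrow>
             liminf (\<lambda>n. ennreal ((rs powr (D / S) / real n) powr (- (S * p / (2 * S + D)))) *
                 minimax_risk p n
                   (sobolev_densities_supp p s1 s2 r R :: ((real^'m) \<times> (real^'n) \<Rightarrow> real) set))
               \<ge> ennreal c)))))"
proof -
  define d where "d = CARD('m) + CARD('n)"
  define s where "s = s1 + s2"
  have ds: "d \<ge> 1" "s \<ge> 1" using assms(1) by (simp_all add: d_def s_def Suc_leI)
  have SD: "S = real s" "D = real d" using assms(3,4) by (simp_all add: d_def s_def)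
  define Lall :: "(('m \<Rightarrow> nat) \<times> ('n \<Rightarrow> nat)) set" where "Lall = multi_indices s1 \<times> multi_indices s2"
  have finL: "finite Lall" unfolding Lall_def by (intro finite_SigmaI finite_multi_indices)
  have zero_in: "((\<lambda>_. 0), (\<lambda>_. 0)) \<in> Lall" by (simp add: Lall_def multi_indices_def order_def)
  define m where "m = card Lall"
  have m: "m > 0" using zero_in finL by (auto simp: m_def card_gt_0_iff)
  \<comment> \<open>The 4 cancels the factor from \<open>Lp_norm_add_le\<close>, and
    \<open>m\<close> is the number of summands of the Sobolev norm, so all derivatives together stay
    within \<open>rs\<close>.\<close>
  define \<eta> where "\<eta> = 1 / (4 * real m)"
  have \<eta>: "\<eta> > 0" using m by (simp add: \<eta>_def)
  \<comment> \<open>For \<open>p = 1\<close> the undifferentiated term is left out: it is the mass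
    of a density and equals 1, and the remaining terms share the budget
    \<open>r - 1\<close>.\<close>
  define L where "L p = (if p = (1::real) then Lall - {((\<lambda>_. 0), (\<lambda>_. 0))} else Lall)" for p
  have L_sub: "L p \<subseteq> multi_indices s1 \<times> multi_indices s2" for p by (auto simp: L_def Lall_def)
  have L_len: "p > 1 \<or> order \<alpha>1 + order \<alpha>2 \<ge> 1" if "(\<alpha>1, \<alpha>2) \<in> L p" "p \<ge> 1" for p \<alpha>1 \<alpha>2
  proof (cases "p = 1")
    case True
    then have "order \<alpha>1 \<noteq> 0 \<or> order \<alpha>2 \<noteq> 0" using that by (auto simp: L_def multi_order_eq_0_iff)
    then show ?thesis by linarith
  next
    case False
    then show ?thesis using that by simp
  qed
  have in_class: "f \<in> sobolev_densities p s1 s2 r"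
    if f: "smooth_alg f" "prob_density f" "\<forall>z. z \<notin> outer_box K \<longrightarrow> f z = 0"
      and Lp: "\<forall>(\<alpha>1, \<alpha>2)\<in>L p. Lp_norm p (foldr dir_deriv (rev (deriv_dirs \<alpha>1 \<alpha>2)) f) \<le> ennreal (4 * (\<eta> * rs))"
      and rs: "rs > 0" "rs = (if p = 1 then r - 1 else r)"
    for f :: "(real^'m) \<times> (real^'n) \<Rightarrow> real" and p r rs :: real and K
  proof -
    obtain R where R: "outer_box K \<subseteq> ball (0 :: (real^'m) \<times> (real^'n)) R"
      using bounded_subset_ballD[of "outer_box K" 0] by (auto simp: outer_box_def)
    define g where "g l = Lp_norm p (foldr dir_deriv (rev (deriv_dirs (fst l) (snd l))) f)" for l
    have sum_le: "(\<Sum>l\<in>L p. g l) \<le> ennreal rs"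
    proof -
      have "(\<Sum>l\<in>L p. g l) \<le> (\<Sum>l\<in>L p. ennreal (4 * (\<eta> * rs)))"
        using Lp by (intro sum_mono) (auto simp: g_def)
      also have "\<dots> \<le> (\<Sum>l\<in>Lall. ennreal (4 * (\<eta> * rs)))"
        by (intro sum_mono2 finL) (auto simp: L_def)
      also have "\<dots> = ennreal (real m * (4 * (\<eta> * rs)))"
        using \<eta> rs by (simp add: m_def ennreal_mult ennreal_of_nat_eq_real_of_nat)
      also have "real m * (4 * (\<eta> * rs)) = rs" using m by (simp add: \<eta>_def)
      finally show ?thesis .
    qed
    have "(\<Sum>l\<in>Lall. g l) \<le> ennreal r"
    proof (cases "p = 1")
      case True
      have "(\<Sum>l\<in>Lall. g l) = g ((\<lambda>_. 0), (\<lambda>_. 0)) + (\<Sum>l\<in>L p. g l)"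
        using sum.remove[OF finL zero_in, of g] True by (simp add: L_def)
      also have "g ((\<lambda>_. 0), (\<lambda>_. 0)) = 1" using True f by (simp add: g_def deriv_dirs_0 Lp_norm_1_prob_density)
      also have "1 + (\<Sum>l\<in>L p. g l) \<le> ennreal 1 + ennreal rs" using sum_le by (auto intro: add_mono)
      also have "\<dots> = ennreal (1 + rs)" using rs(1) by (intro ennreal_plus[symmetric]) auto
      also have "1 + rs = r" using rs(2) True by simp
      finally show ?thesis .
    next
      case False
      then show ?thesis using sum_le rs by (simp add: L_def)
    qed
    then have "(\<Sum>(\<alpha>1, \<alpha>2) \<in> multi_indices s1 \<times> multi_indices s2.
        Lp_norm p (foldr dir_deriv (rev (deriv_dirs \<alpha>1 \<alpha>2)) f)) \<le> ennreal r"
      by (simp add: Lall_def g_def case_prod_beta')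
    moreover have "f z = 0" if "norm z > R" for z
    proof -
      have "z \<notin> outer_box K" using that R by force
      then show ?thesis using f(3) by blast
    qed
    ultimately show ?thesis using f(1,2) by (intro sobolev_densitiesI[where R = R])
  qed
  show ?thesis
  proof (intro conjI allI impI)
    fix p :: real assume p: "2 \<le> p"
    then have p1: "p \<ge> 1" by simp
    obtain c W where cW: "c > 0" and "rate_lower_bound s p \<eta> (L p) c W"
      using minimax_rate[OF assms(1,2) p1 \<eta> L_sub[of p]] unfolding s_def by blast
    note rate = rate_lower_boundD[OF this(2), folded d_def]
    show "\<exists>c::real. c > 0 \<and> (\<forall>r::real. r > 0 \<longrightarrow>
           liminf (\<lambda>n. ennreal ((r powr (D / S) / real n) powr (- (p * S / (2 * S + D)))) *
               minimax_risk p n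
                 (sobolev_densities p s1 s2 r :: ((real^'m) \<times> (real^'n) \<Rightarrow> real) set))
             \<ge> ennreal c)"
    \<comment> \<open>Any positive number could serve as witness here: \<open>J\<close> is chosen
      after \<open>r\<close> and makes the lower bound as large as desired.\<close>
    proof (intro exI[of _ 1] conjI allI impI)
      fix r :: real assume r: "r > 0"
      obtain K :: nat where K: "K \<ge> 1" "\<forall>l\<in>L p. W / real K ^ (d + (order (fst l) + order (snd l))) * (3 * real K) powr (d / p) \<le> \<eta> * r"
        using dilation_exists[of "L p" d p "\<eta> * r" "\<lambda>l. order (fst l) + order (snd l)" W] finite_subset[OF L_sub finL[unfolded Lall_def]]
          ds p \<eta> r by auto
      \<comment> \<open>The factor caused by dilation. Its exponent is negative for
        \<open>p > 2\<close>, so it degrades as small \<open>r\<close> forces large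
        \<open>K\<close>; the power of \<open>J\<close> makes up for it.\<close>
      define k where "k = c * real K powr (real d * real s * (2 - p) / (2 * real s + real d))"
      have k: "k > 0" using cW K by (simp add: k_def)
      have e: "p * real s / (2 * real s + real d) > 0" using p ds by simp
      obtain J :: nat where J: "1 \<le> J" "1 / k \<le> real J powr (p * real s / (2 * real s + real d))"
        using powr_nat_unbounded[OF e, of "1 / k"] k by auto
      have "1 \<le> k * real J powr (p * real s / (2 * real s + real d))" using J(2) k by (simp add: field_simps)
      then have one: "ennreal 1 \<le> ennreal (c * (real K powr (real d * real s * (2 - p) / (2 * real s + real d)) * real J powr (p * real s / (2 * real s + real d))))"
        by (intro ennreal_leI) (simp add: k_def mult.assoc)
      have "\<forall>\<^sub>F n in sequentially. ennreal (c * (real K powr (real d * real s * (2 - p) / (2 * real s + real d)) * real J powr (p * real s / (2 * real s + real d))))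
        \<le> ennreal ((r powr (d / s) / real n) powr (- (p * real s / (2 * real s + real d)))) 
          * minimax_risk p n (sobolev_densities p s1 s2 r :: ((real^'m) \<times> (real^'n) \<Rightarrow> real) set)"
      proof (rule rate[OF K(1) J(1) r])
        show "\<forall>(\<alpha>1, \<alpha>2)\<in>L p. W / real K ^ (d + (order \<alpha>1 + order \<alpha>2)) * (3 * real K) powr (d / p) \<le> \<eta> * r"
          using K(2) by auto
        show "\<forall>f :: (real^'m) \<times> (real^'n) \<Rightarrow> real. smooth_alg f \<longrightarrow> prob_density f \<longrightarrow> (\<forall>z. z \<notin> outer_box K \<longrightarrow> f z = 0) \<longrightarrow>
            (\<forall>(\<alpha>1, \<alpha>2)\<in>L p. Lp_norm p (foldr dir_deriv (rev (deriv_dirs \<alpha>1 \<alpha>2)) f) \<le> ennreal (4 * (\<eta> * r))) 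
            \<longrightarrow> f \<in> sobolev_densities p s1 s2 r"
        proof (intro allI impI)
          fix f :: "(real^'m) \<times> (real^'n) \<Rightarrow> real"
          assume f: "smooth_alg f" "prob_density f" "\<forall>z. z \<notin> outer_box K \<longrightarrow> f z = 0"
            "\<forall>(\<alpha>1, \<alpha>2)\<in>L p. Lp_norm p (foldr dir_deriv (rev (deriv_dirs \<alpha>1 \<alpha>2)) f) \<le> ennreal (4 * (\<eta> * r))"
          show "f \<in> sobolev_densities p s1 s2 r" using in_class[OF f r] p by simp
        qed
      qed (use p in simp)
      then show "ennreal 1 \<le> liminf (\<lambda>n. ennreal ((r powr (D / S) / real n) powr (- (p * S / (2 * S + D)))) *
               minimax_risk p n (sobolev_densities p s1 s2 r :: ((real^'m) \<times> (real^'n) \<Rightarrow> real) set))"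
        unfolding SD by (intro Liminf_bounded) (erule eventually_mono, erule order_trans[OF one])
    qed simp
  next
    fix p :: real assume p: "1 \<le> p \<and> p < 2"
    then have p1: "p \<ge> 1" by simp
    obtain c W where cW: "c > 0" and "rate_lower_bound s p \<eta> (L p) c W"
      using minimax_rate[OF assms(1,2) p1 \<eta> L_sub[of p]] unfolding s_def by blast
    note rate = rate_lower_boundD[OF this(2), folded d_def]
    show "\<exists>c::real. c > 0 \<and> (\<forall>r rs::real. r > 0 \<and> (p = 1 \<longrightarrow> r > 1) \<and>
             rs = (if p = 1 then r - 1 else r) \<longrightarrow>
           (\<exists>R0::real. R0 > 0 \<and> (\<forall>R::real. R \<ge> R0 \<longrightarrow>
             liminf (\<lambda>n. ennreal ((rs powr (D / S) / real n) powr (- (S * p / (2 * S + D)))) *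
                 minimax_risk p n
                   (sobolev_densities_supp p s1 s2 r R :: ((real^'m) \<times> (real^'n) \<Rightarrow> real) set))
               \<ge> ennreal c)))"
    proof (rule exI[of _ c], intro conjI allI impI)
      fix r rs :: real assume r: "r > 0 \<and> (p = 1 \<longrightarrow> r > 1) \<and> rs = (if p = 1 then r - 1 else r)"
      then have rs: "rs > 0" by auto
      obtain K :: nat where K: "K \<ge> 1" "\<forall>l\<in>L p. W / real K ^ (d + (order (fst l) + order (snd l))) * (3 * real K) powr (d / p) \<le> \<eta> * rs"
        using dilation_exists[of "L p" d p "\<eta> * rs" "\<lambda>l. order (fst l) + order (snd l)" W] finite_subset[OF L_sub finL[unfolded Lall_def]]
          ds p \<eta> rs L_len[where p = p] by fastforce
      \<comment> \<open>All perturbed densities vanish outside \<open>outer_box K\<close>, so the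
        radius of a ball around this box is large enough. It depends on \<open>r\<close> through
        \<open>K\<close>, unlike \<open>c\<close>.\<close>
      obtain R0 where R0: "R0 > 0" "outer_box K \<subseteq> ball (0 :: (real^'m) \<times> (real^'n)) R0"
        using bounded_subset_ballD[of "outer_box K" 0] by (auto simp: outer_box_def)
      \<comment> \<open>For \<open>p < 2\<close> the exponent of \<open>K\<close> is positive, so
        dilation can only help, and \<open>J = 1\<close> suffices.\<close>
      have one: "ennreal c \<le> ennreal (c * (real K powr (real d * real s * (2 - p) / (2 * real s + real d)) * real 1 powr (p * real s / (2 * real s + real d))))"
      proof -
        have "1 \<le> real K powr (real d * real s * (2 - p) / (2 * real s + real d))" using K p by (intro ge_one_powr_ge_zero) auto
        then show ?thesis using cW by (intro ennreal_leI) simp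
      qed
      have "ennreal c \<le> liminf (\<lambda>n. ennreal ((rs powr (D / S) / real n) powr (- (S * p / (2 * S + D)))) *
                 minimax_risk p n (sobolev_densities_supp p s1 s2 r R :: ((real^'m) \<times> (real^'n) \<Rightarrow> real) set))"
        if R: "R \<ge> R0" for R
      proof -
        have "\<forall>\<^sub>F n in sequentially. ennreal (c * (real K powr (real d * real s * (2 - p) / (2 * real s + real d)) * real 1 powr (p * real s / (2 * real s + real d))))
          \<le> ennreal ((rs powr (d / s) / real n) powr (- (p * real s / (2 * real s + real d)))) 
            * minimax_risk p n (sobolev_densities_supp p s1 s2 r R :: ((real^'m) \<times> (real^'n) \<Rightarrow> real) set)"
        proof (rule rate[OF K(1) _ rs])
          show "\<forall>(\<alpha>1, \<alpha>2)\<in>L p. W / real K ^ (d + (order \<alpha>1 + order \<alpha>2)) * (3 * real K) powr (d / p) \<le> \<eta> * rs"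
            using K(2) by auto
          show "\<forall>f :: (real^'m) \<times> (real^'n) \<Rightarrow> real. smooth_alg f \<longrightarrow> prob_density f \<longrightarrow> (\<forall>z. z \<notin> outer_box K \<longrightarrow> f z = 0) \<longrightarrow>
            (\<forall>(\<alpha>1, \<alpha>2)\<in>L p. Lp_norm p (foldr dir_deriv (rev (deriv_dirs \<alpha>1 \<alpha>2)) f) \<le> ennreal (4 * (\<eta> * rs))) 
            \<longrightarrow> f \<in> sobolev_densities_supp p s1 s2 r R"
          proof (intro allI impI)
            fix f :: "(real^'m) \<times> (real^'n) \<Rightarrow> real"
            assume f: "smooth_alg f" "prob_density f" "\<forall>z. z \<notin> outer_box K \<longrightarrow> f z = 0"
              "\<forall>(\<alpha>1, \<alpha>2)\<in>L p. Lp_norm p (foldr dir_deriv (rev (deriv_dirs \<alpha>1 \<alpha>2)) f) \<le> ennreal (4 * (\<eta> * rs))"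
            have "{z. f z \<noteq> 0} \<subseteq> cball 0 R" using f(3) R0(2) R by force
            then have "supp f \<subseteq> cball 0 R" unfolding supp_def by (rule closure_minimal) simp
            then show "f \<in> sobolev_densities_supp p s1 s2 r R"
              unfolding sobolev_densities_supp_def using in_class[OF f rs] r by blast
          qed
        qed simp_all
        then show ?thesis
          unfolding SD mult.commute[of "real s" p]
          by (intro Liminf_bounded) (erule eventually_mono, erule order_trans[OF one])
      qed
      with R0(1) show "\<exists>R0::real. R0 > 0 \<and> (\<forall>R::real. R \<ge> R0 \<longrightarrow>
             liminf (\<lambda>n. ennreal ((rs powr (D / S) / real n) powr (- (S * p / (2 * S + D)))) *
                 minimax_risk p n
                   (sobolev_densities_supp p s1 s2 r R :: ((real^'m) \<times> (real^'n) \<Rightarrow> real) set))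
               \<ge> ennreal c)" by blast
    qed (rule cW)
  qed
qed

end
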